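(* Let $0<\rho<1$, $l>0$, $T>0$. Let $\sigma,q:[0,T]\to\mathbb{R}$, $f:[0,l]\times[0,T]\to\mathbb{R}$, $\phi:[0,l]\to\mathbb{R}$ and constants $m_\sigma,M_\sigma,n_q,N_q$ satisfy: (1) $\sigma\in C[0,T]$ and $0<m_\sigma\le\sigma(t)\le M_\sigma$ for all $t\in[0,T]$; (2) $q\in C[0,T]$ and $-\frac{m_\sigma\pi^2}{l^2}<n_q\le q(t)\le N_q<\frac{(M_\sigma-m_\sigma)\pi^2}{l^2}$ for all $t\in[0,T]$; (3) $f\in C([0,T];W_2^3(0,l))$ with $f(0,t)=f(l,t)=f_{xx}(0,t)=f_{xx}(l,t)=0$ for all $t\in[0,T]$; (4) $\phi\in W_2^1(0,l)$ with $\phi(0)=\phi(l)=0$. Then the initial-boundary value problem $$D_t^\rho u(x,t)-\sigma(t)u_{xx}(x,t)+q(t)u(x,t)=f(x,t),\quad (x,t)\in(0,l)\times(0,T],$$ $$u(x,0)=\phi(x),\ x\in[0,l],\qquad u(0,t)=u(l,t)=0,\ t\in[0,T],$$ has a unique classical solution $u(x,t)$.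
   Context: $D_t^\rho$ is the Gerasimov–Caputo fractional derivative of order $\rho\in(0,1)$ in $t$: $D_t^\rho h(t)=\frac{1}{\Gamma(1-\rho)}\int_0^t\frac{h'(\eta)}{(t-\eta)^\rho}\,d\eta$, $t>0$, provided the right-hand side exists. A classical solution of the problem is a function $u\in C([0,T]\times[0,l])$ such that $D_t^\rho u,\ u_{xx}\in C((0,T]\times[0,l])$ and which satisfies the equation, the initial condition and the boundary conditions. $W_2^m(0,l)$ is the Sobolev space of functions with weak derivatives up to order $m$ in $L_2(0,l)$.
   Formalization: In the Gerasimov–Caputo derivative, h'(η)dη is read as the Stieltjes differential dh(η), with the integral improper at η=t; with a pointwise h' existence fails, since for σ, q, f merely continuous in t the solution may be nowhere differentiable in t. *)

theory Defs
  imports "HOL-Analysis.Analysis"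
begin

section \<open>The Gerasimov--Caputo derivative\<close>

text \<open>
  The Riemann--Stieltjes integral of g with respect to dh over [a, b]: the limit of the tagged
  sums as the mesh of the partition tends to 0.
\<close>

definition has_RS_integral ::
    "(real \<Rightarrow> real) \<Rightarrow> (real \<Rightarrow> real) \<Rightarrow> real \<Rightarrow> real \<Rightarrow> real \<Rightarrow> bool" where
  "has_RS_integral g h a b I \<longleftrightarrow>
    (\<forall>e>0. \<exists>d>0. \<forall>(n::nat) (p::nat \<Rightarrow> real) (\<xi>::nat \<Rightarrow> real).
       p 0 = a \<and> p n = b \<and>
       (\<forall>i<n. p i \<le> p (Suc i) \<and> p (Suc i) - p i < d \<and> \<xi> i \<in> {p i..p (Suc i)}) \<longrightarrow>
       \<bar>(\<Sum>i<n. g (\<xi> i) * (h (p (Suc i)) - h (p i))) - I\<bar> < e)"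

text \<open>
  \<open>has_caputo_deriv \<rho> h t D\<close>: the integral of h'(\<eta>) / (t - \<eta>)^\<rho> over (0, t), divided by
  \<open>\<Gamma>(1 - \<rho>)\<close>, exists and equals \<open>D\<close>.  Here h'(\<eta>) d\<eta> is read as the Stieltjes differential dh(\<eta>),
  and the integral is improper at \<open>\<eta> = t\<close>, the only singularity of the kernel.  Whenever the
  formula makes sense with the pointwise derivative h', both readings give the same value
  (lemma \<open>has_caputo_derivI\<close> below).

  The pointwise reading is too narrow for coefficients and data that are merely continuous in
  time.  Take \<open>\<sigma> = 1\<close>, \<open>q = 0\<close>, \<open>\<phi> = 0\<close>, \<open>l = \<pi>\<close>, let J be the Riemann--Liouville integral of
  order \<open>\<rho>\<close>, and f(x,t) = (g + J g)(t) sin x with g continuous and J g nowhere differentiable.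
  Then u(x,t) = (J g)(t) sin x is the only candidate for a solution, with derivative of order
  \<open>\<rho>\<close> equal to g(t) sin x, but it has no pointwise derivative in t.  If, on the other
  hand, h' is only asked to exist almost everywhere, singular functions (of Cantor type) destroy
  uniqueness.
\<close>

definition has_caputo_deriv :: "real \<Rightarrow> (real \<Rightarrow> real) \<Rightarrow> real \<Rightarrow> real \<Rightarrow> bool" where
  "has_caputo_deriv \<rho> h t D \<longleftrightarrow>
    (\<exists>J. (\<forall>s\<in>{0<..<t}. has_RS_integral (\<lambda>\<eta>. 1 / (t - \<eta>) powr \<rho>) h 0 s (J s)) \<and>
         ((\<lambda>s. 1 / Gamma (1 - \<rho>) * J s) \<longlongrightarrow> D) (at_left t))"

lemma has_RS_integral_by_parts:
  fixes g h g' :: "real \<Rightarrow> real"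
  assumes ab: "a \<le> b" and h: "continuous_on {a..b} h"
    and g: "\<And>x. x \<in> {a..b} \<Longrightarrow> (g has_real_derivative g' x) (at x within {a..b})"
    and g': "continuous_on {a..b} g'"
  shows "has_RS_integral g h a b (g b * h b - g a * h a - integral {a..b} (\<lambda>x. g' x * h x))"
proof -
  obtain B where B: "\<And>x. x \<in> {a..b} \<Longrightarrow> \<bar>g' x\<bar> \<le> B" "B > 0"
  proof -
    have "bounded (g' ` {a..b})"
      using compact_continuous_image[OF g'] compact_imp_bounded by blast
    then show ?thesis
      using that unfolding bounded_pos by (metis imageI real_norm_def)
  qed
  have lip: "\<bar>g x - g y\<bar> \<le> B * \<bar>x - y\<bar>" if "x \<in> {a..b}" "y \<in> {a..b}" for x y
    using field_differentiable_bound[of "{a..b}" g g' B x y] g B that by auto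
  have uc: "uniformly_continuous_on {a..b} h"
    using h compact_uniformly_continuous by blast
  have gh_int: "(\<lambda>x. g' x * h x) integrable_on {c..d}" and g'_int: "g' integrable_on {c..d}"
    if "a \<le> c" "d \<le> b" for c d
    using that by (auto intro!: integrable_continuous_interval continuous_intros
        intro: continuous_on_subset[OF g'] continuous_on_subset[OF h])
  show ?thesis
    unfolding has_RS_integral_def
  proof (intro allI impI)
    fix e :: real assume "e > 0"
    define e' where "e' = e / (2 * B * (b - a + 1))"
    have "e' > 0" using \<open>e > 0\<close> B ab by (simp add: e'_def)
    then obtain d where d: "d > 0" "\<And>x y. \<lbrakk>x \<in> {a..b}; y \<in> {a..b}; \<bar>x - y\<bar> < d\<rbrakk> \<Longrightarrow> \<bar>h x - h y\<bar> < e'"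
      using uc unfolding uniformly_continuous_on_def dist_real_def by metis
    show "\<exists>d>0. \<forall>(n::nat) p \<xi>. p 0 = a \<and> p n = b \<and>
       (\<forall>i<n. p i \<le> p (Suc i) \<and> p (Suc i) - p i < d \<and> \<xi> i \<in> {p i..p (Suc i)}) \<longrightarrow>
       \<bar>(\<Sum>i<n. g (\<xi> i) * (h (p (Suc i)) - h (p i))) -
         (g b * h b - g a * h a - integral {a..b} (\<lambda>x. g' x * h x))\<bar> < e"
    proof (intro exI[of _ d] conjI allI impI d(1))
      fix n :: nat and p \<xi> :: "nat \<Rightarrow> real"
      assume "p 0 = a \<and> p n = b \<and>
        (\<forall>i<n. p i \<le> p (Suc i) \<and> p (Suc i) - p i < d \<and> \<xi> i \<in> {p i..p (Suc i)})"
      then have p0: "p 0 = a" and pn: "p n = b"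
        and p: "\<And>i. i < n \<Longrightarrow> p i \<le> p (Suc i)" "\<And>i. i < n \<Longrightarrow> p (Suc i) - p i < d"
          "\<And>i. i < n \<Longrightarrow> \<xi> i \<in> {p i..p (Suc i)}"
        by auto
      have mono: "j \<le> n \<Longrightarrow> i \<le> j \<Longrightarrow> p i \<le> p j" for i j
      proof (induction j)
        case (Suc j)
        then show ?case using p(1)[of j] by (cases "i = Suc j") auto
      qed simp
      have pab: "p i \<in> {a..b}" if "i \<le> n" for i
        using mono[of n i] mono[of i 0] that p0 pn by auto
      define K where "K i = integral {p i..p (Suc i)} (\<lambda>x. g' x * h x)" for i
      have intsum: "k \<le> n \<Longrightarrow> integral {a..p k} (\<lambda>x. g' x * h x) = (\<Sum>i<k. K i)" for k
      proof (induction k)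
        case (Suc k)
        have "integral {a..p (Suc k)} (\<lambda>x. g' x * h x) =
            integral {a..p k} (\<lambda>x. g' x * h x) + K k"
          unfolding K_def using Suc.prems pab[of k] pab[of "Suc k"] p(1)[of k]
          by (intro Henstock_Kurzweil_Integration.integral_combine[symmetric] gh_int) auto
        then show ?case using Suc by simp
      qed (simp add: p0)
      have tele: "(\<Sum>i<n. g (p (Suc i)) * h (p (Suc i)) - g (p i) * h (p i)) = g b * h b - g a * h a"
        using sum_lessThan_telescope[of "\<lambda>i. g (p i) * h (p i)" n] p0 pn by simp
      have step: "\<bar>g (\<xi> i) * (h (p (Suc i)) - h (p i)) -
          (g (p (Suc i)) * h (p (Suc i)) - g (p i) * h (p i) - K i)\<bar>
          \<le> 2 * B * e' * (p (Suc i) - p i)" if i: "i < n" for i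
      proof -
        let ?c = "p i" and ?d = "p (Suc i)"
        have cd: "?c \<le> ?d" "?c \<in> {a..b}" "?d \<in> {a..b}" "\<xi> i \<in> {?c..?d}" "?d - ?c < d"
          using p[OF i] pab[of i] pab[of "Suc i"] i by auto
        have ftc: "(g' has_integral (g ?d - g ?c)) {?c..?d}"
          using cd g by (intro fundamental_theorem_of_calculus)
            (auto simp: has_real_derivative_iff_has_vector_derivative[symmetric]
              intro: DERIV_subset[of _ _ _ "{a..b}"])
        have "((\<lambda>x. g' x * h x - g' x * h ?c) has_integral (K i - (g ?d - g ?c) * h ?c)) {?c..?d}"
          unfolding K_def using cd
          by (intro has_integral_diff has_integral_mult_left ftc integrable_integral gh_int) auto
        then have "((\<lambda>x. g' x * (h x - h ?c)) has_integral (K i - (g ?d - g ?c) * h ?c)) {?c..?d}"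
          by (simp add: algebra_simps)
        moreover have "norm (g' x * (h x - h ?c)) \<le> B * e'" if "x \<in> {?c..?d}" for x
          unfolding real_norm_def abs_mult
          using that cd B(1)[of x] less_imp_le[OF d(2)[of x ?c]]
          by (intro mult_mono) auto
        ultimately have 1: "\<bar>K i - (g ?d - g ?c) * h ?c\<bar> \<le> B * e' * (?d - ?c)"
          using has_integral_bound[of "B * e'" "\<lambda>x. g' x * (h x - h ?c)" _ ?c ?d] cd B(2) \<open>e' > 0\<close>
          by auto
        have "\<bar>g (\<xi> i) - g ?d\<bar> * \<bar>h ?d - h ?c\<bar> \<le> (B * (?d - ?c)) * e'"
        proof (intro mult_mono)
          have "\<bar>g (\<xi> i) - g ?d\<bar> \<le> B * \<bar>\<xi> i - ?d\<bar>" using lip[of "\<xi> i" ?d] cd by auto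
          also have "\<dots> \<le> B * (?d - ?c)" using cd B(2) by auto
          finally show "\<bar>g (\<xi> i) - g ?d\<bar> \<le> B * (?d - ?c)" .
          show "\<bar>h ?d - h ?c\<bar> \<le> e'" using d(2)[of ?d ?c] cd by auto
        qed (use cd B in auto)
        then have 2: "\<bar>(g (\<xi> i) - g ?d) * (h ?d - h ?c)\<bar> \<le> B * e' * (?d - ?c)"
          by (simp add: abs_mult mult_ac)
        have "g (\<xi> i) * (h ?d - h ?c) - (g ?d * h ?d - g ?c * h ?c - K i) =
           (g (\<xi> i) - g ?d) * (h ?d - h ?c) + (K i - (g ?d - g ?c) * h ?c)"
          by (simp add: algebra_simps)
        then show ?thesis using 1 2 by linarith
      qed
      have "\<bar>(\<Sum>i<n. g (\<xi> i) * (h (p (Suc i)) - h (p i))) -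
         (g b * h b - g a * h a - integral {a..b} (\<lambda>x. g' x * h x))\<bar> =
        \<bar>\<Sum>i<n. g (\<xi> i) * (h (p (Suc i)) - h (p i)) -
          (g (p (Suc i)) * h (p (Suc i)) - g (p i) * h (p i) - K i)\<bar>"
        using intsum[of n] pn by (simp add: tele[symmetric] sum_subtractf)
      also have "\<dots> \<le> (\<Sum>i<n. 2 * B * e' * (p (Suc i) - p i))"
        by (rule order_trans[OF sum_abs sum_mono]) (use step in auto)
      also have "\<dots> = 2 * B * e' * (b - a)"
        using sum_lessThan_telescope[of p n] p0 pn by (simp add: sum_distrib_left[symmetric])
      also have "\<dots> < 2 * B * e' * (b - a + 1)"
        using B \<open>e' > 0\<close> by simp
      also have "\<dots> = e" using B ab by (simp add: e'_def)
      finally show "\<bar>(\<Sum>i<n. g (\<xi> i) * (h (p (Suc i)) - h (p i))) -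
         (g b * h b - g a * h a - integral {a..b} (\<lambda>x. g' x * h x))\<bar> < e" .
    qed
  qed
qed

theorem has_caputo_derivI:
  fixes h h' :: "real \<Rightarrow> real"
  assumes t: "t > 0" and h: "continuous_on {0..t} h"
    and h': "\<And>\<eta>. \<eta> \<in> {0<..<t} \<Longrightarrow> (h has_real_derivative h' \<eta>) (at \<eta>)"
    and I: "((\<lambda>\<eta>. h' \<eta> / (t - \<eta>) powr \<rho>) has_integral I) {0..t}"
  shows "has_caputo_deriv \<rho> h t (1 / Gamma (1 - \<rho>) * I)"
proof -
  let ?F = "\<lambda>\<eta>. h' \<eta> / (t - \<eta>) powr \<rho>"
  let ?g = "\<lambda>\<eta>. 1 / (t - \<eta>) powr \<rho>"
  let ?g' = "\<lambda>\<eta>. \<rho> * (t - \<eta>) powr (- \<rho> - 1)"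
  have Fint: "?F integrable_on {0..t}" using I by blast
  have geq: "?g = (\<lambda>\<eta>. (t - \<eta>) powr (- \<rho>))"
    by (simp add: powr_minus_divide)
  have gd: "(?g has_real_derivative ?g' x) (at x)" if "x < t" for x
    unfolding geq using that by (auto intro!: derivative_eq_intros simp: powr_diff)
  have RS: "has_RS_integral ?g h 0 s (integral {0..s} ?F)" if s: "s \<in> {0<..<t}" for s
  proof -
    have hs: "continuous_on {0..s} h" using h s by (auto intro: continuous_on_subset)
    have g's: "continuous_on {0..s} ?g'" using s by (auto intro!: continuous_intros)
    have gs: "continuous_on {0..s} ?g"
      using s by (auto intro!: continuous_intros)
    have "((\<lambda>x. ?g' x * h x + ?g x * h' x) has_integral (?g s * h s - ?g 0 * h 0)) {0..s}"
    proof (rule fundamental_theorem_of_calculus_interior)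
      show "continuous_on {0..s} (\<lambda>x. ?g x * h x)"
        by (intro continuous_on_mult gs hs)
      fix x assume x: "x \<in> {0<..<s}"
      have "((\<lambda>x. ?g x * h x) has_real_derivative (?g' x * h x + h' x * ?g x)) (at x)"
        using x s by (intro DERIV_mult gd h') auto
      then show "((\<lambda>x. ?g x * h x) has_vector_derivative (?g' x * h x + ?g x * h' x)) (at x)"
        by (simp add: has_real_derivative_iff_has_vector_derivative mult.commute)
    qed (use s in auto)
    moreover have "(\<lambda>x. ?g' x * h x) integrable_on {0..s}"
      by (intro integrable_continuous_interval continuous_on_mult g's hs)
    ultimately have "((\<lambda>x. (?g' x * h x + ?g x * h' x) - ?g' x * h x) has_integral
        (?g s * h s - ?g 0 * h 0 - integral {0..s} (\<lambda>x. ?g' x * h x))) {0..s}"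
      by (intro has_integral_diff integrable_integral)
    then have "(?F has_integral
        (?g s * h s - ?g 0 * h 0 - integral {0..s} (\<lambda>x. ?g' x * h x))) {0..s}"
      by simp
    then have "integral {0..s} ?F = ?g s * h s - ?g 0 * h 0 - integral {0..s} (\<lambda>x. ?g' x * h x)"
      by (rule integral_unique)
    moreover have "has_RS_integral ?g h 0 s
        (?g s * h s - ?g 0 * h 0 - integral {0..s} (\<lambda>x. ?g' x * h x))"
      using s by (intro has_RS_integral_by_parts hs g's) (auto intro: DERIV_subset[OF gd])
    ultimately show ?thesis by simp
  qed
  have "continuous_on {0..t} (\<lambda>s. integral {0..s} ?F)"
    by (rule indefinite_integral_continuous_1[OF Fint])
  then have "((\<lambda>s. integral {0..s} ?F) \<longlongrightarrow> integral {0..t} ?F) (at t within {0..t})"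
    using t by (auto simp: continuous_on_def)
  then have "((\<lambda>s. integral {0..s} ?F) \<longlongrightarrow> I) (at_left t)"
    using t I by (simp add: integral_unique at_within_Icc_at_left)
  then show ?thesis
    unfolding has_caputo_deriv_def using RS by (intro exI conjI ballI tendsto_mult_left) auto
qed


section \<open>Sobolev spaces on an interval\<close>

definition L2_on :: "real \<Rightarrow> (real \<Rightarrow> real) set" where
  "L2_on l = {g. g \<in> borel_measurable (lebesgue_on {0<..<l}) \<and>
                 integrable (lebesgue_on {0<..<l}) (\<lambda>x. (g x)\<^sup>2)}"

text \<open>Smooth functions on the line with compact support inside (0, l).\<close>

definition test_functions :: "real \<Rightarrow> (real \<Rightarrow> real) set" where
  "test_functions l = {\<psi>. (\<forall>k x. (deriv ^^ k) \<psi> differentiable (at x)) \<and>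
                          (\<exists>K. compact K \<and> K \<subseteq> {0<..<l} \<and> (\<forall>x. x \<notin> K \<longrightarrow> \<psi> x = 0))}"

definition has_weak_deriv :: "real \<Rightarrow> nat \<Rightarrow> (real \<Rightarrow> real) \<Rightarrow> (real \<Rightarrow> real) \<Rightarrow> bool" where
  "has_weak_deriv l j g v \<longleftrightarrow> v \<in> L2_on l \<and>
    (\<forall>\<psi>\<in>test_functions l.
       integral\<^sup>L (lebesgue_on {0<..<l}) (\<lambda>x. g x * (deriv ^^ j) \<psi> x) =
       (-1) ^ j * integral\<^sup>L (lebesgue_on {0<..<l}) (\<lambda>x. v x * \<psi> x))"

definition sobolev_W2 :: "nat \<Rightarrow> real \<Rightarrow> (real \<Rightarrow> real) set" where
  "sobolev_W2 m l = {g \<in> L2_on l. \<forall>j\<le>m. \<exists>v. has_weak_deriv l j g v}"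

text \<open>Weak derivatives are determined almost everywhere, so the norm does not depend on the choice.\<close>

definition weak_deriv :: "real \<Rightarrow> nat \<Rightarrow> (real \<Rightarrow> real) \<Rightarrow> real \<Rightarrow> real" where
  "weak_deriv l j g = (SOME v. has_weak_deriv l j g v)"

definition sobolev_norm :: "nat \<Rightarrow> real \<Rightarrow> (real \<Rightarrow> real) \<Rightarrow> real" where
  "sobolev_norm m l g =
    sqrt (\<Sum>j\<le>m. integral\<^sup>L (lebesgue_on {0<..<l}) (\<lambda>x. (weak_deriv l j g x)\<^sup>2))"

text \<open>The space C([0,T]; W); \<open>f\<close> takes the space variable first.\<close>

definition continuous_into_sobolev ::
    "real \<Rightarrow> nat \<Rightarrow> real \<Rightarrow> (real \<Rightarrow> real \<Rightarrow> real) \<Rightarrow> bool" where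
  "continuous_into_sobolev T m l f \<longleftrightarrow>
    (\<forall>t\<in>{0..T}. (\<lambda>x. f x t) \<in> sobolev_W2 m l) \<and>
    (\<forall>t\<in>{0..T}. ((\<lambda>s. sobolev_norm m l (\<lambda>x. f x s - f x t)) \<longlongrightarrow> 0) (at t within {0..T}))"

text \<open>
  The j-th weak derivative of \<open>g\<close> vanishes at 0 and l: point values are those of its continuous
  representative, which exists for \<open>g\<close> in \<open>sobolev_W2 m l\<close> with \<open>j < m\<close>.
\<close>

definition weak_deriv_vanishes_at_ends :: "real \<Rightarrow> nat \<Rightarrow> (real \<Rightarrow> real) \<Rightarrow> bool" where
  "weak_deriv_vanishes_at_ends l j g \<longleftrightarrow>
    (\<exists>v. has_weak_deriv l j g v \<and> continuous_on {0..l} v \<and> v 0 = 0 \<and> v l = 0)"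


section \<open>The initial-boundary value problem\<close>

text \<open>
  \<open>u x t\<close> with derivatives \<open>Du\<close> (fractional, in t), \<open>ux\<close> and \<open>uxx\<close>; at \<open>x = 0\<close> and
  \<open>x = l\<close> the x-derivatives are one-sided.
\<close>

definition classical_solution ::
    "real \<Rightarrow> real \<Rightarrow> real \<Rightarrow> (real \<Rightarrow> real) \<Rightarrow> (real \<Rightarrow> real) \<Rightarrow>
     (real \<Rightarrow> real \<Rightarrow> real) \<Rightarrow> (real \<Rightarrow> real) \<Rightarrow> (real \<Rightarrow> real \<Rightarrow> real) \<Rightarrow> bool" where
  "classical_solution \<rho> l T \<sigma> q f \<phi> u \<longleftrightarrow>
    continuous_on ({0..l} \<times> {0..T}) (\<lambda>(x, t). u x t) \<and>
    (\<exists>Du ux uxx.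
       (\<forall>x\<in>{0..l}. \<forall>t\<in>{0<..T}.
          has_caputo_deriv \<rho> (\<lambda>\<tau>. u x \<tau>) t (Du x t) \<and>
          ((\<lambda>y. u y t) has_real_derivative ux x t) (at x within {0..l}) \<and>
          ((\<lambda>y. ux y t) has_real_derivative uxx x t) (at x within {0..l})) \<and>
       continuous_on ({0..l} \<times> {0<..T}) (\<lambda>(x, t). Du x t) \<and>
       continuous_on ({0..l} \<times> {0<..T}) (\<lambda>(x, t). uxx x t) \<and>
       (\<forall>x\<in>{0<..<l}. \<forall>t\<in>{0<..T}.
          Du x t - \<sigma> t * uxx x t + q t * u x t = f x t)) \<and>
    (\<forall>x\<in>{0..l}. u x 0 = \<phi> x) \<and>
    (\<forall>t\<in>{0..T}. u 0 t = 0 \<and> u l t = 0)"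

end

(*
  Fourier's method.  The sine coefficients of a solution satisfy D h + a h = g with
  a(t) = \<sigma>(t) (k pi / l)^2 + q(t), which is bounded below by a positive multiple of k^2.  Such an
  equation becomes the Volterra equation w = g - a (c + J w) for w = D h, where J is the Abel integral
  of order \<rho>.  At a maximum over [0, t] the fractional derivative is nonnegative; comparison with the
  barrier 1 / (1 + \<kappa> t^\<rho>) therefore gives |h(t)| <= |c| / (1 + \<kappa> t^\<rho>) + sup |g| / min a with \<kappa> of
  order k^2.  Hence the series of k^2 h_k(t) converges locally uniformly in t > 0 as soon as the
  coefficients of \<phi> and the suprema of those of f are summable: the former by Bessel's inequality for
  the weak derivative of \<phi>, the latter because two weak derivatives give the decay k^(-2).

  For uniqueness, the difference of two solutions is divided by cos (r (x - l/2)) with r slightly below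
  pi / l; this absorbs a negative q, and the maximum principle applies.
*)
theory Submission
  imports Defs
begin

text \<open>So every fact about the fractional derivative, the sign at a maximum included, is read
  off from integrals over [0, s] with s < t, followed by the limit from the left; and the decay of
  the modes comes from a comparison function that is elementary but decays like t^(-\<rho>), as the
  Mittag-Leffler function does.

  The delicate exchange is that of the limit s -> t with the sum over the modes. At t = 0 the
  derivatives of the modes are of size k^2 times the coefficient of \<open>\<phi>\<close>, in
  general not summable; for t > 0 they are at most A + C t^(-\<rho>) with A and C summable over the
  modes. The truncated integrals therefore need a bound in terms of A and C alone.

  Weak derivatives are tested with compactly supported functions only, which sines and cosines are
  not. The zero boundary values make up for this.\<close>

section \<open>Truncated Caputo integrals and the maximum principle\<close>

text \<open>The Stieltjes integral over \<open>[0, s]\<close> in the definition of the Caputo derivative at \<open>t\<close>, after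
  integration by parts.\<close>

definition caputo_trunc :: "real \<Rightarrow> (real \<Rightarrow> real) \<Rightarrow> real \<Rightarrow> real \<Rightarrow> real" where
  "caputo_trunc \<rho> h t s = (t - s) powr (- \<rho>) * h s - t powr (- \<rho>) * h 0
     - integral {0..s} (\<lambda>x. \<rho> * (t - x) powr (- \<rho> - 1) * h x)"

section \<open>Truncated form, linearity and constants for the Caputo derivative\<close>

lemma has_RS_integral_unique:
  assumes "has_RS_integral g h a b I" "has_RS_integral g h a b I'" "a \<le> b"
  shows "I = I'"
proof (rule ccontr)
  assume "I \<noteq> I'"
  then have e: "\<bar>I - I'\<bar> / 2 > 0" by simp
  obtain d where d: "d > 0" and D: "\<And>n p \<xi>. p 0 = a \<and> p (n::nat) = b \<and>
       (\<forall>i<n. p i \<le> p (Suc i) \<and> p (Suc i) - p i < d \<and> \<xi> i \<in> {p i..p (Suc i)}) \<Longrightarrow>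
       \<bar>(\<Sum>i<n. g (\<xi> i) * (h (p (Suc i)) - h (p i))) - I\<bar> < \<bar>I - I'\<bar> / 2"
    using assms(1) e unfolding has_RS_integral_def by meson
  obtain d' where d': "d' > 0" and D': "\<And>n p \<xi>. p 0 = a \<and> p (n::nat) = b \<and>
       (\<forall>i<n. p i \<le> p (Suc i) \<and> p (Suc i) - p i < d' \<and> \<xi> i \<in> {p i..p (Suc i)}) \<Longrightarrow>
       \<bar>(\<Sum>i<n. g (\<xi> i) * (h (p (Suc i)) - h (p i))) - I'\<bar> < \<bar>I - I'\<bar> / 2"
    using assms(2) e unfolding has_RS_integral_def by meson
  obtain n :: nat where n: "real n > (b - a) / min d d'" using reals_Archimedean2 by blast
  \<comment> \<open>One subinterval more than \<open>n\<close>, so that the divisor is positive by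
    construction. The uniform partition with left tags is then fine enough for both
    integrals.\<close>
  define m where "m = Suc n"
  have m: "(b - a) / real m < min d d'"
  proof -
    have "(b - a) < real n * min d d'" using n d d' by (simp add: divide_less_eq)
    also have "\<dots> \<le> real m * min d d'" using d d' by (intro mult_right_mono) (auto simp: m_def)
    finally have "b - a < min d d' * real m" by (simp add: mult.commute)
    moreover have "real m > 0" by (simp add: m_def)
    ultimately show ?thesis by (subst pos_divide_less_eq)
  qed
  define p where "p i = a + real i * ((b - a) / real m)" for i
  have step: "p (Suc i) - p i = (b - a) / real m" for i
    unfolding p_def of_nat_Suc distrib_right by simp
  have pos: "0 \<le> (b - a) / real m" using assms(3) by simp
  have P: "p 0 = a" "p m = b" by (auto simp: p_def m_def)
  have le: "p i \<le> p (Suc i)" for i using step[of i] pos by linarith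
  define X where "X = (\<Sum>i<m. g (p i) * (h (p (Suc i)) - h (p i)))"
  have "\<bar>X - I\<bar> < \<bar>I - I'\<bar> / 2"
    unfolding X_def using P le step m by (intro D) auto
  moreover have "\<bar>X - I'\<bar> < \<bar>I - I'\<bar> / 2"
    unfolding X_def using P le step m by (intro D') auto
  ultimately show False by (simp add: abs_if split: if_splits)
qed

lemma has_RS_integral_caputo_trunc:
  assumes "0 < s" "s < t" "continuous_on {0..s} h"
  shows "has_RS_integral (\<lambda>x. 1 / (t - x) powr \<rho>) h 0 s (caputo_trunc \<rho> h t s)"
proof -
  have "has_RS_integral (\<lambda>x. 1 / (t - x) powr \<rho>) h 0 s
     (1 / (t - s) powr \<rho> * h s - 1 / (t - 0) powr \<rho> * h 0
      - integral {0..s} (\<lambda>x. \<rho> * (t - x) powr (- \<rho> - 1) * h x))"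
  proof (rule has_RS_integral_by_parts)
    fix x assume x: "x \<in> {0..s}"
    have "((\<lambda>x. (t - x) powr (- \<rho>)) has_real_derivative \<rho> * (t - x) powr (- \<rho> - 1)) (at x within {0..s})"
      using x assms by (auto intro!: derivative_eq_intros simp: powr_diff)
    then show "((\<lambda>x. 1 / (t - x) powr \<rho>) has_real_derivative \<rho> * (t - x) powr (- \<rho> - 1)) (at x within {0..s})"
      by (simp add: powr_minus_divide)
  qed (use assms in \<open>auto intro!: continuous_intros\<close>)
  then show ?thesis by (simp add: caputo_trunc_def powr_minus_divide)
qed

text \<open>For continuous \<open>h\<close> integration by parts makes every truncated Stieltjes
  integral exist, and uniqueness forces the witness \<open>J\<close> of the definition. What remains
  is a single limit from the left.\<close>

lemma has_caputo_deriv_iff_trunc: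
  assumes "0 < t" "continuous_on {0..t} h"
  shows "has_caputo_deriv \<rho> h t D \<longleftrightarrow>
    ((\<lambda>s. caputo_trunc \<rho> h t s / Gamma (1 - \<rho>)) \<longlongrightarrow> D) (at_left t)"
proof -
  have RS: "has_RS_integral (\<lambda>x. 1 / (t - x) powr \<rho>) h 0 s (caputo_trunc \<rho> h t s)"
    if "s \<in> {0<..<t}" for s
    using that assms by (intro has_RS_integral_caputo_trunc) (auto intro: continuous_on_subset)
  show ?thesis
  proof
    assume "has_caputo_deriv \<rho> h t D"
    then obtain J where J: "\<And>s. s \<in> {0<..<t} \<Longrightarrow> has_RS_integral (\<lambda>\<eta>. 1 / (t - \<eta>) powr \<rho>) h 0 s (J s)"
      and lim: "((\<lambda>s. 1 / Gamma (1 - \<rho>) * J s) \<longlongrightarrow> D) (at_left t)"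
      unfolding has_caputo_deriv_def by blast
    have "J s = caputo_trunc \<rho> h t s" if "s \<in> {0<..<t}" for s
      using has_RS_integral_unique[OF J[OF that] RS[OF that]] that by auto
    then have "eventually (\<lambda>s. 1 / Gamma (1 - \<rho>) * J s = caputo_trunc \<rho> h t s / Gamma (1 - \<rho>)) (at_left t)"
      using assms(1) by (auto simp: eventually_at_left_field intro!: exI[of _ 0])
    then show "((\<lambda>s. caputo_trunc \<rho> h t s / Gamma (1 - \<rho>)) \<longlongrightarrow> D) (at_left t)"
      by (rule Lim_transform_eventually[OF lim])
  next
    assume "((\<lambda>s. caputo_trunc \<rho> h t s / Gamma (1 - \<rho>)) \<longlongrightarrow> D) (at_left t)"
    then show "has_caputo_deriv \<rho> h t D"
      unfolding has_caputo_deriv_def using RS by (intro exI[of _ "caputo_trunc \<rho> h t"]) auto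
  qed
qed

lemma caputo_trunc_integrable:
  fixes h :: "real \<Rightarrow> real"
  assumes "s < t" "continuous_on {0..s} h"
  shows "(\<lambda>x. \<rho> * (t - x) powr (- \<rho> - 1) * h x) integrable_on {0..s}"
  using assms by (intro integrable_continuous_interval continuous_intros) auto

lemma caputo_trunc_linear:
  assumes "s < t" "continuous_on {0..s} h" "continuous_on {0..s} k"
  shows "caputo_trunc \<rho> (\<lambda>x. a * h x + b * k x) t s =
     a * caputo_trunc \<rho> h t s + b * caputo_trunc \<rho> k t s"
proof -
  have "integral {0..s} (\<lambda>x. \<rho> * (t - x) powr (- \<rho> - 1) * (a * h x + b * k x)) =
    integral {0..s} (\<lambda>x. a * (\<rho> * (t - x) powr (- \<rho> - 1) * h x) + b * (\<rho> * (t - x) powr (- \<rho> - 1) * k x))"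
    by (simp add: algebra_simps)
  also have "\<dots> = a * integral {0..s} (\<lambda>x. \<rho> * (t - x) powr (- \<rho> - 1) * h x) +
      b * integral {0..s} (\<lambda>x. \<rho> * (t - x) powr (- \<rho> - 1) * k x)"
    using caputo_trunc_integrable[OF assms(1,2)] caputo_trunc_integrable[OF assms(1,3)]
    by (subst integral_add) (auto intro!: integrable_on_mult_right)
  finally show ?thesis by (simp add: caputo_trunc_def algebra_simps)
qed

lemma caputo_trunc_const:
  assumes "0 < s" "s < t"
  shows "caputo_trunc \<rho> (\<lambda>_. c) t s = 0"
proof -
  have "((\<lambda>x. \<rho> * (t - x) powr (- \<rho> - 1)) has_integral ((t - s) powr (- \<rho>) - (t - 0) powr (- \<rho>))) {0..s}"
    using assms by (intro fundamental_theorem_of_calculus)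
      (auto intro!: derivative_eq_intros simp: has_real_derivative_iff_has_vector_derivative[symmetric] powr_diff)
  from integral_unique[OF has_integral_mult_left[OF this, of c]] show ?thesis
    by (simp add: caputo_trunc_def algebra_simps)
qed

text \<open>General linear combinations cover sums, differences and sign changes at once; later uses
  are therefore phrased as \<open>1 * h x + (-1) * k x\<close>.\<close>

lemma has_caputo_deriv_linear:
  assumes "0 < t" "continuous_on {0..t} h" "continuous_on {0..t} k"
    and "has_caputo_deriv \<rho> h t D" "has_caputo_deriv \<rho> k t E"
  shows "has_caputo_deriv \<rho> (\<lambda>x. a * h x + b * k x) t (a * D + b * E)"
proof -
  have "((\<lambda>s. a * (caputo_trunc \<rho> h t s / Gamma (1 - \<rho>)) + b * (caputo_trunc \<rho> k t s / Gamma (1 - \<rho>)))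
      \<longlongrightarrow> a * D + b * E) (at_left t)"
    using assms by (intro tendsto_intros) (simp_all add: has_caputo_deriv_iff_trunc)
  moreover have "eventually (\<lambda>s. a * (caputo_trunc \<rho> h t s / Gamma (1 - \<rho>)) + b * (caputo_trunc \<rho> k t s / Gamma (1 - \<rho>))
     = caputo_trunc \<rho> (\<lambda>x. a * h x + b * k x) t s / Gamma (1 - \<rho>)) (at_left t)"
    unfolding eventually_at_left_field
  proof (intro exI[of _ 0] conjI allI impI)
    fix s assume s: "0 < s" "s < t"
    have "continuous_on {0..s} h" "continuous_on {0..s} k"
      using s assms by (auto intro: continuous_on_subset)
    then show "a * (caputo_trunc \<rho> h t s / Gamma (1 - \<rho>)) + b * (caputo_trunc \<rho> k t s / Gamma (1 - \<rho>))
     = caputo_trunc \<rho> (\<lambda>x. a * h x + b * k x) t s / Gamma (1 - \<rho>)"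
      using s by (simp add: caputo_trunc_linear add_divide_distrib)
  qed (use assms in auto)
  ultimately have "((\<lambda>s. caputo_trunc \<rho> (\<lambda>x. a * h x + b * k x) t s / Gamma (1 - \<rho>)) \<longlongrightarrow> a * D + b * E) (at_left t)"
    by (rule Lim_transform_eventually)
  then show ?thesis
    using assms by (subst has_caputo_deriv_iff_trunc) (auto intro!: continuous_intros)
qed

lemma has_caputo_deriv_const:
  assumes "0 < t"
  shows "has_caputo_deriv \<rho> (\<lambda>_. c) t 0"
proof -
  have "eventually (\<lambda>s. 0 = caputo_trunc \<rho> (\<lambda>_. c) t s / Gamma (1 - \<rho>)) (at_left t)"
    unfolding eventually_at_left_field using assms by (intro exI[of _ 0]) (auto simp: caputo_trunc_const)
  then have "((\<lambda>s. caputo_trunc \<rho> (\<lambda>_. c) t s / Gamma (1 - \<rho>)) \<longlongrightarrow> 0) (at_left t)"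
    by (rule Lim_transform_eventually[OF tendsto_const])
  then show ?thesis using assms by (subst has_caputo_deriv_iff_trunc) auto
qed

text \<open>With \<open>g = h t - h\<close> and \<open>G s\<close> the integral of \<open>g \<eta> * (t - \<eta>) powr (- \<rho> - 1)\<close> over \<open>[0, s]\<close>,
  a negative derivative would make \<open>(t - s) powr \<rho> * G s\<close> strictly increasing near \<open>t\<close>, although it
  is nonnegative and at most \<open>g s / \<rho>\<close>, which tends to 0.\<close>

lemma has_caputo_deriv_nonneg_at_max:
  assumes \<rho>: "0 < \<rho>" "\<rho> < 1" and t: "0 < t" and h: "continuous_on {0..t} h"
    and max: "\<And>s. s \<in> {0..t} \<Longrightarrow> h s \<le> h t"
    and D: "has_caputo_deriv \<rho> h t D"
  shows "0 \<le> D"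
proof (rule ccontr)
  assume neg: "\<not> 0 \<le> D"
  define g where "g = (\<lambda>s. h t - h s)"
  have g0: "g s \<ge> 0" if "s \<in> {0..t}" for s using max[OF that] by (simp add: g_def)
  have gc: "continuous_on {0..t} g" unfolding g_def by (intro continuous_intros h)
  have "has_caputo_deriv \<rho> (\<lambda>s. 1 * h t + (-1) * h s) t (1 * 0 + (-1) * D)"
    using t h D by (intro has_caputo_deriv_linear has_caputo_deriv_const) auto
  then have "has_caputo_deriv \<rho> g t (- D)" by (simp add: g_def)
  then have lim: "((\<lambda>s. caputo_trunc \<rho> g t s / Gamma (1 - \<rho>)) \<longlongrightarrow> - D) (at_left t)"
    using t gc by (simp add: has_caputo_deriv_iff_trunc)
  have "eventually (\<lambda>s. caputo_trunc \<rho> g t s / Gamma (1 - \<rho>) > 0) (at_left t)"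
    using order_tendstoD(1)[OF lim] neg by simp
  then obtain r' where r': "r' < t" "\<And>s. r' < s \<Longrightarrow> s < t \<Longrightarrow> caputo_trunc \<rho> g t s / Gamma (1 - \<rho>) > 0"
    unfolding eventually_at_left_field by blast
  define r where "r = max r' 0"
  have r: "0 \<le> r" "r < t" "\<And>s. r < s \<Longrightarrow> s < t \<Longrightarrow> caputo_trunc \<rho> g t s > 0"
  proof -
    show "0 \<le> r" "r < t" using r' t by (auto simp: r_def)
    fix s assume "r < s" "s < t"
    then show "caputo_trunc \<rho> g t s > 0"
      using r'(2)[of s] Gamma_real_pos[of "1 - \<rho>"] \<rho>
      using zero_less_mult_pos2[of "caputo_trunc \<rho> g t s" "inverse (Gamma (1 - \<rho>))"]
      by (simp add: r_def divide_inverse)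
  qed
  define k where "k = (\<lambda>x. (t - x) powr (- \<rho> - 1) * g x)"
  define G where "G s = integral {0..s} k" for s
  have kc: "continuous_on {0..s} k" if "s < t" for s
    unfolding k_def using that by (intro continuous_intros continuous_on_subset[OF gc]) auto
  have key: "\<rho> * G s < (t - s) powr (- \<rho>) * g s" if s: "r < s" "s < t" for s
  proof -
    have "caputo_trunc \<rho> g t s = (t - s) powr (- \<rho>) * g s - t powr (- \<rho>) * g 0 - \<rho> * G s"
      unfolding caputo_trunc_def G_def k_def
      by (simp add: mult.assoc flip: integral_mult_right)
    moreover have "t powr (- \<rho>) * g 0 \<ge> 0" using g0[of 0] t by simp
    ultimately show ?thesis using r(3)[OF s] by linarith
  qed
  define Q where "Q s = (t - s) powr \<rho> * G s" for s
  have dG: "(G has_real_derivative k s) (at s)" if s: "r < s" "s < t" for s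
  proof -
    define e where "e = (s + t) / 2"
    have e: "s < e" "e < t" using s by (auto simp: e_def)
    have "((\<lambda>u. integral {0..u} k) has_real_derivative k s) (at s within {0..e})"
      using s e r kc[of e] by (intro integral_has_real_derivative) auto
    moreover have "at s within {0..e} = at s" using s e r by (intro at_within_Icc_at) auto
    ultimately show ?thesis by (simp add: G_def[abs_def])
  qed
  \<comment> \<open>The power in \<open>Q\<close> acts as an integrating factor: the derivative
    becomes a positive multiple of the gap in \<open>key\<close>.\<close>
  have dQ: "(Q has_real_derivative (t - s) powr (\<rho> - 1) * ((t - s) powr (- \<rho>) * g s - \<rho> * G s)) (at s)"
    if s: "r < s" "s < t" for s
  proof -
    have e: "(t - s) powr (\<rho> - 1) * (t - s) powr (- \<rho>) = (t - s) powr \<rho> * (t - s) powr (- \<rho> - 1)"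
      by (simp add: powr_add[symmetric])
    have "(Q has_real_derivative (- \<rho> * (t - s) powr (\<rho> - 1)) * G s + k s * (t - s) powr \<rho>) (at s)"
      unfolding Q_def[abs_def] using s
      by (intro DERIV_mult dG) (auto intro!: derivative_eq_intros simp: powr_diff)
    moreover have "(- \<rho> * (t - s) powr (\<rho> - 1)) * G s + k s * (t - s) powr \<rho> =
       (t - s) powr (\<rho> - 1) * ((t - s) powr (- \<rho>) * g s - \<rho> * G s)"
      unfolding k_def using e by (simp add: algebra_simps)
    ultimately show ?thesis by simp
  qed
  have mono: "Q a < Q b" if "r < a" "a < b" "b < t" for a b
  proof (rule DERIV_pos_imp_increasing[OF that(2)])
    fix x assume "a \<le> x" "x \<le> b"
    then have x: "r < x" "x < t" using that by auto
    have "0 < (t - x) powr (\<rho> - 1) * ((t - x) powr (- \<rho>) * g x - \<rho> * G x)"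
      using key[OF x] x by simp
    then show "\<exists>y. (Q has_real_derivative y) (at x) \<and> y > 0" using dQ[OF x] by blast
  qed
  have Qg: "\<rho> * Q s \<le> g s" if s: "r < s" "s < t" for s
  proof -
    have "\<rho> * Q s = (t - s) powr \<rho> * (\<rho> * G s)" by (simp add: Q_def)
    also have "\<dots> \<le> (t - s) powr \<rho> * ((t - s) powr (- \<rho>) * g s)"
      using key[OF s] by (intro mult_left_mono) auto
    also have "\<dots> = g s" using s by (simp add: mult.assoc[symmetric] powr_add[symmetric])
    finally show ?thesis .
  qed
  \<comment> \<open>Any two points between \<open>r\<close> and \<open>t\<close> would do.
    \<open>Q a\<close> is nonnegative, hence \<open>Q b\<close> is strictly positive, and this fixed
    lower bound collides with \<open>Qg\<close> as s tends to t.\<close>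
  define a where "a = (2 * r + t) / 3"
  define b where "b = (r + 2 * t) / 3"
  have ab: "r < a" "a < b" "b < t" using r(2) by (auto simp: a_def b_def field_simps)
  have "Q a \<ge> 0"
    unfolding Q_def G_def using ab r(1) g0
    by (intro mult_nonneg_nonneg Henstock_Kurzweil_Integration.integral_nonneg integrable_continuous_interval kc)
       (auto simp: k_def)
  then have Qb: "Q b > 0" using mono[OF ab] by linarith
  have "(g \<longlongrightarrow> g t) (at t within {0..t})" using gc t by (auto simp: continuous_on_def)
  then have "(g \<longlongrightarrow> 0) (at_left t)" using t by (simp add: g_def at_within_Icc_at_left)
  then have "eventually (\<lambda>s. g s < \<rho> * Q b) (at_left t)"
    using Qb \<rho> by (intro order_tendstoD) auto
  moreover have "eventually (\<lambda>s. s \<in> {b<..<t}) (at_left t)"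
    using ab(3) by (rule eventually_at_left_real)
  ultimately have "eventually (\<lambda>s. False) (at_left t)"
  proof eventually_elim
    case (elim s)
    then have "Q b < Q s" using mono[of b s] ab by auto
    then have "\<rho> * Q b < \<rho> * Q s" using \<rho> by simp
    then show ?case using Qg[of s] elim ab by auto
  qed
  then show False by (simp add: trivial_limit_at_left_real eventually_False)
qed

section \<open>The Abel integral inverts the Caputo derivative\<close>

lemma has_integral_powr_right_end:
  fixes p :: real
  assumes "0 < p" "a \<le> b"
  shows "((\<lambda>x. (b - x) powr (p - 1)) has_integral (b - a) powr p / p) {a..b}"
proof -
  have "((\<lambda>x. (b - x) powr (p - 1)) has_integral (- ((b - b) powr p / p) - - ((b - a) powr p / p))) {a..b}"
  \<comment> \<open>For p < 1 the integrand blows up at b, but the antiderivative is continuous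
    there, so differentiability in the interior is enough.\<close>
  proof (rule fundamental_theorem_of_calculus_interior)
    show "continuous_on {a..b} (\<lambda>x. - ((b - x) powr p / p))"
      using assms by (intro continuous_intros continuous_on_powr') auto
    fix x assume "x \<in> {a<..<b}"
    then have "((\<lambda>x. - ((b - x) powr p / p)) has_real_derivative (b - x) powr (p - 1)) (at x)"
      using assms by (auto intro!: derivative_eq_intros simp: powr_diff)
    then show "((\<lambda>x. - ((b - x) powr p / p)) has_vector_derivative (b - x) powr (p - 1)) (at x)"
      by (simp add: has_real_derivative_iff_has_vector_derivative)
  qed (use assms in auto)
  then show ?thesis using assms by simp
qed

lemma has_integral_powr_left_end:
  fixes p :: real
  assumes "0 < p" "a \<le> b"
  shows "((\<lambda>x. (x - a) powr (p - 1)) has_integral (b - a) powr p / p) {a..b}"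
proof -
  have "((\<lambda>x. (x - a) powr (p - 1)) has_integral ((b - a) powr p / p - (a - a) powr p / p)) {a..b}"
  proof (rule fundamental_theorem_of_calculus_interior)
    show "continuous_on {a..b} (\<lambda>x. (x - a) powr p / p)"
      using assms by (intro continuous_intros continuous_on_powr') auto
    fix x assume "x \<in> {a<..<b}"
    then have "((\<lambda>x. (x - a) powr p / p) has_real_derivative (x - a) powr (p - 1)) (at x)"
      using assms by (auto intro!: derivative_eq_intros simp: powr_diff)
    then show "((\<lambda>x. (x - a) powr p / p) has_vector_derivative (x - a) powr (p - 1)) (at x)"
      by (simp add: has_real_derivative_iff_has_vector_derivative)
  qed (use assms in auto)
  then show ?thesis using assms by simp
qed

lemma powr_right_end_absolutely_integrable:
  fixes p :: real
  assumes "0 < p" "a \<le> b"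
  shows "(\<lambda>x. (b - x) powr (p - 1)) absolutely_integrable_on {a..b}"
  using has_integral_powr_right_end[OF assms] by (intro nonnegative_absolutely_integrable_1) auto

lemma continuous_on_Icc_bounded:
  fixes w :: "real \<Rightarrow> real"
  assumes "continuous_on {a..b} w"
  obtains M where "M > 0" "\<And>x. x \<in> {a..b} \<Longrightarrow> \<bar>w x\<bar> \<le> M"
proof -
  have "bounded (w ` {a..b})"
    using compact_continuous_image[OF assms] by (auto intro: compact_imp_bounded)
  then show ?thesis using that by (auto simp: bounded_pos)
qed

lemma absolutely_integrable_mult_continuous:
  fixes k w :: "real \<Rightarrow> real"
  assumes "k absolutely_integrable_on {a..b}" "continuous_on {a..b} w"
  shows "(\<lambda>x. k x * w x) absolutely_integrable_on {a..b}"
proof -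
  have "(\<lambda>x. w x * k x) absolutely_integrable_on {a..b}"
  proof (rule absolutely_integrable_bounded_measurable_product_real)
    show "w \<in> borel_measurable (lebesgue_on {a..b})"
      using assms(2) by (intro continuous_imp_measurable_on_sets_lebesgue) auto
    show "bounded (w ` {a..b})"
      using compact_continuous_image[OF assms(2)] by (auto intro: compact_imp_bounded)
  qed (use assms in auto)
  then show ?thesis by (simp add: mult.commute)
qed

text \<open>The Riemann-Liouville integral of order \<rho> after the substitution x = t * y. Domain
  and singular kernel no longer depend on t, so continuity in t follows from uniform continuity of
  \<open>w\<close>, and the factor \<open>t powr \<rho>\<close> gives the value 0 at 0. The
  convolution form is recovered in \<open>abel_eq_integral\<close>.\<close>

definition abel :: "real \<Rightarrow> (real \<Rightarrow> real) \<Rightarrow> real \<Rightarrow> real" where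
  "abel \<rho> w t = t powr \<rho> / Gamma \<rho> * integral {0..1} (\<lambda>y. (1 - y) powr (\<rho> - 1) * w (t * y))"

lemma continuous_on_dilation:
  fixes w :: "real \<Rightarrow> real"
  assumes "continuous_on {0..T} w" "0 \<le> t" "t \<le> T"
  shows "continuous_on {0..1} (\<lambda>y. w (t * y))"
proof (rule continuous_on_compose2[OF assms(1)])
  show "(\<lambda>y. t * y) ` {0..1} \<subseteq> {0..T}"
    using assms mult_mono[of t T _ 1] by (auto intro: mult_nonneg_nonneg)
qed (intro continuous_intros)

lemma abel_kernel_integrable:
  fixes w :: "real \<Rightarrow> real"
  assumes "0 < \<rho>" "continuous_on {0..T} w" "0 \<le> t" "t \<le> T"
  shows "(\<lambda>y. (1 - y) powr (\<rho> - 1) * w (t * y)) absolutely_integrable_on {0..1}"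
  using assms powr_right_end_absolutely_integrable[of \<rho> 0 1] continuous_on_dilation
  by (intro absolutely_integrable_mult_continuous) auto

lemma continuous_on_abel:
  assumes \<rho>: "0 < \<rho>" and w: "continuous_on {0..T} w"
  shows "continuous_on {0..T} (abel \<rho> w)"
proof -
  let ?I = "\<lambda>t. integral {0..1} (\<lambda>y. (1 - y) powr (\<rho> - 1) * w (t * y))"
  have "continuous_on {0..T} ?I"
    unfolding continuous_on_iff
  proof (intro ballI allI impI)
    fix t e :: real assume t: "t \<in> {0..T}" and e: "0 < e"
    have "uniformly_continuous_on {0..T} w" using w compact_uniformly_continuous by blast
    \<comment> \<open>The kernel has mass 1 / \<rho> over [0, 1], so this tolerance for
      \<open>w\<close> becomes e / 2 for the integral.\<close>
    moreover have "e * \<rho> / 2 > 0" using e \<rho> by simp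
    ultimately obtain d where d: "d > 0" "\<And>x y. x \<in> {0..T} \<Longrightarrow> y \<in> {0..T} \<Longrightarrow> \<bar>x - y\<bar> < d \<Longrightarrow> \<bar>w x - w y\<bar> < e * \<rho> / 2"
      unfolding uniformly_continuous_on_def dist_real_def by metis
    show "\<exists>d>0. \<forall>t'\<in>{0..T}. dist t' t < d \<longrightarrow> dist (?I t') (?I t) < e"
    proof (intro exI[of _ d] conjI ballI impI d(1))
      fix s assume s: "s \<in> {0..T}" "dist s t < d"
      let ?k = "\<lambda>y::real. (1 - y) powr (\<rho> - 1)"
      have int: "(\<lambda>y. ?k y * w (r * y)) integrable_on {0..1}" if "r \<in> {0..T}" for r
        using abel_kernel_integrable[OF \<rho> w, of r] that by (auto intro: set_lebesgue_integral_eq_integral)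
      have "norm (integral {0..1} (\<lambda>y. ?k y * w (s * y) - ?k y * w (t * y)))
         \<le> integral {0..1} (\<lambda>y. ?k y * (e * \<rho> / 2))"
      proof (rule integral_norm_bound_integral)
        show "(\<lambda>y. ?k y * (e * \<rho> / 2)) integrable_on {0..1}"
          using has_integral_mult_left[OF has_integral_powr_right_end[OF \<rho>, of 0 1]] by auto
        fix y :: real assume y: "y \<in> {0..1}"
        have "\<bar>s * y - t * y\<bar> \<le> \<bar>s - t\<bar>"
          using y mult_left_le[of y "\<bar>s - t\<bar>"] by (simp add: left_diff_distrib[symmetric] abs_mult)
        moreover have "s * y \<in> {0..T}" "t * y \<in> {0..T}"
          using y s t mult_mono[of s T y 1] mult_mono[of t T y 1] by auto
        ultimately have "\<bar>w (s * y) - w (t * y)\<bar> < e * \<rho> / 2"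
          using s by (intro d(2)) (auto simp: dist_real_def)
        then have "?k y * \<bar>w (s * y) - w (t * y)\<bar> \<le> ?k y * (e * \<rho> / 2)"
          by (intro mult_left_mono) auto
        then show "norm (?k y * w (s * y) - ?k y * w (t * y)) \<le> ?k y * (e * \<rho> / 2)"
          by (simp add: right_diff_distrib[symmetric] abs_mult)
      qed (intro integrable_diff int s t)
      also have "\<dots> = e / 2"
        using has_integral_mult_left[OF has_integral_powr_right_end[OF \<rho>, of 0 1], of "e * \<rho> / 2"] \<rho>
        by (subst integral_unique) auto
      finally have "\<bar>?I s - ?I t\<bar> \<le> e / 2"
        using s t by (simp add: Henstock_Kurzweil_Integration.integral_diff int)
      then show "dist (?I s) (?I t) < e" using e by (simp add: dist_real_def)
    qed
  qed
  then show ?thesis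
    unfolding abel_def[abs_def] using \<rho> less_imp_neq[OF Gamma_real_pos[OF \<rho>]]
    by (intro continuous_on_mult continuous_on_divide continuous_on_powr' continuous_on_const continuous_on_id) auto
qed

lemma abel_0 [simp]: "abel \<rho> w 0 = 0"
  by (simp add: abel_def)

lemma abel_eq_integral:
  assumes \<rho>: "0 < \<rho>" and w: "continuous_on {0..t} w" and t: "0 < t"
  shows "((\<lambda>x. (t - x) powr (\<rho> - 1) * w x) has_integral Gamma \<rho> * abel \<rho> w t) {0..t}"
proof -
  let ?f = "\<lambda>x. (t - x) powr (\<rho> - 1) * w x"
  have int: "?f integrable_on {0..t}"
    using absolutely_integrable_mult_continuous[OF powr_right_end_absolutely_integrable[OF \<rho>, of 0 t] w] t
    by (auto intro: set_lebesgue_integral_eq_integral)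
  have "((\<lambda>x. ?f (t *\<^sub>R x + 0)) has_integral (1 / (\<bar>t\<bar> ^ DIM(real))) *\<^sub>R integral {0..t} ?f)
     ((\<lambda>x. (1 / t) *\<^sub>R x + -((1 / t) *\<^sub>R 0)) ` cbox 0 t)"
    using t integrable_integral[OF int] by (intro has_integral_affinity) auto
  moreover have "(\<lambda>x. (1 / t) *\<^sub>R x + -((1 / t) *\<^sub>R 0)) ` cbox 0 t = {0..1}"
    using t image_affinity_atLeastAtMost[of "1/t" 0 0 t] by (simp add: cbox_interval)
  ultimately have "((\<lambda>x. ?f (t * x)) has_integral (1 / t * integral {0..t} ?f)) {0..1}"
    using t by simp
  then have "((\<lambda>x. t powr (\<rho> - 1) * ((1 - x) powr (\<rho> - 1) * w (t * x))) has_integral (1 / t * integral {0..t} ?f)) {0..1}"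
  proof (rule has_integral_eq[rotated])
    fix x :: real assume x: "x \<in> {0..1}"
    have "t - t * x = t * (1 - x)" by (simp add: algebra_simps)
    then show "?f (t * x) = t powr (\<rho> - 1) * ((1 - x) powr (\<rho> - 1) * w (t * x))"
      using t x by (simp add: powr_mult)
  qed
  then have "integral {0..1} (\<lambda>x. t powr (\<rho> - 1) * ((1 - x) powr (\<rho> - 1) * w (t * x))) = 1 / t * integral {0..t} ?f"
    by (rule integral_unique)
  then have "t powr (\<rho> - 1) * integral {0..1} (\<lambda>x. (1 - x) powr (\<rho> - 1) * w (t * x)) = 1 / t * integral {0..t} ?f"
    by (simp add: integral_mult_right)
  moreover have "t powr \<rho> = t * t powr (\<rho> - 1)" using t by (simp add: powr_diff)
  ultimately have "Gamma \<rho> * abel \<rho> w t = integral {0..t} ?f"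
    using t Gamma_real_pos[OF \<rho>] by (simp add: abel_def mult.assoc)
  then show ?thesis using integrable_integral[OF int] by simp
qed

text \<open>Fubini is used for Lebesgue integrals over the line, while the kernels are treated as
  gauge integrals on an interval; extension by zero translates between the two. Borel measurability
  is asked for because \<open>lborel\<close>, unlike \<open>lebesgue\<close>, is not
  complete.\<close>

lemma has_bochner_integral_Ioo:
  fixes f :: "real \<Rightarrow> real"
  assumes "f absolutely_integrable_on {a..b}"
    and m: "(\<lambda>x. if a < x \<and> x < b then f x else 0) \<in> borel_measurable borel"
  shows "has_bochner_integral lborel (\<lambda>x. if a < x \<and> x < b then f x else 0) (integral {a..b} f)"
proof -
  let ?g = "\<lambda>x. if a < x \<and> x < b then f x else 0"
  have "f absolutely_integrable_on {a<..<b}"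
    using assms(1) by (rule set_integrable_subset) auto
  then have "integrable lebesgue (\<lambda>x. indicator {a<..<b} x *\<^sub>R f x)"
    by (simp add: set_integrable_def)
  also have "(\<lambda>x. indicator {a<..<b} x *\<^sub>R f x) = ?g" by (auto simp: indicator_def)
  finally have int: "integrable lborel ?g"
    using m by (subst integrable_completion[symmetric]) auto
  have "(?g has_integral integral\<^sup>L lborel ?g) UNIV" by (rule has_integral_integral_lborel[OF int])
  then have "((\<lambda>x. if x \<in> {a<..<b} then f x else 0) has_integral integral\<^sup>L lborel ?g) UNIV" by simp
  then have "(f has_integral integral\<^sup>L lborel ?g) {a..b}"
    unfolding has_integral_restrict_UNIV has_integral_Icc_iff_Ioo .
  then show ?thesis using int by (simp add: has_bochner_integral_iff integral_unique)
qed

text \<open>Up to the factor 1 / (t - x) the antiderivative is the \<rho>-th power of the Moebius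
  map (y - x) / (t - y), whose derivative is (t - x) / (t - y)^2.\<close>

lemma has_integral_abel_inner:
  fixes \<rho> :: real
  assumes "0 < \<rho>" "x < s" "s < t"
  shows "((\<lambda>y. \<rho> * (t - y) powr (- \<rho> - 1) * (y - x) powr (\<rho> - 1)) has_integral
     (s - x) powr \<rho> * (t - s) powr (- \<rho>) / (t - x)) {x..s}"
proof -
  let ?F = "\<lambda>y. (y - x) powr \<rho> * (t - y) powr (- \<rho>) / (t - x)"
  have "((\<lambda>y. \<rho> * (t - y) powr (- \<rho> - 1) * (y - x) powr (\<rho> - 1)) has_integral (?F s - ?F x)) {x..s}"
  proof (rule fundamental_theorem_of_calculus_interior)
    show "continuous_on {x..s} ?F"
      using assms by (intro continuous_intros continuous_on_powr') auto
    fix y assume y: "y \<in> {x<..<s}"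
    have e: "(y - x) powr \<rho> = (y - x) * (y - x) powr (\<rho> - 1)"
      "(t - y) powr (- \<rho>) = (t - y) * (t - y) powr (- \<rho> - 1)"
      using y assms by (simp_all add: powr_diff)
    have "(?F has_real_derivative ((\<rho> * (y - x) powr (\<rho> - 1)) * (t - y) powr (- \<rho>) +
        (\<rho> * (t - y) powr (- \<rho> - 1)) * (y - x) powr \<rho>) / (t - x)) (at y)"
      using y assms
      by (intro DERIV_cdivide DERIV_mult) (auto intro!: derivative_eq_intros simp: powr_diff)
    moreover have "((\<rho> * (y - x) powr (\<rho> - 1)) * (t - y) powr (- \<rho>) +
        (\<rho> * (t - y) powr (- \<rho> - 1)) * (y - x) powr \<rho>) / (t - x) =
        \<rho> * (t - y) powr (- \<rho> - 1) * (y - x) powr (\<rho> - 1)"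
      using assms unfolding e by (simp add: field_simps)
    ultimately show "(?F has_vector_derivative \<rho> * (t - y) powr (- \<rho> - 1) * (y - x) powr (\<rho> - 1)) (at y)"
      by (simp add: has_real_derivative_iff_has_vector_derivative)
  qed (use assms in auto)
  then show ?thesis using assms by simp
qed

text \<open>Fubini on the triangle 0 < x < y < s. Integrating in x first produces the memory term of
  \<open>caputo_trunc\<close> for an Abel integral, integrating in y first the closed form of
  \<open>has_integral_abel_inner\<close>.\<close>

lemma integral_abel_swap:
  fixes w :: "real \<Rightarrow> real"
  assumes \<rho>: "0 < \<rho>" and st: "0 < s" "s < t" and w: "continuous_on {0..s} w"
  shows "((\<lambda>x. w x * ((s - x) powr \<rho> * (t - s) powr (- \<rho>) / (t - x))) has_integral
     Gamma \<rho> * integral {0..s} (\<lambda>y. \<rho> * (t - y) powr (- \<rho> - 1) * abel \<rho> w y)) {0..s}"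
proof -
  \<comment> \<open>Clamping the argument to [0, s] extends \<open>w\<close> continuously to the
    whole line, which provides the measurability needed for Fubini.\<close>
  define W where "W x = w (max 0 (min s x))" for x
  have Wc: "continuous_on UNIV W"
    unfolding W_def using st by (intro continuous_on_compose2[OF w] continuous_intros) auto
  have [measurable]: "W \<in> borel_measurable borel" using Wc by (rule borel_measurable_continuous_onI)
  have Ww: "W x = w x" if "x \<in> {0..s}" for x using that by (simp add: W_def)
  obtain M where M: "M > 0" "\<And>x. x \<in> {0..s} \<Longrightarrow> \<bar>w x\<bar> \<le> M"
    using continuous_on_Icc_bounded[OF w] by blast
  have WM: "\<bar>W x\<bar> \<le> M" for x unfolding W_def using st by (intro M(2)) auto
  define G where "G y x = (if 0 < y \<and> y < s then
     if 0 < x \<and> x < y then \<rho> * (t - y) powr (- \<rho> - 1) * ((y - x) powr (\<rho> - 1) * W x) else 0 else 0)" for y x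
  have [measurable]: "(\<lambda>(y, x). G y x) \<in> borel_measurable (borel \<Otimes>\<^sub>M borel)"
    unfolding G_def by measurable
  have inner1: "has_bochner_integral lborel (G y) (\<rho> * (t - y) powr (- \<rho> - 1) * (Gamma \<rho> * abel \<rho> w y))"
    if y: "0 < y" "y < s" for y
  proof -
    have c: "continuous_on {0..y} W" using Wc continuous_on_subset by blast
    have a: "(\<lambda>x. (y - x) powr (\<rho> - 1) * W x) absolutely_integrable_on {0..y}"
      using y by (intro absolutely_integrable_mult_continuous powr_right_end_absolutely_integrable \<rho> c) auto
    have "has_bochner_integral lborel (\<lambda>x. if 0 < x \<and> x < y then (y - x) powr (\<rho> - 1) * W x else 0)
       (integral {0..y} (\<lambda>x. (y - x) powr (\<rho> - 1) * W x))"
      by (rule has_bochner_integral_Ioo[OF a]) measurable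
    moreover have "integral {0..y} (\<lambda>x. (y - x) powr (\<rho> - 1) * W x) = Gamma \<rho> * abel \<rho> w y"
    proof -
      have "continuous_on {0..y} w" using w y by (auto intro: continuous_on_subset)
      then have "((\<lambda>x. (y - x) powr (\<rho> - 1) * W x) has_integral Gamma \<rho> * abel \<rho> w y) {0..y}"
        using abel_eq_integral[OF \<rho> _ y(1), of w] y by (auto intro: has_integral_eq[rotated] simp: Ww)
      then show ?thesis by (rule integral_unique)
    qed
    ultimately have "has_bochner_integral lborel (\<lambda>x. \<rho> * (t - y) powr (- \<rho> - 1) * (if 0 < x \<and> x < y then (y - x) powr (\<rho> - 1) * W x else 0))
       (\<rho> * (t - y) powr (- \<rho> - 1) * (Gamma \<rho> * abel \<rho> w y))"
      by (auto intro: has_bochner_integral_mult_right)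
    moreover have "(\<lambda>x. \<rho> * (t - y) powr (- \<rho> - 1) * (if 0 < x \<and> x < y then (y - x) powr (\<rho> - 1) * W x else 0)) = G y"
      using y by (auto simp: G_def)
    ultimately show ?thesis by simp
  qed
  \<comment> \<open>As y < s < t, the outer kernel stays bounded and only (y - x)^(\<rho> - 1) is
    singular. The absolute inner integrals are thus below one constant, which is integrable over
    [0, s].\<close>
  have norm_le: "(\<integral>x. norm (G y x) \<partial>lborel) \<le> \<rho> * (t - s) powr (- \<rho> - 1) * (M * (s powr \<rho> / \<rho>))"
    if y: "0 < y" "y < s" for y
  proof -
    have "has_bochner_integral lborel (\<lambda>x. if 0 < x \<and> x < y then (y - x) powr (\<rho> - 1) else 0)
       (integral {0..y} (\<lambda>x. (y - x) powr (\<rho> - 1)))"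
      using y by (intro has_bochner_integral_Ioo powr_right_end_absolutely_integrable \<rho>) (auto, measurable)
    then have "has_bochner_integral lborel (\<lambda>x. \<rho> * (t - s) powr (- \<rho> - 1) * (M * (if 0 < x \<and> x < y then (y - x) powr (\<rho> - 1) else 0)))
       (\<rho> * (t - s) powr (- \<rho> - 1) * (M * integral {0..y} (\<lambda>x. (y - x) powr (\<rho> - 1))))"
      by (intro has_bochner_integral_mult_right)
    then have H: "has_bochner_integral lborel (\<lambda>x. \<rho> * (t - s) powr (- \<rho> - 1) * (M * (if 0 < x \<and> x < y then (y - x) powr (\<rho> - 1) else 0)))
       (\<rho> * (t - s) powr (- \<rho> - 1) * (M * (y powr \<rho> / \<rho>)))"
      using has_integral_powr_right_end[OF \<rho>, of 0 y] y by (simp add: integral_unique)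
    have "(\<integral>x. norm (G y x) \<partial>lborel) \<le> (\<integral>x. \<rho> * (t - s) powr (- \<rho> - 1) * (M * (if 0 < x \<and> x < y then (y - x) powr (\<rho> - 1) else 0)) \<partial>lborel)"
    proof (rule integral_mono)
      show "integrable lborel (\<lambda>x. norm (G y x))"
        using inner1[OF y] by (auto simp: has_bochner_integral_iff)
      fix x
      have "(t - y) powr (- \<rho> - 1) \<le> (t - s) powr (- \<rho> - 1)"
        using y st \<rho> by (intro powr_mono2') auto
      moreover have "(y - x) powr (\<rho> - 1) * \<bar>W x\<bar> \<le> M * (y - x) powr (\<rho> - 1)"
        using mult_right_mono[OF WM[of x], of "(y - x) powr (\<rho> - 1)"] by (simp add: mult.commute)
      ultimately have "(\<rho> * (t - y) powr (- \<rho> - 1)) * ((y - x) powr (\<rho> - 1) * \<bar>W x\<bar>) \<le>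
         (\<rho> * (t - s) powr (- \<rho> - 1)) * (M * (y - x) powr (\<rho> - 1))"
        using \<rho> M by (intro mult_mono[of "\<rho> * (t - y) powr (- \<rho> - 1)"] mult_left_mono) auto
      then show "norm (G y x) \<le> \<rho> * (t - s) powr (- \<rho> - 1) * (M * (if 0 < x \<and> x < y then (y - x) powr (\<rho> - 1) else 0))"
        using \<rho> M by (auto simp: G_def abs_mult)
    qed (use H in \<open>auto simp: has_bochner_integral_iff\<close>)
    also have "\<dots> = \<rho> * (t - s) powr (- \<rho> - 1) * (M * (y powr \<rho> / \<rho>))"
      using H by (simp add: has_bochner_integral_iff)
    also have "\<dots> \<le> \<rho> * (t - s) powr (- \<rho> - 1) * (M * (s powr \<rho> / \<rho>))"
      using y \<rho> M by (intro mult_left_mono divide_right_mono powr_mono2) auto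
    finally show ?thesis .
  qed
  have G0: "G y = (\<lambda>x. 0)" if "\<not> (0 < y \<and> y < s)" for y using that by (auto simp: G_def)
  have "integrable (lborel \<Otimes>\<^sub>M lborel) (\<lambda>(y, x). G y x)"
  proof (rule lborel_pair.Fubini_integrable)
    show "(\<lambda>(y, x). G y x) \<in> borel_measurable (lborel \<Otimes>\<^sub>M lborel)" by measurable
    show "AE y in lborel. integrable lborel (\<lambda>x. case (y, x) of (y, x) \<Rightarrow> G y x)"
    proof (intro AE_I2)
      fix y
      show "integrable lborel (\<lambda>x. case (y, x) of (y, x) \<Rightarrow> G y x)"
        using inner1[of y] G0[of y] by (cases "0 < y \<and> y < s") (auto simp: has_bochner_integral_iff)
    qed
    show "integrable lborel (\<lambda>y. \<integral>x. norm (case (y, x) of (y, x) \<Rightarrow> G y x) \<partial>lborel)"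
    proof (rule Bochner_Integration.integrable_bound)
      show "integrable lborel (\<lambda>y. indicator {0..s} y *\<^sub>R (\<rho> * (t - s) powr (- \<rho> - 1) * (M * (s powr \<rho> / \<rho>))))"
        by (intro integrable_real_indicator integrable_scaleR_left) (auto simp: emeasure_lborel_Icc_eq)
      show "AE y in lborel. norm (\<integral>x. norm (case (y, x) of (y, x) \<Rightarrow> G y x) \<partial>lborel) \<le>
         norm (indicator {0..s} y *\<^sub>R (\<rho> * (t - s) powr (- \<rho> - 1) * (M * (s powr \<rho> / \<rho>))))"
      proof (intro AE_I2)
        fix y
        show "norm (\<integral>x. norm (case (y, x) of (y, x) \<Rightarrow> G y x) \<partial>lborel) \<le>
         norm (indicator {0..s} y *\<^sub>R (\<rho> * (t - s) powr (- \<rho> - 1) * (M * (s powr \<rho> / \<rho>))))"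
        proof (cases "0 < y \<and> y < s")
          case True
          then have "norm (indicator {0..s} y *\<^sub>R (\<rho> * (t - s) powr (- \<rho> - 1) * (M * (s powr \<rho> / \<rho>)))) =
             \<rho> * (t - s) powr (- \<rho> - 1) * (M * (s powr \<rho> / \<rho>))"
            using \<rho> M by (simp add: abs_mult)
          then show ?thesis using norm_le[of y] True by (simp add: integral_nonneg_AE)
        next
          case False
          then show ?thesis using G0[of y] by simp
        qed
      qed
      show "(\<lambda>y. \<integral>x. norm (case (y, x) of (y, x) \<Rightarrow> G y x) \<partial>lborel) \<in> borel_measurable lborel"
        by measurable
    qed
  qed
  then have int: "integrable (lborel \<Otimes>\<^sub>M lborel) (case_prod G)" by simp
  have swap: "(\<integral>x. (\<integral>y. G y x \<partial>lborel) \<partial>lborel) = (\<integral>y. (\<integral>x. G y x \<partial>lborel) \<partial>lborel)"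
    by (rule lborel_pair.Fubini_integral[OF int])
  define R where "R y = \<rho> * (t - y) powr (- \<rho> - 1) * (Gamma \<rho> * abel \<rho> w y)" for y
  have R: "(\<lambda>y. \<integral>x. G y x \<partial>lborel) = (\<lambda>y. if y \<in> {0<..<s} then R y else 0)"
  proof
    fix y
    show "(\<integral>x. G y x \<partial>lborel) = (if y \<in> {0<..<s} then R y else 0)"
      using inner1[of y] G0[of y] by (auto simp: has_bochner_integral_iff R_def)
  qed
  have "integrable lborel (\<lambda>y. \<integral>x. G y x \<partial>lborel)"
    using lborel_pair.integrable_fst'[OF int] by simp
  from has_integral_integral_lborel[OF this]
  have RI: "(R has_integral (\<integral>y. (\<integral>x. G y x \<partial>lborel) \<partial>lborel)) {0..s}"
    unfolding R has_integral_restrict_UNIV has_integral_Icc_iff_Ioo .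
  define L where "L x = W x * ((s - x) powr \<rho> * (t - s) powr (- \<rho>) / (t - x))" for x
  have inner2: "has_bochner_integral lborel (\<lambda>y. G y x) (L x)" if x: "0 < x" "x < s" for x
  proof -
    have h: "((\<lambda>y. \<rho> * (t - y) powr (- \<rho> - 1) * (y - x) powr (\<rho> - 1)) has_integral
     (s - x) powr \<rho> * (t - s) powr (- \<rho>) / (t - x)) {x..s}"
      by (rule has_integral_abel_inner[OF \<rho> x(2) st(2)])
    then have "(\<lambda>y. \<rho> * (t - y) powr (- \<rho> - 1) * (y - x) powr (\<rho> - 1)) absolutely_integrable_on {x..s}"
      using \<rho> by (intro nonnegative_absolutely_integrable_1) auto
    then have "has_bochner_integral lborel (\<lambda>y. if x < y \<and> y < s then \<rho> * (t - y) powr (- \<rho> - 1) * (y - x) powr (\<rho> - 1) else 0)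
       (integral {x..s} (\<lambda>y. \<rho> * (t - y) powr (- \<rho> - 1) * (y - x) powr (\<rho> - 1)))"
      by (rule has_bochner_integral_Ioo) measurable
    then have "has_bochner_integral lborel (\<lambda>y. W x * (if x < y \<and> y < s then \<rho> * (t - y) powr (- \<rho> - 1) * (y - x) powr (\<rho> - 1) else 0)) (L x)"
      unfolding integral_unique[OF h] L_def by (rule has_bochner_integral_mult_right)
    moreover have "(\<lambda>y. W x * (if x < y \<and> y < s then \<rho> * (t - y) powr (- \<rho> - 1) * (y - x) powr (\<rho> - 1) else 0)) = (\<lambda>y. G y x)"
      using x by (auto simp: G_def fun_eq_iff)
    ultimately show ?thesis by simp
  qed
  have L: "(\<lambda>x. \<integral>y. G y x \<partial>lborel) = (\<lambda>x. if x \<in> {0<..<s} then L x else 0)"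
  proof
    fix x
    have "\<not> (0 < x \<and> x < s) \<Longrightarrow> (\<lambda>y. G y x) = (\<lambda>y. 0)" by (auto simp: G_def fun_eq_iff)
    then show "(\<integral>y. G y x \<partial>lborel) = (if x \<in> {0<..<s} then L x else 0)"
      using inner2[of x] by (auto simp: has_bochner_integral_iff)
  qed
  have "integrable lborel (\<lambda>x. \<integral>y. G y x \<partial>lborel)"
    using lborel_pair.integrable_snd[OF int] by simp
  from has_integral_integral_lborel[OF this]
  have LI: "(L has_integral (\<integral>x. (\<integral>y. G y x \<partial>lborel) \<partial>lborel)) {0..s}"
    unfolding L has_integral_restrict_UNIV has_integral_Icc_iff_Ioo .
  have "integral {0..s} R = Gamma \<rho> * integral {0..s} (\<lambda>y. \<rho> * (t - y) powr (- \<rho> - 1) * abel \<rho> w y)"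
  proof -
    have "R = (\<lambda>y. Gamma \<rho> * (\<rho> * (t - y) powr (- \<rho> - 1) * abel \<rho> w y))"
      by (simp add: R_def fun_eq_iff)
    then show ?thesis by (simp only: integral_mult_right)
  qed
  then have "(L has_integral Gamma \<rho> * integral {0..s} (\<lambda>y. \<rho> * (t - y) powr (- \<rho> - 1) * abel \<rho> w y)) {0..s}"
    using LI swap integral_unique[OF RI] by simp
  then show ?thesis by (rule has_integral_eq[rotated]) (simp add: L_def Ww)
qed

text \<open>As \<open>s\<close> tends to \<open>t\<close> from the left, this kernel concentrates at \<open>x = t\<close>; its total mass is read off
  from the case \<open>w = 1\<close>, where the derivative is a Beta integral.\<close>

definition abel_trunc_kernel :: "real \<Rightarrow> real \<Rightarrow> real \<Rightarrow> real \<Rightarrow> real" where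
  "abel_trunc_kernel \<rho> t s x = (t - s) powr (1 - \<rho>) * (s - x) powr (\<rho> - 1) / (t - x)"

text \<open>The boundary term at s and the memory term combine through 1 - (s - x) / (t - x) = (t -
  s) / (t - x); the boundary term at 0 is absent because \<open>abel\<close> vanishes there.\<close>

lemma caputo_trunc_abel:
  fixes w :: "real \<Rightarrow> real"
  assumes \<rho>: "0 < \<rho>" and st: "0 < s" "s < t" and w: "continuous_on {0..s} w"
  shows "((\<lambda>x. w x * abel_trunc_kernel \<rho> t s x) has_integral
     Gamma \<rho> * caputo_trunc \<rho> (abel \<rho> w) t s) {0..s}"
proof -
  have "((\<lambda>x. (t - s) powr (- \<rho>) * ((s - x) powr (\<rho> - 1) * w x) -
      w x * ((s - x) powr \<rho> * (t - s) powr (- \<rho>) / (t - x))) has_integral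
     ((t - s) powr (- \<rho>) * (Gamma \<rho> * abel \<rho> w s) -
     Gamma \<rho> * integral {0..s} (\<lambda>y. \<rho> * (t - y) powr (- \<rho> - 1) * abel \<rho> w y))) {0..s}"
    by (intro has_integral_diff has_integral_mult_right abel_eq_integral integral_abel_swap assms)
  moreover have "(t - s) powr (- \<rho>) * (Gamma \<rho> * abel \<rho> w s) -
     Gamma \<rho> * integral {0..s} (\<lambda>y. \<rho> * (t - y) powr (- \<rho> - 1) * abel \<rho> w y) =
     Gamma \<rho> * caputo_trunc \<rho> (abel \<rho> w) t s"
    by (simp add: caputo_trunc_def algebra_simps)
  ultimately have "((\<lambda>x. (t - s) powr (- \<rho>) * ((s - x) powr (\<rho> - 1) * w x) -
      w x * ((s - x) powr \<rho> * (t - s) powr (- \<rho>) / (t - x))) has_integral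
      Gamma \<rho> * caputo_trunc \<rho> (abel \<rho> w) t s) {0..s}" by simp
  then show ?thesis
  proof (rule has_integral_eq[rotated])
    fix x assume x: "x \<in> {0..s}"
    have e: "(s - x) powr \<rho> = (s - x) * (s - x) powr (\<rho> - 1)"
      using x by (cases "x = s") (simp_all add: powr_diff)
    have e': "(t - s) powr (1 - \<rho>) = (t - s) * (t - s) powr (- \<rho>)"
      using st by (simp add: powr_diff powr_minus_divide)
    show "(t - s) powr (- \<rho>) * ((s - x) powr (\<rho> - 1) * w x) -
      w x * ((s - x) powr \<rho> * (t - s) powr (- \<rho>) / (t - x)) = w x * abel_trunc_kernel \<rho> t s x"
      unfolding e e' abel_trunc_kernel_def using x st by (simp add: field_simps)
  qed
qed

section \<open>The limit of the truncated derivative of an Abel integral\<close>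

lemma abel_one:
  assumes "0 < \<rho>"
  shows "abel \<rho> (\<lambda>_. 1) t = t powr \<rho> / (\<rho> * Gamma \<rho>)"
  using integral_unique[OF has_integral_powr_right_end[OF assms, of 0 1]]
  by (simp add: abel_def)

lemma has_integral_Beta_scaled:
  fixes t :: real
  assumes \<rho>: "0 < \<rho>" "\<rho> < 1" and t: "0 < t"
  shows "((\<lambda>x. x powr (\<rho> - 1) * (t - x) powr (- \<rho>)) has_integral Gamma \<rho> * Gamma (1 - \<rho>)) {0..t}"
proof -
  let ?f = "\<lambda>x::real. x powr (\<rho> - 1) * (1 - x) powr ((1 - \<rho>) - 1)"
  have B: "(?f has_integral Gamma \<rho> * Gamma (1 - \<rho>)) (cbox 0 1)"
    using has_integral_Beta_real[of \<rho> "1 - \<rho>"] \<rho> by (simp add: Beta_def)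
  have "((\<lambda>x. ?f ((1/t) *\<^sub>R x + 0)) has_integral (1 / (\<bar>1/t\<bar> ^ DIM(real))) *\<^sub>R (Gamma \<rho> * Gamma (1 - \<rho>)))
     ((\<lambda>x. (1 / (1/t)) *\<^sub>R x + -((1 / (1/t)) *\<^sub>R 0)) ` cbox 0 1)"
    using t by (intro has_integral_affinity B) auto
  moreover have "(\<lambda>x. (1 / (1/t)) *\<^sub>R x + -((1 / (1/t)) *\<^sub>R 0)) ` cbox 0 1 = {0..t}"
    using t image_affinity_atLeastAtMost[of t 0 0 1] by (simp add: cbox_interval)
  ultimately have "((\<lambda>x. ?f (x / t)) has_integral (t * (Gamma \<rho> * Gamma (1 - \<rho>)))) {0..t}"
    using t by simp
  then have "((\<lambda>x. t * (x powr (\<rho> - 1) * (t - x) powr (- \<rho>))) has_integral (t * (Gamma \<rho> * Gamma (1 - \<rho>)))) {0..t}"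
  proof (rule has_integral_eq[rotated])
    fix x assume x: "x \<in> {0..t}"
    have 1: "1 - x / t = (t - x) / t" using t by (simp add: field_simps)
    have "?f (x / t) = x powr (\<rho> - 1) * (t - x) powr (- \<rho>) / (t powr (\<rho> - 1) * t powr (- \<rho>))"
      unfolding 1 using x t by (simp add: powr_divide)
    also have "t powr (\<rho> - 1) * t powr (- \<rho>) = 1 / t"
      using t by (simp add: powr_diff powr_minus inverse_eq_divide)
    finally show "?f (x / t) = t * (x powr (\<rho> - 1) * (t - x) powr (- \<rho>))" by simp
  qed
  from has_integral_mult_right[OF this, of "1/t"] show ?thesis using t by simp
qed

lemma has_caputo_deriv_abel_one:
  assumes \<rho>: "0 < \<rho>" "\<rho> < 1" and t: "0 < t"
  shows "has_caputo_deriv \<rho> (abel \<rho> (\<lambda>_. 1)) t 1"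
proof -
  have G: "Gamma \<rho> > 0" "Gamma (1 - \<rho>) > 0" using \<rho> by (auto intro!: Gamma_real_pos)
  have "has_caputo_deriv \<rho> (abel \<rho> (\<lambda>_. 1)) t (1 / Gamma (1 - \<rho>) * Gamma (1 - \<rho>))"
  proof (rule has_caputo_derivI[OF t])
    show "continuous_on {0..t} (abel \<rho> (\<lambda>_. 1))"
      using \<rho> by (intro continuous_on_abel continuous_intros)
    fix x assume x: "x \<in> {0<..<t}"
    show "(abel \<rho> (\<lambda>_. 1) has_real_derivative x powr (\<rho> - 1) / Gamma \<rho>) (at x)"
      unfolding abel_one[OF \<rho>(1), abs_def] using x \<rho> less_imp_neq[OF G(1)]
      by (auto intro!: derivative_eq_intros simp: powr_diff)
  next
    have "((\<lambda>x. 1 / Gamma \<rho> * (x powr (\<rho> - 1) * (t - x) powr (- \<rho>))) has_integral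
       1 / Gamma \<rho> * (Gamma \<rho> * Gamma (1 - \<rho>))) {0..t}"
      by (intro has_integral_mult_right has_integral_Beta_scaled assms)
    then show "((\<lambda>x. x powr (\<rho> - 1) / Gamma \<rho> / (t - x) powr \<rho>) has_integral Gamma (1 - \<rho>)) {0..t}"
      using G by (simp add: powr_minus_divide)
  qed
  then show ?thesis using G by simp
qed

lemma caputo_trunc_abel_one_tendsto:
  assumes \<rho>: "0 < \<rho>" "\<rho> < 1" and t: "0 < t"
  shows "(caputo_trunc \<rho> (abel \<rho> (\<lambda>_. 1)) t \<longlongrightarrow> Gamma (1 - \<rho>)) (at_left t)"
proof -
  have G: "Gamma (1 - \<rho>) > 0" using \<rho> by (auto intro!: Gamma_real_pos)
  have "((\<lambda>s. caputo_trunc \<rho> (abel \<rho> (\<lambda>_. 1)) t s / Gamma (1 - \<rho>)) \<longlongrightarrow> 1) (at_left t)"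
    using has_caputo_deriv_abel_one[OF assms] t \<rho>
    by (subst (asm) has_caputo_deriv_iff_trunc) (auto intro!: continuous_on_abel continuous_intros)
  from tendsto_mult_right[OF this, of "Gamma (1 - \<rho>)"] show ?thesis using G by simp
qed

text \<open>An approximate identity argument. Within distance d of t, continuity of \<open>w\<close>
  bounds the error by e' times the mass of the kernel; further away 1 / (t - x) is at most 1 / d,
  and the factor (t - s)^(1 - \<rho>) tends to 0.\<close>

lemma caputo_trunc_abel_tendsto:
  fixes w :: "real \<Rightarrow> real"
  assumes \<rho>: "0 < \<rho>" "\<rho> < 1" and t: "0 < t" and w: "continuous_on {0..t} w"
  shows "(caputo_trunc \<rho> (abel \<rho> w) t \<longlongrightarrow> w t * Gamma (1 - \<rho>)) (at_left t)"
proof -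
  have G: "Gamma \<rho> > 0" "Gamma (1 - \<rho>) > 0" using \<rho> by (auto intro!: Gamma_real_pos)
  define N where "N = caputo_trunc \<rho> (abel \<rho> (\<lambda>_. 1)) t"
  have N: "(N \<longlongrightarrow> Gamma (1 - \<rho>)) (at_left t)"
    unfolding N_def by (rule caputo_trunc_abel_one_tendsto[OF \<rho> t])
  obtain M where M: "M > 0" "\<And>x. x \<in> {0..t} \<Longrightarrow> \<bar>w x\<bar> \<le> M"
    using continuous_on_Icc_bounded[OF w] by blast
  have "((\<lambda>s. caputo_trunc \<rho> (abel \<rho> w) t s - w t * N s) \<longlongrightarrow> 0) (at_left t)"
  proof (rule tendstoI)
    fix e :: real assume e: "0 < e"
    \<comment> \<open>The mass \<open>N s\<close> tends to Gamma (1 - \<rho>), so the part near t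
      tends to e / 2 in \<open>U\<close>.\<close>
    define e' where "e' = e / (2 * Gamma (1 - \<rho>))"
    have e': "e' > 0" using e G by (simp add: e'_def)
    have "(w \<longlongrightarrow> w t) (at t within {0..t})" using w t by (auto simp: continuous_on_def)
    then obtain d where d: "d > 0" "\<And>x. x \<in> {0..t} \<Longrightarrow> \<bar>x - t\<bar> < d \<Longrightarrow> \<bar>w x - w t\<bar> \<le> e'"
      using tendstoD[of w "w t" "at t within {0..t}", OF _ e'] e'
      unfolding eventually_at dist_real_def by (metis abs_zero diff_self less_imp_le)
    define U where "U s = e' * N s + 2 * M / d * (t - s) powr (1 - \<rho>) * (s powr \<rho> / \<rho>) / Gamma \<rho>" for s
    have "((\<lambda>s. (t - s) powr (1 - \<rho>)) \<longlongrightarrow> (t - t) powr (1 - \<rho>)) (at_left t)"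
    proof -
      have "continuous_on {..t} (\<lambda>s. (t - s) powr (1 - \<rho>))"
        using \<rho> by (intro continuous_on_powr' continuous_intros) auto
      then have "((\<lambda>s. (t - s) powr (1 - \<rho>)) \<longlongrightarrow> (t - t) powr (1 - \<rho>)) (at t within {..t})"
        unfolding continuous_on_def by blast
      then show ?thesis by (rule tendsto_within_subset) auto
    qed
    note Z = this
    have "((\<lambda>s. s powr \<rho>) \<longlongrightarrow> t powr \<rho>) (at_left t)"
      using t by (intro tendsto_powr tendsto_const tendsto_ident_at) auto
    with Z have "(U \<longlongrightarrow> e' * Gamma (1 - \<rho>) + 2 * M / d * (t - t) powr (1 - \<rho>) * (t powr \<rho> / \<rho>) / Gamma \<rho>) (at_left t)"
      unfolding U_def using \<rho> less_imp_neq[OF G(1)] d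
      by (intro tendsto_add tendsto_mult tendsto_divide tendsto_const N) auto
    then have "(U \<longlongrightarrow> e / 2) (at_left t)" using G \<rho> by (simp add: e'_def)
    then have "eventually (\<lambda>s. U s < e) (at_left t)" using e by (intro order_tendstoD(2)[of U "e / 2"]) auto
    moreover have "eventually (\<lambda>s. s \<in> {0<..<t}) (at_left t)" using t by (rule eventually_at_left_real)
    ultimately show "eventually (\<lambda>s. dist (caputo_trunc \<rho> (abel \<rho> w) t s - w t * N s) 0 < e) (at_left t)"
    proof eventually_elim
      case (elim s)
      then have s: "0 < s" "s < t" by auto
      let ?K = "abel_trunc_kernel \<rho> t s"
      have ws: "continuous_on {0..s} w" using w s by (auto intro: continuous_on_subset)
      have iN: "((\<lambda>x. 1 * ?K x) has_integral Gamma \<rho> * N s) {0..s}"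
        unfolding N_def using s \<rho> by (intro caputo_trunc_abel) auto
      have "((\<lambda>x. w x * ?K x - w t * (1 * ?K x)) has_integral
         (Gamma \<rho> * caputo_trunc \<rho> (abel \<rho> w) t s - w t * (Gamma \<rho> * N s))) {0..s}"
        using s \<rho> by (intro has_integral_diff has_integral_mult_right iN caputo_trunc_abel ws) auto
      then have I: "((\<lambda>x. (w x - w t) * ?K x) has_integral
         Gamma \<rho> * (caputo_trunc \<rho> (abel \<rho> w) t s - w t * N s)) {0..s}"
        by (simp add: algebra_simps)
      have J: "((\<lambda>x. e' * (1 * ?K x) + 2 * M / d * (t - s) powr (1 - \<rho>) * (s - x) powr (\<rho> - 1)) has_integral
         e' * (Gamma \<rho> * N s) + 2 * M / d * (t - s) powr (1 - \<rho>) * ((s - 0) powr \<rho> / \<rho>)) {0..s}"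
        using s \<rho> by (intro has_integral_add has_integral_mult_right iN has_integral_powr_right_end) auto
      have "norm (integral {0..s} (\<lambda>x. (w x - w t) * ?K x)) \<le>
         integral {0..s} (\<lambda>x. e' * (1 * ?K x) + 2 * M / d * (t - s) powr (1 - \<rho>) * (s - x) powr (\<rho> - 1))"
      proof (rule integral_norm_bound_integral)
        fix x assume x: "x \<in> {0..s}"
        have K0: "?K x \<ge> 0" using x s by (simp add: abel_trunc_kernel_def)
        show "norm ((w x - w t) * ?K x) \<le> e' * (1 * ?K x) + 2 * M / d * (t - s) powr (1 - \<rho>) * (s - x) powr (\<rho> - 1)"
        proof (cases "\<bar>x - t\<bar> < d")
          case True
          then have "\<bar>w x - w t\<bar> * ?K x \<le> e' * ?K x"
            using x s K0 by (intro mult_right_mono d(2)) auto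
          moreover have "0 \<le> 2 * M / d * (t - s) powr (1 - \<rho>) * (s - x) powr (\<rho> - 1)" using M d by simp
          ultimately show ?thesis using K0 by (simp add: abs_mult)
        next
          case False
          then have td: "d \<le> t - x" using x s by auto
          have "\<bar>w x - w t\<bar> \<le> 2 * M" using M(2)[of x] M(2)[of t] x s by (auto simp: abs_le_iff)
          moreover have "?K x \<le> (t - s) powr (1 - \<rho>) * (s - x) powr (\<rho> - 1) / d"
            unfolding abel_trunc_kernel_def using td d by (intro divide_left_mono) auto
          ultimately have "\<bar>w x - w t\<bar> * ?K x \<le> 2 * M * ((t - s) powr (1 - \<rho>) * (s - x) powr (\<rho> - 1) / d)"
            using K0 M by (intro mult_mono) auto
          moreover have "0 \<le> e' * ?K x" using e' K0 by simp
          ultimately show ?thesis using K0 by (simp add: abs_mult)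
        qed
      qed (use I J in auto)
      then have "Gamma \<rho> * \<bar>caputo_trunc \<rho> (abel \<rho> w) t s - w t * N s\<bar> \<le> Gamma \<rho> * U s"
        unfolding integral_unique[OF I] integral_unique[OF J] using G by (simp add: abs_mult U_def distrib_left mult_ac)
      then have "\<bar>caputo_trunc \<rho> (abel \<rho> w) t s - w t * N s\<bar> \<le> U s"
        by (rule mult_left_le_imp_le[OF _ G(1)])
      then show ?case using elim by (simp add: dist_real_def)
    qed
  qed
  from tendsto_add[OF this tendsto_mult_left[OF N, of "w t"]] show ?thesis by simp
qed

lemma has_caputo_deriv_abel:
  assumes \<rho>: "0 < \<rho>" "\<rho> < 1" and t: "0 < t" and w: "continuous_on {0..t} w"
  shows "has_caputo_deriv \<rho> (abel \<rho> w) t (w t)"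
proof -
  have G: "Gamma (1 - \<rho>) > 0" using \<rho> by (auto intro!: Gamma_real_pos)
  have "((\<lambda>s. caputo_trunc \<rho> (abel \<rho> w) t s / Gamma (1 - \<rho>)) \<longlongrightarrow> w t * Gamma (1 - \<rho>) / Gamma (1 - \<rho>)) (at_left t)"
    using G by (intro tendsto_divide caputo_trunc_abel_tendsto assms tendsto_const) auto
  then show ?thesis
    using G t \<rho> w by (subst has_caputo_deriv_iff_trunc) (auto intro!: continuous_on_abel)
qed

lemma caputo_trunc_abel_bounded:
  assumes \<rho>: "0 < \<rho>" "\<rho> < 1" and t: "0 < t"
  shows "\<exists>M. eventually (\<lambda>s. \<forall>w A C. continuous_on {0..t} w \<longrightarrow> 0 \<le> A \<longrightarrow> 0 \<le> C \<longrightarrow>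
     (\<forall>x\<in>{0<..t}. \<bar>w x\<bar> \<le> A + C * x powr (- \<rho>)) \<longrightarrow>
     \<bar>caputo_trunc \<rho> (abel \<rho> w) t s\<bar> \<le> M * (A + C)) (at_left t)"
proof -
  have G: "Gamma \<rho> > 0" "Gamma (1 - \<rho>) > 0" using \<rho> by (auto intro!: Gamma_real_pos)
  define N where "N = caputo_trunc \<rho> (abel \<rho> (\<lambda>_. 1)) t"
  have N: "eventually (\<lambda>s. N s < Gamma (1 - \<rho>) + 1) (at_left t)"
    unfolding N_def by (rule order_tendstoD(2)[OF caputo_trunc_abel_one_tendsto[OF \<rho> t]]) simp
  \<comment> \<open>The weight x^(-\<rho>) and the kernel are singular at opposite ends of [0, s].
    Right of t / 4 the weight is at most \<open>a\<close>; left of it, once s > t / 2, the kernel is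
    at most \<open>b\<close>.\<close>
  define a where "a = (t / 4) powr (- \<rho>)"
  define b where "b = t powr (1 - \<rho>) * (t / 4) powr (\<rho> - 1) / (t / 2)"
  define M where "M = max (Gamma (1 - \<rho>) + 1) (a * (Gamma (1 - \<rho>) + 1) + b * t powr (1 - \<rho>) / (1 - \<rho>) / Gamma \<rho>)"
  have ab: "a > 0" "b > 0" using t by (auto simp: a_def b_def)
  have "eventually (\<lambda>s. s \<in> {t/2<..<t}) (at_left t)" using t by (intro eventually_at_left_real) auto
  with N have "eventually (\<lambda>s. \<forall>w A C. continuous_on {0..t} w \<longrightarrow> 0 \<le> A \<longrightarrow> 0 \<le> C \<longrightarrow>
     (\<forall>x\<in>{0<..t}. \<bar>w x\<bar> \<le> A + C * x powr (- \<rho>)) \<longrightarrow>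
     \<bar>caputo_trunc \<rho> (abel \<rho> w) t s\<bar> \<le> M * (A + C)) (at_left t)"
  proof eventually_elim
    case (elim s)
    then have s: "t / 2 < s" "s < t" "0 < s" and Ns: "N s \<le> Gamma (1 - \<rho>) + 1" using t by auto
    show ?case
    proof (intro allI impI)
      fix w A C assume w: "continuous_on {0..t} w" and AC: "0 \<le> (A::real)" "0 \<le> (C::real)"
        and wb: "\<forall>x\<in>{0<..t}. \<bar>w x\<bar> \<le> A + C * x powr (- \<rho>)"
      let ?K = "abel_trunc_kernel \<rho> t s"
      define R where "R = (\<lambda>x. (A + C * a) * (1 * ?K x) + (C * b) * (x - 0) powr ((1 - \<rho>) - 1))"
      have iN: "((\<lambda>x. 1 * ?K x) has_integral Gamma \<rho> * N s) {0..s}"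
        unfolding N_def using s \<rho> by (intro caputo_trunc_abel) auto
      have R: "(R has_integral (A + C * a) * (Gamma \<rho> * N s) + (C * b) * ((s - 0) powr (1 - \<rho>) / (1 - \<rho>))) {0..s}"
        unfolding R_def using s \<rho> by (intro has_integral_add has_integral_mult_right iN has_integral_powr_left_end) auto
      have I: "((\<lambda>x. w x * ?K x) has_integral Gamma \<rho> * caputo_trunc \<rho> (abel \<rho> w) t s) {0..s}"
        using s \<rho> by (intro caputo_trunc_abel continuous_on_subset[OF w]) auto
      have pw: "\<bar>w x * ?K x\<bar> \<le> R x" if x: "x \<in> {0<..<s}" for x
      proof -
        have K0: "?K x \<ge> 0" using x s by (simp add: abel_trunc_kernel_def)
        have "x powr (- \<rho>) * ?K x \<le> a * ?K x + b * x powr (- \<rho>)"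
        proof (cases "x \<ge> t / 4")
          case True
          then have "x powr (- \<rho>) \<le> a" unfolding a_def using \<rho> t by (intro powr_mono2') auto
          then have "x powr (- \<rho>) * ?K x \<le> a * ?K x" using K0 by (rule mult_right_mono)
          moreover have "b * x powr (- \<rho>) \<ge> 0" using ab by simp
          ultimately show ?thesis by linarith
        next
          case False
          have "(t - s) powr (1 - \<rho>) \<le> t powr (1 - \<rho>)" using s \<rho> by (intro powr_mono2) auto
          moreover have "(s - x) powr (\<rho> - 1) \<le> (t / 4) powr (\<rho> - 1)"
            using False s \<rho> t by (intro powr_mono2') auto
          ultimately have "?K x \<le> b"
            unfolding abel_trunc_kernel_def b_def using s x t False
            by (intro frac_le mult_mono) auto
          then have "x powr (- \<rho>) * ?K x \<le> x powr (- \<rho>) * b" by (intro mult_left_mono) auto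
          moreover have "a * ?K x \<ge> 0" using ab K0 by simp
          ultimately show ?thesis by (simp add: mult.commute)
        qed
        then have "C * (x powr (- \<rho>) * ?K x) \<le> C * (a * ?K x + b * x powr (- \<rho>))"
          using AC by (intro mult_left_mono)
        moreover have "\<bar>w x\<bar> * ?K x \<le> (A + C * x powr (- \<rho>)) * ?K x"
          using wb x s K0 by (intro mult_right_mono) auto
        ultimately show ?thesis using K0 by (simp add: R_def abs_mult algebra_simps)
      qed
      \<comment> \<open>The pointwise bound holds in the open interval only: at 0 the hypothesis
        says nothing about \<open>w\<close>, and \<open>powr\<close> gives the weight the value 0
        instead of infinity. Removing the endpoints does not change the integrals.\<close>
      have R': "(R has_integral (A + C * a) * (Gamma \<rho> * N s) + (C * b) * (s powr (1 - \<rho>) / (1 - \<rho>))) {0<..<s}"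
        using R by (simp add: has_integral_Icc_iff_Ioo)
      have I': "((\<lambda>x. w x * ?K x) has_integral Gamma \<rho> * caputo_trunc \<rho> (abel \<rho> w) t s) {0<..<s}"
        using I by (simp add: has_integral_Icc_iff_Ioo)
      have "Gamma \<rho> * caputo_trunc \<rho> (abel \<rho> w) t s \<le> (A + C * a) * (Gamma \<rho> * N s) + (C * b) * (s powr (1 - \<rho>) / (1 - \<rho>))"
        using pw by (intro has_integral_le[OF I' R']) (auto simp: abs_le_iff)
      moreover have "- (Gamma \<rho> * caputo_trunc \<rho> (abel \<rho> w) t s) \<le> (A + C * a) * (Gamma \<rho> * N s) + (C * b) * (s powr (1 - \<rho>) / (1 - \<rho>))"
        using pw by (intro has_integral_le[OF has_integral_neg[OF I'] R']) (auto simp: abs_le_iff)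
      ultimately have "Gamma \<rho> * \<bar>caputo_trunc \<rho> (abel \<rho> w) t s\<bar> \<le> (A + C * a) * (Gamma \<rho> * N s) + (C * b) * (s powr (1 - \<rho>) / (1 - \<rho>))"
        by (auto simp: abs_if)
      also have "\<dots> \<le> (A + C * a) * (Gamma \<rho> * (Gamma (1 - \<rho>) + 1)) + (C * b) * (t powr (1 - \<rho>) / (1 - \<rho>))"
        using Ns AC ab G s \<rho> by (intro add_mono mult_left_mono divide_right_mono powr_mono2) auto
      also have "\<dots> = Gamma \<rho> * (A * (Gamma (1 - \<rho>) + 1) + C * (a * (Gamma (1 - \<rho>) + 1) + b * t powr (1 - \<rho>) / (1 - \<rho>) / Gamma \<rho>))"
        using less_imp_neq[OF G(1)] by (simp add: distrib_left distrib_right mult_ac)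
      finally have "\<bar>caputo_trunc \<rho> (abel \<rho> w) t s\<bar> \<le> A * (Gamma (1 - \<rho>) + 1) + C * (a * (Gamma (1 - \<rho>) + 1) + b * t powr (1 - \<rho>) / (1 - \<rho>) / Gamma \<rho>)"
        using G by simp
      also have "\<dots> \<le> A * M + C * M"
        using AC by (intro add_mono mult_left_mono) (auto simp: M_def)
      finally show "\<bar>caputo_trunc \<rho> (abel \<rho> w) t s\<bar> \<le> M * (A + C)" by (simp add: algebra_simps)
    qed
  qed
  then show ?thesis by blast
qed

section \<open>The fractional relaxation equation\<close>

lemma exp_minus_le_powr:
  fixes z :: real
  assumes "0 < z" "0 \<le> p" "p \<le> 1"
  shows "exp (- z) \<le> z powr (- p)"
proof -
  have "p * ln z \<le> z"
  proof (cases "ln z \<le> 0")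
    case True
    then have "p * ln z \<le> 0" using assms by (simp add: mult_nonneg_nonpos)
    then show ?thesis using assms by linarith
  next
    case False
    then have "p * ln z \<le> ln z" using assms by (simp add: mult_left_le_one_le)
    then show ?thesis using ln_le_minus_one[OF assms(1)] by linarith
  qed
  then have "exp (- z) \<le> exp (- (p * ln z))" by simp
  then show ?thesis using assms by (simp add: powr_def)
qed

text \<open>Relative to the weight exp (\<gamma> * x) the Abel integral gains a negative power of
  \<open>\<gamma>\<close>. The factor exp (- \<gamma> * t * (1 - y)) is bounded by (\<gamma> * t *
  (1 - y))^(-\<rho> / 2), which spends half of the exponent of the kernel and leaves (1 - y)^(\<rho>
  / 2 - 1), still integrable.\<close>

lemma abel_exp_bound:
  fixes w :: "real \<Rightarrow> real"
  assumes \<rho>: "0 < \<rho>" "\<rho> < 1" and t: "0 \<le> t" and w: "continuous_on {0..t} w"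
    and \<gamma>: "0 < \<gamma>" and M: "\<And>x. x \<in> {0..t} \<Longrightarrow> \<bar>w x\<bar> \<le> M * exp (\<gamma> * x)"
  shows "\<bar>abel \<rho> w t\<bar> \<le> M * exp (\<gamma> * t) * (2 / \<rho> * t powr (\<rho> / 2) * \<gamma> powr (- (\<rho> / 2)) / Gamma \<rho>)"
proof (cases "t = 0")
  case True
  then show ?thesis by simp
next
  case False
  then have t: "0 < t" using t by simp
  have M0: "M \<ge> 0" using M[of 0] t by auto
  have G: "Gamma \<rho> > 0" using \<rho> by (auto intro!: Gamma_real_pos)
  let ?c = "M * exp (\<gamma> * t) * (\<gamma> * t) powr (- (\<rho> / 2))"
  have R: "((\<lambda>y. ?c * (1 - y) powr (\<rho> / 2 - 1)) has_integral ?c * ((1 - 0) powr (\<rho> / 2) / (\<rho> / 2))) {0..1}"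
    using \<rho> by (intro has_integral_mult_right has_integral_powr_right_end) auto
  have "norm (integral {0..1} (\<lambda>y. (1 - y) powr (\<rho> - 1) * w (t * y))) \<le> integral {0..1} (\<lambda>y. ?c * (1 - y) powr (\<rho> / 2 - 1))"
  proof (rule integral_norm_bound_integral)
    show "(\<lambda>y. (1 - y) powr (\<rho> - 1) * w (t * y)) integrable_on {0..1}"
      using abel_kernel_integrable[OF \<rho>(1) w, of t] t by (auto intro: set_lebesgue_integral_eq_integral)
    fix y :: real assume y: "y \<in> {0..1}"
    show "norm ((1 - y) powr (\<rho> - 1) * w (t * y)) \<le> ?c * (1 - y) powr (\<rho> / 2 - 1)"
    proof (cases "y = 1")
      case False
      then have y1: "y < 1" using y by auto
      have "t * y \<in> {0..t}" using y t mult_left_le[of y t] by auto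
      then have "\<bar>w (t * y)\<bar> \<le> M * exp (\<gamma> * (t * y))" by (rule M)
      also have "exp (\<gamma> * (t * y)) = exp (\<gamma> * t) * exp (- (\<gamma> * t * (1 - y)))"
        by (simp add: exp_add[symmetric] algebra_simps)
      also have "M * \<dots> \<le> M * (exp (\<gamma> * t) * (\<gamma> * t * (1 - y)) powr (- (\<rho> / 2)))"
        using M0 \<gamma> t y1 \<rho> by (intro mult_left_mono exp_minus_le_powr) auto
      also have "(\<gamma> * t * (1 - y)) powr (- (\<rho> / 2)) = (\<gamma> * t) powr (- (\<rho> / 2)) * (1 - y) powr (- (\<rho> / 2))"
        by (rule powr_mult)
      finally have "\<bar>w (t * y)\<bar> \<le> ?c * (1 - y) powr (- (\<rho> / 2))" by (simp add: mult_ac)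
      then have "(1 - y) powr (\<rho> - 1) * \<bar>w (t * y)\<bar> \<le> (1 - y) powr (\<rho> - 1) * (?c * (1 - y) powr (- (\<rho> / 2)))"
        by (intro mult_left_mono) auto
      also have "\<dots> = ?c * ((1 - y) powr (\<rho> - 1) * (1 - y) powr (- (\<rho> / 2)))" by simp
      also have "(1 - y) powr (\<rho> - 1) * (1 - y) powr (- (\<rho> / 2)) = (1 - y) powr (\<rho> / 2 - 1)"
        by (simp add: powr_add[symmetric])
      finally show ?thesis by (simp add: abs_mult)
    qed simp
  qed (use R in auto)
  also have "\<dots> = ?c * (2 / \<rho>)" using integral_unique[OF R] by simp
  finally have b: "\<bar>integral {0..1} (\<lambda>y. (1 - y) powr (\<rho> - 1) * w (t * y))\<bar> \<le> ?c * (2 / \<rho>)" by simp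
  have "\<bar>abel \<rho> w t\<bar> = t powr \<rho> / Gamma \<rho> * \<bar>integral {0..1} (\<lambda>y. (1 - y) powr (\<rho> - 1) * w (t * y))\<bar>"
    using G by (simp add: abel_def abs_mult)
  also have "\<dots> \<le> t powr \<rho> / Gamma \<rho> * (?c * (2 / \<rho>))"
    using b G by (intro mult_left_mono) auto
  also have "\<dots> = M * exp (\<gamma> * t) * (2 / \<rho> * (t powr \<rho> * t powr (- (\<rho> / 2))) * \<gamma> powr (- (\<rho> / 2)) / Gamma \<rho>)"
    by (simp add: powr_mult mult_ac)
  also have "t powr \<rho> * t powr (- (\<rho> / 2)) = t powr (\<rho> / 2)" by (simp add: powr_add[symmetric])
  finally show ?thesis .
qed

lemma abel_diff:
  assumes \<rho>: "0 < \<rho>" and c: "continuous_on {0..t} v" "continuous_on {0..t} w" and t: "0 \<le> t"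
  shows "abel \<rho> (\<lambda>x. v x - w x) t = abel \<rho> v t - abel \<rho> w t"
proof -
  have "integral {0..1} (\<lambda>y. (1 - y) powr (\<rho> - 1) * (v (t * y) - w (t * y))) =
    integral {0..1} (\<lambda>y. (1 - y) powr (\<rho> - 1) * v (t * y)) - integral {0..1} (\<lambda>y. (1 - y) powr (\<rho> - 1) * w (t * y))"
    unfolding right_diff_distrib
    using abel_kernel_integrable[OF \<rho> c(1), of t] abel_kernel_integrable[OF \<rho> c(2), of t] t
    by (intro Henstock_Kurzweil_Integration.integral_diff) (auto intro: set_lebesgue_integral_eq_integral)
  then show ?thesis by (simp add: abel_def right_diff_distrib)
qed

text \<open>Picard iteration in the norm weighted by exp (- \<gamma> * t). For large
  \<open>\<gamma>\<close> the Volterra map contracts by the factor 1 / 2 on all of [0, T], however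
  large \<open>a\<close> and \<open>T\<close> are, so no continuation from short intervals is
  involved.\<close>

lemma abel_volterra_solution:
  fixes a g :: "real \<Rightarrow> real"
  assumes \<rho>: "0 < \<rho>" "\<rho> < 1" and T: "0 < T" and a: "continuous_on {0..T} a" and g: "continuous_on {0..T} g"
  obtains w where "continuous_on {0..T} w" "\<And>t. t \<in> {0..T} \<Longrightarrow> w t = g t - a t * (c + abel \<rho> w t)"
proof -
  have G: "Gamma \<rho> > 0" using \<rho> by (auto intro!: Gamma_real_pos)
  obtain A where A: "A > 0" "\<And>t. t \<in> {0..T} \<Longrightarrow> \<bar>a t\<bar> \<le> A"
    using continuous_on_Icc_bounded[OF a] by blast
  define B where "B = A * (2 / \<rho> * T powr (\<rho> / 2) / Gamma \<rho>)"
  have B: "B > 0" using A \<rho> T G by (simp add: B_def)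
  \<comment> \<open>The solution of B * \<gamma>^(-\<rho> / 2) = 1 / 2, which is the contraction
    factor.\<close>
  define \<gamma> where "\<gamma> = (2 * B) powr (2 / \<rho>)"
  have \<gamma>: "\<gamma> > 0" using B by (simp add: \<gamma>_def)
  have \<gamma>': "\<gamma> powr (- (\<rho> / 2)) = 1 / (2 * B)"
    using B \<rho> by (simp add: \<gamma>_def powr_powr powr_minus_divide)
  have contr: "\<bar>a t * abel \<rho> w t\<bar> \<le> (M / 2) * exp (\<gamma> * t)"
    if "continuous_on {0..T} w" "t \<in> {0..T}" "\<And>x. x \<in> {0..T} \<Longrightarrow> \<bar>w x\<bar> \<le> M * exp (\<gamma> * x)" for w M t
  proof -
    have M0: "M \<ge> 0" using that(3)[of 0] T by auto
    have "\<bar>abel \<rho> w t\<bar> \<le> M * exp (\<gamma> * t) * (2 / \<rho> * t powr (\<rho> / 2) * \<gamma> powr (- (\<rho> / 2)) / Gamma \<rho>)"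
      using that by (intro abel_exp_bound \<rho> \<gamma> continuous_on_subset[OF that(1)]) auto
    also have "\<dots> \<le> M * exp (\<gamma> * t) * (2 / \<rho> * T powr (\<rho> / 2) * \<gamma> powr (- (\<rho> / 2)) / Gamma \<rho>)"
      using that M0 \<rho> G by (intro mult_left_mono divide_right_mono mult_right_mono powr_mono2) auto
    finally have "\<bar>a t\<bar> * \<bar>abel \<rho> w t\<bar> \<le> A * (M * exp (\<gamma> * t) * (2 / \<rho> * T powr (\<rho> / 2) * \<gamma> powr (- (\<rho> / 2)) / Gamma \<rho>))"
      using A that by (intro mult_mono) auto
    also have "\<dots> = M * exp (\<gamma> * t) * (B * \<gamma> powr (- (\<rho> / 2)))" by (simp add: B_def)
    also have "B * \<gamma> powr (- (\<rho> / 2)) = 1 / 2" unfolding \<gamma>' using B by simp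
    finally show ?thesis by (simp add: abs_mult)
  qed
  define W where "W = rec_nat (\<lambda>_. 0) (\<lambda>_ v t. g t - a t * (c + abel \<rho> v t))"
  have W0: "W 0 = (\<lambda>_. 0)" and WS: "W (Suc n) = (\<lambda>t. g t - a t * (c + abel \<rho> (W n) t))" for n
    by (simp_all add: W_def)
  have Wc: "continuous_on {0..T} (W n)" for n
    by (induction n) (auto simp: W0 WS intro!: continuous_intros a g continuous_on_abel \<rho>)
  have sub: "continuous_on {0..t} v" if "continuous_on {0..T} v" "t \<in> {0..T}" for v :: "real \<Rightarrow> real" and t
    using that by (auto intro: continuous_on_subset)
  have c1: "continuous_on {0..T} (W 1)" by (rule Wc)
  obtain M where M: "M > 0" "\<And>x. x \<in> {0..T} \<Longrightarrow> \<bar>W 1 x\<bar> \<le> M"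
    using continuous_on_Icc_bounded[OF Wc] by blast
  have step: "t \<in> {0..T} \<Longrightarrow> \<bar>W (Suc n) t - W n t\<bar> \<le> M / 2 ^ n * exp (\<gamma> * t)" for n t
  proof (induction n arbitrary: t)
    case 0
    have "M \<le> M * exp (\<gamma> * t)" using M \<gamma> 0 by simp
    then show ?case using M(2)[OF 0] W0 by (simp del: mult_le_cancel_left1)
  next
    case (Suc n)
    have "W (Suc (Suc n)) t - W (Suc n) t = - (a t * abel \<rho> (\<lambda>x. W (Suc n) x - W n x) t)"
    proof -
      have "abel \<rho> (\<lambda>x. W (Suc n) x - W n x) t = abel \<rho> (W (Suc n)) t - abel \<rho> (W n) t"
        using Suc.prems by (intro abel_diff \<rho> sub[OF Wc]) auto
      moreover have "W (Suc (Suc n)) t = g t - a t * (c + abel \<rho> (W (Suc n)) t)"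
        "W (Suc n) t = g t - a t * (c + abel \<rho> (W n) t)" by (simp_all only: WS)
      ultimately show ?thesis by (simp only:) (simp add: algebra_simps)
    qed
    moreover have "\<bar>a t * abel \<rho> (\<lambda>x. W (Suc n) x - W n x) t\<bar> \<le> (M / 2 ^ n / 2) * exp (\<gamma> * t)"
      by (intro contr continuous_intros Wc Suc)
    ultimately show ?case by (simp add: mult.commute)
  qed
  \<comment> \<open>The iterates are the partial sums of their own differences, so their uniform
    convergence follows from the geometric bound \<open>step\<close>.\<close>
  have "uniform_limit {0..T} (\<lambda>n t. \<Sum>i<n. W (Suc i) t - W i t) (\<lambda>t. \<Sum>i. W (Suc i) t - W i t) sequentially"
  proof (rule Weierstrass_m_test)
    show "summable (\<lambda>n. M / 2 ^ n * exp (\<gamma> * T))"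
      using summable_mult2[OF summable_mult[OF summable_geometric[of "1/2::real"], of M], of "exp (\<gamma> * T)"]
      by (simp add: power_divide)
    fix n t assume t: "t \<in> {0..T}"
    have "\<bar>W (Suc n) t - W n t\<bar> \<le> M / 2 ^ n * exp (\<gamma> * t)" by (rule step[OF t])
    also have "\<dots> \<le> M / 2 ^ n * exp (\<gamma> * T)" using t \<gamma> M by (intro mult_left_mono) auto
    finally show "norm (W (Suc n) t - W n t) \<le> M / 2 ^ n * exp (\<gamma> * T)" by simp
  qed
  moreover have "(\<Sum>i<n. W (Suc i) t - W i t) = W n t" for n t
    using sum_lessThan_telescope[of "\<lambda>i. W i t" n] by (simp add: W0)
  ultimately obtain w where w: "uniform_limit {0..T} W w sequentially" by (auto simp: fun_eq_iff)
  have wc: "continuous_on {0..T} w"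
    by (rule uniform_limit_theorem[OF _ w]) (auto simp: Wc)
  have "w t = g t - a t * (c + abel \<rho> w t)" if t: "t \<in> {0..T}" for t
  proof -
    \<comment> \<open>The contraction estimate serves once more, now as continuity of the Volterra
      map, applied to the difference of an iterate and the limit.\<close>
    have "(\<lambda>n. a t * abel \<rho> (W n) t - a t * abel \<rho> w t) \<longlonglongrightarrow> 0"
    proof (rule metric_LIMSEQ_I)
      fix e :: real assume e: "0 < e"
      define e' where "e' = e / exp (\<gamma> * T)"
      have e': "e' > 0" using e by (simp add: e'_def)
      obtain N where N: "\<And>n x. n \<ge> N \<Longrightarrow> x \<in> {0..T} \<Longrightarrow> \<bar>W n x - w x\<bar> < e'"
        using uniform_limitD[OF w e'] unfolding eventually_sequentially dist_real_def by blast
      have "dist (a t * abel \<rho> (W n) t - a t * abel \<rho> w t) 0 < e" if n: "n \<ge> N" for n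
      proof -
        have "\<bar>a t * abel \<rho> (\<lambda>x. W n x - w x) t\<bar> \<le> (e' / 2) * exp (\<gamma> * t)"
        proof (intro contr continuous_intros Wc wc t)
          fix x assume x: "x \<in> {0..T}"
          have "e' * 1 \<le> e' * exp (\<gamma> * x)" using x e' \<gamma> by (intro mult_left_mono) auto
          then show "\<bar>W n x - w x\<bar> \<le> e' * exp (\<gamma> * x)" using N[OF n x] by linarith
        qed
        also have "\<dots> \<le> (e' / 2) * exp (\<gamma> * T)" using t \<gamma> e' by (intro mult_left_mono) auto
        also have "\<dots> < e" using e by (simp add: e'_def)
        finally show ?thesis
          using abel_diff[OF \<rho>(1) sub[OF Wc t] sub[OF wc t], of n] t by (simp add: dist_real_def right_diff_distrib)
      qed
      then show "\<exists>N. \<forall>n\<ge>N. dist (a t * abel \<rho> (W n) t - a t * abel \<rho> w t) 0 < e" by blast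
    qed
    then have "(\<lambda>n. (g t - a t * c) - a t * abel \<rho> w t - (a t * abel \<rho> (W n) t - a t * abel \<rho> w t)) \<longlonglongrightarrow>
        (g t - a t * c) - a t * abel \<rho> w t - 0"
      by (intro tendsto_intros)
    then have "(\<lambda>n. W (Suc n) t) \<longlonglongrightarrow> g t - a t * (c + abel \<rho> w t)"
      by (simp add: WS algebra_simps)
    moreover have "(\<lambda>n. W (Suc n) t) \<longlonglongrightarrow> w t"
      using tendsto_uniform_limitI[OF w t] by (rule LIMSEQ_Suc)
    ultimately show ?thesis using LIMSEQ_unique by blast
  qed
  then show ?thesis using that wc by blast
qed

lemma has_caputo_deriv_const_plus_abel:
  assumes \<rho>: "0 < \<rho>" "\<rho> < 1" and t: "0 < t" and w: "continuous_on {0..t} w"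
  shows "has_caputo_deriv \<rho> (\<lambda>x. c + abel \<rho> w x) t (w t)"
proof -
  have "has_caputo_deriv \<rho> (\<lambda>x. 1 * c + 1 * abel \<rho> w x) t (1 * 0 + 1 * w t)"
    using t by (intro has_caputo_deriv_linear has_caputo_deriv_const has_caputo_deriv_abel continuous_on_abel assms) auto
  then show ?thesis by simp
qed

text \<open>An elementary supersolution of D y = - C \<kappa> y, where C depends on \<rho> only. In
  C the factor 2^\<rho> comes from comparing the barrier at t / 2 and at t, and 1 / (1 - \<rho>) = 1
  + \<rho> / (1 - \<rho>) from adding the two halves of the integral.\<close>

lemma caputo_barrier:
  assumes \<rho>: "0 < \<rho>" "\<rho> < 1" and \<kappa>: "0 < \<kappa>" and t: "0 < t"
  obtains D where "has_caputo_deriv \<rho> (\<lambda>t. 1 / (1 + \<kappa> * t powr \<rho>)) t D"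
    "- (\<kappa> * (2 powr \<rho> / ((1 - \<rho>) * Gamma (1 - \<rho>))) * (1 / (1 + \<kappa> * t powr \<rho>))) \<le> D"
proof -
  have G: "Gamma (1 - \<rho>) > 0" using \<rho> by (auto intro!: Gamma_real_pos)
  let ?B = "\<lambda>t. 1 / (1 + \<kappa> * t powr \<rho>)"
  let ?b = "\<lambda>x. \<kappa> * \<rho> * x powr (\<rho> - 1) / (1 + \<kappa> * x powr \<rho>)\<^sup>2"
  have pos: "1 + \<kappa> * x powr \<rho> > 0" for x using \<kappa> by (simp add: add_pos_nonneg)
  have Bc: "continuous_on {0..r} ?B" for r
    using pos \<rho> less_imp_neq[OF pos]
    by (intro continuous_on_divide continuous_on_add continuous_on_mult continuous_on_powr' continuous_on_const continuous_on_id) auto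
  have dB: "(?B has_real_derivative - ?b x) (at x)" if "0 < x" for x
    using that less_imp_neq[OF pos[of x]]
    by (auto intro!: derivative_eq_intros simp: powr_diff power2_eq_square)
  let ?J = "\<lambda>x. ?b x / (t - x) powr \<rho>"
  have "(\<lambda>x. x powr (\<rho> - 1) * (t - x) powr (- \<rho>)) absolutely_integrable_on {0..t}"
    using has_integral_Beta_scaled[OF \<rho> t] by (intro nonnegative_absolutely_integrable_1) auto
  moreover have "continuous_on {0..t} (\<lambda>x. \<kappa> * \<rho> / (1 + \<kappa> * x powr \<rho>)\<^sup>2)"
    using pos \<rho> less_imp_neq[OF pos]
    by (intro continuous_on_divide continuous_on_add continuous_on_power continuous_on_mult continuous_on_powr' continuous_on_const continuous_on_id) auto
  ultimately have "(\<lambda>x. (x powr (\<rho> - 1) * (t - x) powr (- \<rho>)) * (\<kappa> * \<rho> / (1 + \<kappa> * x powr \<rho>)\<^sup>2)) absolutely_integrable_on {0..t}"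
    by (rule absolutely_integrable_mult_continuous)
  also have "(\<lambda>x. (x powr (\<rho> - 1) * (t - x) powr (- \<rho>)) * (\<kappa> * \<rho> / (1 + \<kappa> * x powr \<rho>)\<^sup>2)) = ?J"
    by (simp add: powr_minus_divide fun_eq_iff mult_ac)
  finally have J: "?J integrable_on {0..t}" by (auto intro: set_lebesgue_integral_eq_integral)
  \<comment> \<open>Splitting at t / 2 separates the singularity of the derivative of the barrier at
    0 from that of the kernel at t. On each half the nonsingular factor is bounded by a constant
    taken at t / 2.\<close>
  have J1: "?J integrable_on {0..t/2}" and J2: "?J integrable_on {t/2..t}"
    using J t by (auto intro: integrable_subinterval_real)
  have "((\<lambda>x. (t / 2) powr (- \<rho>) * ?b x) has_integral (t / 2) powr (- \<rho>) * (- ?B (t / 2) - - ?B 0)) {0..t/2}"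
  proof (intro has_integral_mult_right fundamental_theorem_of_calculus_interior)
    fix x assume "x \<in> {0<..<t/2}"
    then have "((\<lambda>x. - ?B x) has_real_derivative - (- ?b x)) (at x)" by (intro DERIV_minus dB) auto
    then show "((\<lambda>x. - ?B x) has_vector_derivative ?b x) (at x)"
      by (simp add: has_real_derivative_iff_has_vector_derivative)
  qed (use t in \<open>auto intro!: continuous_on_minus Bc\<close>)
  moreover have "?J x \<le> (t / 2) powr (- \<rho>) * ?b x" if x: "x \<in> {0..t/2}" for x
  proof -
    have "(t - x) powr (- \<rho>) \<le> (t / 2) powr (- \<rho>)" using x t \<rho> by (intro powr_mono2') auto
    moreover have "?b x \<ge> 0" using \<kappa> \<rho> by simp
    ultimately have "(t - x) powr (- \<rho>) * ?b x \<le> (t / 2) powr (- \<rho>) * ?b x" by (rule mult_right_mono)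
    then show ?thesis by (simp add: powr_minus_divide mult.commute)
  qed
  ultimately have "integral {0..t/2} ?J \<le> (t / 2) powr (- \<rho>) * (- ?B (t / 2) - - ?B 0)"
    using integrable_integral[OF J1] by (rule has_integral_le[rotated])
  also have "\<dots> = \<kappa> * ?B (t / 2)"
    using t \<rho> less_imp_neq[OF pos[of "t/2"]] by (simp add: powr_minus_divide field_simps)
  finally have b1: "integral {0..t/2} ?J \<le> \<kappa> * ?B (t / 2)" .
  let ?c = "\<kappa> * \<rho> * (t / 2) powr (\<rho> - 1) * ?B (t / 2)"
  have "((\<lambda>x. ?c * (t - x) powr ((1 - \<rho>) - 1)) has_integral ?c * ((t - t / 2) powr (1 - \<rho>) / (1 - \<rho>))) {t/2..t}"
    using t \<rho> by (intro has_integral_mult_right has_integral_powr_right_end) auto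
  moreover have "?J x \<le> ?c * (t - x) powr ((1 - \<rho>) - 1)" if x: "x \<in> {t/2..t}" for x
  proof -
    have 1: "x powr (\<rho> - 1) \<le> (t / 2) powr (\<rho> - 1)" using x t \<rho> by (intro powr_mono2') auto
    have 2: "1 + \<kappa> * (t / 2) powr \<rho> \<le> 1 + \<kappa> * x powr \<rho>"
      using x t \<rho> \<kappa> by (intro add_left_mono mult_left_mono powr_mono2) auto
    have "1 / (1 + \<kappa> * x powr \<rho>)\<^sup>2 \<le> 1 / (1 + \<kappa> * x powr \<rho>)"
      using pos[of x] \<kappa> by (intro divide_left_mono) (auto simp: power2_eq_square)
    also have "\<dots> \<le> ?B (t / 2)" using 2 pos[of x] pos[of "t/2"] by (intro divide_left_mono) auto
    finally have "\<kappa> * \<rho> * x powr (\<rho> - 1) * (1 / (1 + \<kappa> * x powr \<rho>)\<^sup>2) \<le> ?c"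
      using 1 \<kappa> \<rho> by (intro mult_mono) auto
    then have "?b x * (t - x) powr (- \<rho>) \<le> ?c * (t - x) powr (- \<rho>)"
      by (intro mult_right_mono) auto
    then show ?thesis by (simp add: powr_minus_divide)
  qed
  ultimately have "integral {t/2..t} ?J \<le> ?c * ((t - t / 2) powr (1 - \<rho>) / (1 - \<rho>))"
    using integrable_integral[OF J2] by (rule has_integral_le[rotated])
  also have "\<dots> = \<kappa> * \<rho> * ?B (t / 2) / (1 - \<rho>) * ((t / 2) powr (\<rho> - 1) * (t / 2) powr (1 - \<rho>))"
    by simp
  also have "(t / 2) powr (\<rho> - 1) * (t / 2) powr (1 - \<rho>) = 1" using t by (simp add: powr_add[symmetric])
  finally have b2: "integral {t/2..t} ?J \<le> \<kappa> * \<rho> * ?B (t / 2) / (1 - \<rho>)" by simp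
  have "integral {0..t} ?J = integral {0..t/2} ?J + integral {t/2..t} ?J"
    using t by (intro Henstock_Kurzweil_Integration.integral_combine[symmetric] J) auto
  also have "\<dots> \<le> \<kappa> * ?B (t / 2) + \<kappa> * \<rho> * ?B (t / 2) / (1 - \<rho>)" using b1 b2 by linarith
  also have "\<dots> = \<kappa> / (1 - \<rho>) * ?B (t / 2)"
  proof -
    have "k * b + k * \<rho> * b / (1 - \<rho>) = k / (1 - \<rho>) * b" for k b :: real using \<rho> by (simp add: field_simps)
    then show ?thesis .
  qed
  also have "\<dots> \<le> \<kappa> / (1 - \<rho>) * (2 powr \<rho> * ?B t)"
  proof (intro mult_left_mono)
    have "1 \<le> (2::real) powr \<rho>" using \<rho> by (simp add: ge_one_powr_ge_zero)
    moreover have "t powr \<rho> = 2 powr \<rho> * (t / 2) powr \<rho>" using t by (simp add: powr_mult[symmetric])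
    ultimately have "1 + \<kappa> * t powr \<rho> \<le> 2 powr \<rho> * (1 + \<kappa> * (t / 2) powr \<rho>)" by (simp add: distrib_left)
    then show "?B (t / 2) \<le> 2 powr \<rho> * ?B t" using pos[of t] pos[of "t/2"] by (simp add: field_simps)
  qed (use \<kappa> \<rho> in auto)
  finally have bJ: "integral {0..t} ?J \<le> \<kappa> / (1 - \<rho>) * (2 powr \<rho> * ?B t)" .
  have "has_caputo_deriv \<rho> ?B t (1 / Gamma (1 - \<rho>) * - integral {0..t} ?J)"
  proof (rule has_caputo_derivI[OF t Bc])
    fix x assume "x \<in> {0<..<t}"
    then show "(?B has_real_derivative - ?b x) (at x)" by (intro dB) auto
  next
    show "((\<lambda>x. - ?b x / (t - x) powr \<rho>) has_integral - integral {0..t} ?J) {0..t}"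
      using has_integral_neg[OF integrable_integral[OF J]] by simp
  qed
  moreover have "- (\<kappa> * (2 powr \<rho> / ((1 - \<rho>) * Gamma (1 - \<rho>))) * ?B t) \<le> 1 / Gamma (1 - \<rho>) * - integral {0..t} ?J"
    using divide_right_mono[OF bJ less_imp_le[OF G]] by (simp add: mult_ac)
  ultimately show ?thesis by (rule that)
qed

text \<open>If h exceeded k somewhere, h - k would attain a positive maximum, at a positive time by
  the initial condition. There D - E is nonnegative and the zeroth order terms are strictly ordered,
  against the differential inequality.\<close>

lemma caputo_comparison:
  assumes \<rho>: "0 < \<rho>" "\<rho> < 1" and hc: "continuous_on {0..T} h" and kc: "continuous_on {0..T} k"
    and init: "h 0 \<le> k 0" and T: "0 \<le> T"
    and ineq: "\<And>t. t \<in> {0<..T} \<Longrightarrow> \<exists>D E. has_caputo_deriv \<rho> h t D \<and> has_caputo_deriv \<rho> k t E \<and>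
       D + a t * h t \<le> E + a t * k t"
    and a: "\<And>t. t \<in> {0<..T} \<Longrightarrow> 0 < a t"
    and t: "t \<in> {0..T}"
  shows "h t \<le> k t"
proof (rule ccontr)
  assume neg: "\<not> h t \<le> k t"
  have "continuous_on {0..T} (\<lambda>t. 1 * h t + (-1) * k t)" by (intro continuous_intros hc kc)
  then obtain m where m: "m \<in> {0..T}" "\<And>s. s \<in> {0..T} \<Longrightarrow> 1 * h s + (-1) * k s \<le> 1 * h m + (-1) * k m"
    using continuous_attains_sup[of "{0..T}" "\<lambda>t. 1 * h t + (-1) * k t"] T by auto
  have hk: "h m > k m" using m(2)[OF t] neg by auto
  then have m0: "m \<in> {0<..T}" using m(1) init by (cases "m = 0") auto
  then obtain D E where DE: "has_caputo_deriv \<rho> h m D" "has_caputo_deriv \<rho> k m E"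
    "D + a m * h m \<le> E + a m * k m" using ineq by blast
  have c: "continuous_on {0..m} h" "continuous_on {0..m} k"
    using m hc kc by (auto intro: continuous_on_subset)
  have "has_caputo_deriv \<rho> (\<lambda>t. 1 * h t + (-1) * k t) m (1 * D + (-1) * E)"
    using m0 by (intro has_caputo_deriv_linear c DE) auto
  then have "0 \<le> 1 * D + (-1) * E"
    by (rule has_caputo_deriv_nonneg_at_max[OF \<rho>, rotated 3])
       (use m m0 c in \<open>auto intro!: continuous_intros\<close>)
  moreover have "a m * h m > a m * k m" using a[OF m0] hk by simp
  ultimately show False using DE(3) by linarith
qed

lemma caputo_decay:
  assumes \<rho>: "0 < \<rho>" "\<rho> < 1" and hc: "continuous_on {0..T} h"
    and ode: "\<And>t. t \<in> {0<..T} \<Longrightarrow> has_caputo_deriv \<rho> h t (g t - a t * h t)"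
    and a: "0 < \<alpha>" "\<And>t. t \<in> {0<..T} \<Longrightarrow> \<alpha> \<le> a t"
    and g: "\<And>t. t \<in> {0<..T} \<Longrightarrow> \<bar>g t\<bar> \<le> F" and F: "0 \<le> F"
    and t: "t \<in> {0..T}"
  shows "\<bar>h t\<bar> \<le> \<bar>h 0\<bar> * (1 / (1 + \<alpha> * ((1 - \<rho>) * Gamma (1 - \<rho>) / 2 powr \<rho>) * t powr \<rho>)) + F / \<alpha>"
proof -
  have G: "Gamma (1 - \<rho>) > 0" using \<rho> by (auto intro!: Gamma_real_pos)
  \<comment> \<open>Calibrated so that the constant in \<open>caputo_barrier\<close> becomes exactly
    \<open>\<alpha>\<close>; then the derivative of the barrier plus \<open>a\<close> times the
    barrier is nonnegative.\<close>
  define \<kappa> where "\<kappa> = \<alpha> * ((1 - \<rho>) * Gamma (1 - \<rho>) / 2 powr \<rho>)"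
  have \<kappa>: "\<kappa> > 0" using a G \<rho> by (simp add: \<kappa>_def)
  have \<kappa>\<alpha>: "\<kappa> * (2 powr \<rho> / ((1 - \<rho>) * Gamma (1 - \<rho>))) = \<alpha>"
    using \<rho> less_imp_neq[OF G] by (simp add: \<kappa>_def)
  let ?B = "\<lambda>t. 1 / (1 + \<kappa> * t powr \<rho>)"
  \<comment> \<open>The barrier carries the initial value, the constant F / \<alpha> the source:
    since a >= \<alpha>, the zeroth order term alone dominates F.\<close>
  define k where "k = (\<lambda>t. \<bar>h 0\<bar> * ?B t + (F / \<alpha>) * 1)"
  have pos: "1 + \<kappa> * x powr \<rho> > 0" for x using \<kappa> by (simp add: add_pos_nonneg)
  have Bc: "continuous_on {0..r} ?B" for r
    using pos \<rho> less_imp_neq[OF pos]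
    by (intro continuous_on_divide continuous_on_add continuous_on_mult continuous_on_powr' continuous_on_const continuous_on_id) auto
  have kc: "continuous_on {0..r} k" for r unfolding k_def by (intro continuous_intros Bc)
  have k: "\<exists>E. has_caputo_deriv \<rho> k t E \<and> F \<le> E + a t * k t" if t: "t \<in> {0<..T}" for t
  proof -
    have t0: "0 < t" using t by auto
    obtain D where D: "has_caputo_deriv \<rho> ?B t D" "- (\<alpha> * ?B t) \<le> D"
      using caputo_barrier[OF \<rho> \<kappa> t0] unfolding \<kappa>\<alpha> by blast
    have "has_caputo_deriv \<rho> k t (\<bar>h 0\<bar> * D + (F / \<alpha>) * 0)"
      unfolding k_def using t0 by (intro has_caputo_deriv_linear D has_caputo_deriv_const Bc) auto
    moreover have "F \<le> (\<bar>h 0\<bar> * D + (F / \<alpha>) * 0) + a t * k t"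
    proof -
      have "?B t \<ge> 0" using pos[of t] by simp
      then have "- (a t * ?B t) \<le> D" using D(2) mult_right_mono[OF a(2)[OF t], of "?B t"] by linarith
      then have "\<bar>h 0\<bar> * (- (a t * ?B t)) \<le> \<bar>h 0\<bar> * D" by (rule mult_left_mono) simp
      moreover have "\<alpha> * (F / \<alpha>) \<le> a t * (F / \<alpha>)" using a(1) a(2)[OF t] F by (intro mult_right_mono) auto
      ultimately show ?thesis using a(1) by (simp add: k_def distrib_left mult_ac)
    qed
    ultimately show ?thesis by blast
  qed
  have k0: "\<bar>h 0\<bar> \<le> k 0" using F a \<rho> by (simp add: k_def)
  have T: "0 \<le> T" using t by auto
  have apos: "0 < a s" if "s \<in> {0<..T}" for s using a(1) a(2)[OF that] by linarith
  have "h t \<le> k t"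
  proof (rule caputo_comparison[OF \<rho> hc kc _ T _ apos t])
    fix s assume s: "s \<in> {0<..T}"
    show "\<exists>D E. has_caputo_deriv \<rho> h s D \<and> has_caputo_deriv \<rho> k s E \<and> D + a s * h s \<le> E + a s * k s"
    proof -
      obtain E where "has_caputo_deriv \<rho> k s E" "F \<le> E + a s * k s" using k[OF s] by blast
      moreover have "g s \<le> F" using g[OF s] by (simp add: abs_le_iff)
      ultimately show ?thesis using ode[OF s]
        by (intro exI[of _ "g s - a s * h s"] exI[of _ E]) auto
    qed
  qed (use k0 in auto)
  \<comment> \<open>The comparison for -h, written in the shape that
    \<open>has_caputo_deriv_linear\<close> produces.\<close>
  moreover have "(-1) * h t + 0 * h t \<le> k t"
  proof (rule caputo_comparison[OF \<rho> _ kc _ T _ apos t])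
    fix s assume s: "s \<in> {0<..T}"
    have c: "continuous_on {0..s} h" using s hc by (auto intro: continuous_on_subset)
    have "has_caputo_deriv \<rho> (\<lambda>t. (-1) * h t + 0 * h t) s ((-1) * (g s - a s * h s) + 0 * (g s - a s * h s))"
      using s by (intro has_caputo_deriv_linear ode c) auto
    then show "\<exists>D E. has_caputo_deriv \<rho> (\<lambda>t. (-1) * h t + 0 * h t) s D \<and> has_caputo_deriv \<rho> k s E \<and>
        D + a s * ((-1) * h s + 0 * h s) \<le> E + a s * k s"
    proof -
      assume D: "has_caputo_deriv \<rho> (\<lambda>t. (-1) * h t + 0 * h t) s ((-1) * (g s - a s * h s) + 0 * (g s - a s * h s))"
      obtain E where "has_caputo_deriv \<rho> k s E" "F \<le> E + a s * k s" using k[OF s] by blast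
      moreover have "- g s \<le> F" using g[OF s] by (simp add: abs_le_iff)
      ultimately show ?thesis using D
        by (intro exI[of _ "(-1) * (g s - a s * h s) + 0 * (g s - a s * h s)"] exI[of _ E]) auto
    qed
  qed (use k0 hc in \<open>auto intro!: continuous_intros\<close>)
  ultimately show ?thesis by (simp add: k_def \<kappa>_def abs_le_iff)
qed

section \<open>Smooth cutoff functions\<close>

definition smooth :: "(real \<Rightarrow> real) \<Rightarrow> bool" where
  "smooth f \<longleftrightarrow> (\<forall>k x. (deriv ^^ k) f differentiable (at x))"

lemma DERIV_imp_differentiable:
  "(f has_real_derivative D) (at x) \<Longrightarrow> f differentiable (at x)"
  by (auto simp: real_differentiable_def)

text \<open>Spares formulas for the k-th derivative: for an explicit family of functions it is
  enough that \<open>deriv\<close> maps the family into itself.\<close>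

lemma smooth_coinduct:
  assumes "X f" "\<And>f x. X f \<Longrightarrow> f differentiable (at x)" "\<And>f. X f \<Longrightarrow> X (deriv f)"
  shows "smooth f"
proof -
  have "X ((deriv ^^ k) f)" for k by (induction k) (use assms in auto)
  then show ?thesis using assms(2) by (auto simp: smooth_def)
qed

lemma smooth_differentiable: "smooth f \<Longrightarrow> f differentiable (at x)"
  unfolding smooth_def by (metis funpow_0)

lemma smooth_DERIV: "smooth f \<Longrightarrow> (f has_real_derivative deriv f x) (at x)"
  using smooth_differentiable by (simp add: DERIV_deriv_iff_real_differentiable)

lemma smooth_deriv: "smooth f \<Longrightarrow> smooth (deriv f)"
  unfolding smooth_def by (metis funpow_Suc_right o_apply)

lemma smooth_continuous_on: "smooth f \<Longrightarrow> continuous_on A f"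
  by (auto intro: DERIV_isCont continuous_at_imp_continuous_on smooth_DERIV)

text \<open>Invariant under differentiation by the product and chain rules, which yields the smoothness of
  products and compositions by coinduction.\<close>

inductive smooth_closure :: "(real \<Rightarrow> real) \<Rightarrow> bool" where
  base: "smooth f \<Longrightarrow> smooth_closure f"
| add: "smooth_closure f \<Longrightarrow> smooth_closure g \<Longrightarrow> smooth_closure (\<lambda>x. f x + g x)"
| mult: "smooth_closure f \<Longrightarrow> smooth_closure g \<Longrightarrow> smooth_closure (\<lambda>x. f x * g x)"
| compose: "smooth_closure f \<Longrightarrow> smooth_closure g \<Longrightarrow> smooth_closure (\<lambda>x. f (g x))"

lemma smooth_closure_deriv:
  "smooth_closure f \<Longrightarrow> (\<forall>x. (f has_real_derivative deriv f x) (at x)) \<and> smooth_closure (deriv f)"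
proof (induction rule: smooth_closure.induct)
  case (base f)
  then show ?case by (auto intro: smooth_DERIV smooth_closure.base smooth_deriv)
next
  case (add f g)
  have D: "((\<lambda>x. f x + g x) has_real_derivative deriv f x + deriv g x) (at x)" for x
    using add by (intro DERIV_add) auto
  then have "deriv (\<lambda>x. f x + g x) = (\<lambda>x. deriv f x + deriv g x)" by (auto intro!: DERIV_imp_deriv)
  then show ?case using D add by (auto intro: smooth_closure.add)
next
  case (mult f g)
  have D: "((\<lambda>x. f x * g x) has_real_derivative deriv f x * g x + deriv g x * f x) (at x)" for x
    using mult by (intro DERIV_mult) auto
  then have "deriv (\<lambda>x. f x * g x) = (\<lambda>x. deriv f x * g x + deriv g x * f x)" by (auto intro!: DERIV_imp_deriv)
  then show ?case using D mult by (auto intro!: smooth_closure.add smooth_closure.mult)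
next
  case (compose f g)
  have D: "((\<lambda>x. f (g x)) has_real_derivative deriv f (g x) * deriv g x) (at x)" for x
    using compose by (intro DERIV_chain2) auto
  then have "deriv (\<lambda>x. f (g x)) = (\<lambda>x. deriv f (g x) * deriv g x)" by (auto intro!: DERIV_imp_deriv)
  then show ?case using D compose by (simp add: smooth_closure.mult smooth_closure.compose)
qed

lemma smooth_closure_smooth: "smooth_closure f \<Longrightarrow> smooth f"
  by (rule smooth_coinduct[of smooth_closure])
     (use smooth_closure_deriv DERIV_imp_differentiable in blast)+

lemma smooth_add: "smooth f \<Longrightarrow> smooth g \<Longrightarrow> smooth (\<lambda>x. f x + g x)"
  and smooth_mult: "smooth f \<Longrightarrow> smooth g \<Longrightarrow> smooth (\<lambda>x. f x * g x)"
  and smooth_compose: "smooth f \<Longrightarrow> smooth g \<Longrightarrow> smooth (\<lambda>x. f (g x))"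
  using smooth_closure_smooth[OF smooth_closure.add[OF smooth_closure.base smooth_closure.base]]
    smooth_closure_smooth[OF smooth_closure.mult[OF smooth_closure.base smooth_closure.base]]
    smooth_closure_smooth[OF smooth_closure.compose[OF smooth_closure.base smooth_closure.base], of f g]
  by simp_all

section \<open>Explicit smooth functions and a smooth step\<close>

lemma smooth_affine: "smooth (\<lambda>x. a * x + b)"
proof (rule smooth_coinduct[of "\<lambda>f. \<exists>a b. f = (\<lambda>x. a * x + b)"])
  fix f :: "real \<Rightarrow> real" assume "\<exists>a b. f = (\<lambda>x. a * x + b)"
  then obtain a b where f: "f = (\<lambda>x. a * x + b)" by blast
  have D: "(f has_real_derivative a) (at x)" for x unfolding f by (auto intro!: derivative_eq_intros)
  then have "deriv f = (\<lambda>x. 0 * x + a)" by (auto intro!: DERIV_imp_deriv)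
  then show "\<exists>a b. deriv f = (\<lambda>x. a * x + b)" by blast
  show "f differentiable (at x)" for x using D by (auto intro: DERIV_imp_differentiable)
qed blast

lemma smooth_const: "smooth (\<lambda>_. c)"
  using smooth_affine[of 0 c] by simp

lemma smooth_sin_cos: "smooth (\<lambda>x. a * sin x + b * cos x)"
proof (rule smooth_coinduct[of "\<lambda>f. \<exists>a b. f = (\<lambda>x. a * sin x + b * cos x)"])
  fix f :: "real \<Rightarrow> real" assume "\<exists>a b. f = (\<lambda>x. a * sin x + b * cos x)"
  then obtain a b where f: "f = (\<lambda>x. a * sin x + b * cos x)" by blast
  have D: "(f has_real_derivative (- b) * sin x + a * cos x) (at x)" for x
    unfolding f by (auto intro!: derivative_eq_intros)
  then have "deriv f = (\<lambda>x. (- b) * sin x + a * cos x)" by (auto intro!: DERIV_imp_deriv)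
  then show "\<exists>a b. deriv f = (\<lambda>x. a * sin x + b * cos x)" by blast
  show "f differentiable (at x)" for x using D by (auto intro: DERIV_imp_differentiable)
qed blast

lemma smooth_sin_affine: "smooth (\<lambda>x. sin (c * x))"
  using smooth_compose[OF smooth_sin_cos[of 1 0] smooth_affine[of c 0]] by simp

lemma smooth_cos_affine: "smooth (\<lambda>x. cos (c * x))"
  using smooth_compose[OF smooth_sin_cos[of 0 1] smooth_affine[of c 0]] by simp

definition flat_exp :: "real \<Rightarrow> real" where
  "flat_exp x = (if 0 < x then exp (- (1 / x)) else 0)"

lemma poly_div_exp_tendsto_0:
  fixes p :: "real poly"
  shows "((\<lambda>y. poly p y / exp y) \<longlongrightarrow> 0) at_top"
proof -
  have "((\<lambda>y. \<Sum>i\<le>degree p. coeff p i * (y ^ i / exp y)) \<longlongrightarrow> (\<Sum>i\<le>degree p. coeff p i * 0)) at_top"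
    by (intro tendsto_intros tendsto_power_div_exp_0)
  then show ?thesis by (simp add: poly_altdef sum_divide_distrib)
qed

text \<open>The invariant family consists of the functions p(1/x) exp(-1/x), continued by 0 to x <=
  0, with p a polynomial. At 0 the difference quotients vanish in the limit because exp outgrows
  every polynomial.\<close>

lemma smooth_flat_exp: "smooth flat_exp"
proof (rule smooth_coinduct[of "\<lambda>f. \<exists>p. f = (\<lambda>x. if 0 < x then poly p (1 / x) * exp (- (1 / x)) else 0)"])
  show "\<exists>p. flat_exp = (\<lambda>x. if 0 < x then poly p (1 / x) * exp (- (1 / x)) else 0)"
    by (intro exI[of _ 1]) (simp add: flat_exp_def fun_eq_iff)
  fix f :: "real \<Rightarrow> real" assume "\<exists>p. f = (\<lambda>x. if 0 < x then poly p (1 / x) * exp (- (1 / x)) else 0)"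
  then obtain p where f: "f = (\<lambda>x. if 0 < x then poly p (1 / x) * exp (- (1 / x)) else 0)" by blast
  \<comment> \<open>In the variable y = 1/x one has d/dx = - y^2 d/dy, so differentiation sends the
    polynomial p to y^2 times the difference of p and its derivative.\<close>
  define p' where "p' = [:0, 0, 1:] * (p - pderiv p)"
  have D: "(f has_real_derivative (if 0 < x then poly p' (1 / x) * exp (- (1 / x)) else 0)) (at x)" for x
  proof (cases x "0::real" rule: linorder_cases)
    case greater
    have "((\<lambda>x. poly p (1 / x) * exp (- (1 / x))) has_real_derivative
      (poly (pderiv p) (1 / x) * (- (1 / x\<^sup>2))) * exp (- (1 / x)) + (exp (- (1 / x)) * (1 / x\<^sup>2)) * poly p (1 / x)) (at x)"
      using greater
      by (intro DERIV_mult DERIV_chain2[OF poly_DERIV] DERIV_chain2[OF DERIV_exp])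
         (auto intro!: derivative_eq_intros simp: power2_eq_square)
    then have "((\<lambda>x. poly p (1 / x) * exp (- (1 / x))) has_real_derivative poly p' (1 / x) * exp (- (1 / x))) (at x)"
      by (rule DERIV_cong) (simp add: p'_def power2_eq_square algebra_simps)
    then have "(f has_real_derivative poly p' (1 / x) * exp (- (1 / x))) (at x)"
      by (rule has_field_derivative_transform_within_open[of _ _ _ "{0<..}"]) (use greater in \<open>auto simp: f\<close>)
    then show ?thesis using greater by simp
  next
    case less
    have "(f has_real_derivative 0) (at x)"
      by (rule has_field_derivative_transform_within_open[of "\<lambda>_. 0" _ _ "{..<0}"]) (use less in \<open>auto simp: f\<close>)
    then show ?thesis using less by simp
  next
    case equal
    have "((\<lambda>h. (f (0 + h) - f 0) / h) \<longlongrightarrow> 0) (at 0)"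
      unfolding filterlim_at_split
    proof
      have "eventually (\<lambda>h::real. 0 = (f (0 + h) - f 0) / h) (at_left 0)"
        by (auto simp: eventually_at_filter f)
      then show "((\<lambda>h. (f (0 + h) - f 0) / h) \<longlongrightarrow> 0) (at_left 0)"
        by (rule Lim_transform_eventually[OF tendsto_const])
      \<comment> \<open>For h > 0 the difference quotient at 0 is y p(y) / exp y with y = 1/h;
        \<open>pCons 0 p\<close> supplies the factor y.\<close>
      have "((\<lambda>h::real. poly (pCons 0 p) (inverse h) / exp (inverse h)) \<longlongrightarrow> 0) (at_right 0)"
        by (rule filterlim_compose[OF poly_div_exp_tendsto_0 filterlim_inverse_at_top_right])
      moreover have "eventually (\<lambda>h::real. poly (pCons 0 p) (inverse h) / exp (inverse h) = (f (0 + h) - f 0) / h) (at_right 0)"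
        by (auto simp: eventually_at_filter f exp_minus field_simps)
      ultimately show "((\<lambda>h. (f (0 + h) - f 0) / h) \<longlongrightarrow> 0) (at_right 0)"
        by (rule Lim_transform_eventually)
    qed
    then show ?thesis using equal by (simp add: DERIV_def)
  qed
  then have "deriv f = (\<lambda>x. if 0 < x then poly p' (1 / x) * exp (- (1 / x)) else 0)"
    by (intro ext DERIV_imp_deriv)
  then show "\<exists>p. deriv f = (\<lambda>x. if 0 < x then poly p (1 / x) * exp (- (1 / x)) else 0)" by blast
  show "f differentiable (at x)" for x using D[of x] by (auto intro: DERIV_imp_differentiable)
qed

lemma flat_exp_mono: "x \<le> y \<Longrightarrow> flat_exp x \<le> flat_exp y"
proof -
  assume "x \<le> y"
  then have "1 / y \<le> 1 / x" if "0 < x" using that by (simp add: frac_le)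
  then show ?thesis using \<open>x \<le> y\<close> by (auto simp: flat_exp_def)
qed

lemma flat_exp_nonneg: "0 \<le> flat_exp x"
  and flat_exp_pos: "0 < x \<Longrightarrow> 0 < flat_exp x"
  and flat_exp_zero: "x \<le> 0 \<Longrightarrow> flat_exp x = 0"
  by (auto simp: flat_exp_def)

text \<open>The inner \<open>flat_exp\<close> is switched off for x <= 1, the outer one as soon as
  its argument is nonpositive, that is for x >= 2. Only affine maps and compositions occur, the
  denominator being a constant, so smoothness does not involve a quotient of functions.\<close>

definition smooth_step :: "real \<Rightarrow> real" where
  "smooth_step x = 1 - flat_exp (flat_exp 1 - flat_exp (x - 1)) / flat_exp (flat_exp 1)"

lemma smooth_smooth_step: "smooth smooth_step"
proof -
  have "smooth (\<lambda>x. (- 1 / flat_exp (flat_exp 1)) * flat_exp ((- 1) * flat_exp (1 * x + (- 1)) + flat_exp 1) + 1)"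
    by (intro smooth_compose[OF smooth_affine] smooth_compose[OF smooth_flat_exp] smooth_affine)
  then show ?thesis by (simp add: smooth_step_def[abs_def])
qed

lemma smooth_step_left: "x \<le> 1 \<Longrightarrow> smooth_step x = 0"
  using flat_exp_pos[OF flat_exp_pos[of 1]] by (simp add: smooth_step_def flat_exp_zero)

lemma smooth_step_right: "2 \<le> x \<Longrightarrow> smooth_step x = 1"
  using flat_exp_mono[of 1 "x - 1"] by (simp add: smooth_step_def flat_exp_zero)

lemma smooth_step_range: "0 \<le> smooth_step x" "smooth_step x \<le> 1"
  using flat_exp_pos[OF flat_exp_pos[of 1]] flat_exp_nonneg
    flat_exp_mono[of "flat_exp 1 - flat_exp (x - 1)" "flat_exp 1"]
  by (auto simp: smooth_step_def divide_le_eq)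

lemma deriv_zero_if_const_near:
  fixes f :: "real \<Rightarrow> real"
  assumes "open A" "x \<in> A" "\<And>y. y \<in> A \<Longrightarrow> f y = c"
  shows "deriv f x = 0"
proof (rule DERIV_imp_deriv)
  show "(f has_real_derivative 0) (at x)"
    by (rule has_field_derivative_transform_within_open[of "\<lambda>_. c" _ _ A]) (use assms in auto)
qed

lemma deriv_smooth_step_zero:
  assumes "x < 1 \<or> 2 < x"
  shows "deriv smooth_step x = 0"
  using assms deriv_zero_if_const_near[of "{..<1}" x smooth_step 0]
    deriv_zero_if_const_near[of "{2<..}" x smooth_step 1]
  by (auto simp: smooth_step_left smooth_step_right)

lemma deriv_deriv_smooth_step_zero:
  assumes "x < 1 \<or> 2 < x"
  shows "deriv (deriv smooth_step) x = 0"
  using assms deriv_zero_if_const_near[of "{..<1}" x "deriv smooth_step" 0]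
    deriv_zero_if_const_near[of "{2<..}" x "deriv smooth_step" 0]
  by (auto simp: deriv_smooth_step_zero)

lemma smooth_step_derivs_bounded:
  obtains C where "C > 0" "\<And>x. \<bar>deriv smooth_step x\<bar> \<le> C" "\<And>x. \<bar>deriv (deriv smooth_step) x\<bar> \<le> C"
proof -
  obtain A where A: "A > 0" "\<And>x. x \<in> {1..2} \<Longrightarrow> \<bar>deriv smooth_step x\<bar> \<le> A"
    using continuous_on_Icc_bounded[OF smooth_continuous_on[OF smooth_deriv[OF smooth_smooth_step]]] by blast
  obtain B where B: "B > 0" "\<And>x. x \<in> {1..2} \<Longrightarrow> \<bar>deriv (deriv smooth_step) x\<bar> \<le> B"
    using continuous_on_Icc_bounded[OF smooth_continuous_on[OF smooth_deriv[OF smooth_deriv[OF smooth_smooth_step]]]] by blast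
  show ?thesis
  proof (rule that[of "max A B"])
    fix x
    show "\<bar>deriv smooth_step x\<bar> \<le> max A B"
      using A(1) A(2)[of x] deriv_smooth_step_zero[of x] by (cases "x \<in> {1..2}") (auto simp: le_max_iff_disj)
    show "\<bar>deriv (deriv smooth_step) x\<bar> \<le> max A B"
      using B(1) B(2)[of x] deriv_deriv_smooth_step_zero[of x] by (cases "x \<in> {1..2}") (auto simp: le_max_iff_disj)
  qed (use A in auto)
qed

section \<open>Weak derivatives tested up to the boundary\<close>

text \<open>Goes from 0 to 1 while n * x runs from 1 to 2, and back to 0 while n * (l - x) runs from
  2 to 1. The shift by 3 puts the second transition at the mirror image of the first.\<close>

definition cutoff :: "real \<Rightarrow> real \<Rightarrow> real \<Rightarrow> real" where
  "cutoff l n x = smooth_step (n * x) - smooth_step (n * (x - l) + 3)"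

lemma smooth_cutoff: "smooth (cutoff l n)"
proof -
  have "smooth (\<lambda>x. smooth_step (n * x + 0) + (-1 * smooth_step (n * x + (3 - n * l)) + 0))"
    by (intro smooth_add smooth_compose[OF smooth_smooth_step] smooth_compose[OF smooth_affine] smooth_affine)
  then show ?thesis by (simp add: cutoff_def[abs_def] algebra_simps)
qed

lemma cutoff_bounds: "\<bar>cutoff l n x\<bar> \<le> 1"
  using smooth_step_range[of "n * x"] smooth_step_range[of "n * (x - l) + 3"] by (simp add: cutoff_def)

lemma DERIV_cutoff:
  "(cutoff l n has_real_derivative n * deriv smooth_step (n * x) - n * deriv smooth_step (n * (x - l) + 3)) (at x)"
  "((\<lambda>x. n * deriv smooth_step (n * x) - n * deriv smooth_step (n * (x - l) + 3)) has_real_derivative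
    n\<^sup>2 * deriv (deriv smooth_step) (n * x) - n\<^sup>2 * deriv (deriv smooth_step) (n * (x - l) + 3)) (at x)"
proof -
  have c: "((\<lambda>x. f (n * x)) has_real_derivative deriv f (n * x) * n) (at x)"
    "((\<lambda>x. f (n * (x - l) + 3)) has_real_derivative deriv f (n * (x - l) + 3) * n) (at x)" if "smooth f" for f
    by (rule DERIV_chain2[OF smooth_DERIV[OF that]]; auto intro!: derivative_eq_intros)+
  show "(cutoff l n has_real_derivative n * deriv smooth_step (n * x) - n * deriv smooth_step (n * (x - l) + 3)) (at x)"
    unfolding cutoff_def[abs_def] using c[OF smooth_smooth_step] by (auto intro!: derivative_eq_intros)
  show "((\<lambda>x. n * deriv smooth_step (n * x) - n * deriv smooth_step (n * (x - l) + 3)) has_real_derivative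
    n\<^sup>2 * deriv (deriv smooth_step) (n * x) - n\<^sup>2 * deriv (deriv smooth_step) (n * (x - l) + 3)) (at x)"
    by (rule DERIV_cong[OF DERIV_diff[OF DERIV_cmult[OF c(1)] DERIV_cmult[OF c(2)]]])
      (auto intro: smooth_deriv smooth_smooth_step simp: power2_eq_square)
qed

lemma deriv_cutoff:
  "deriv (cutoff l n) = (\<lambda>x. n * deriv smooth_step (n * x) - n * deriv smooth_step (n * (x - l) + 3))"
  "deriv (deriv (cutoff l n)) =
    (\<lambda>x. n\<^sup>2 * deriv (deriv smooth_step) (n * x) - n\<^sup>2 * deriv (deriv smooth_step) (n * (x - l) + 3))"
proof -
  show 1: "deriv (cutoff l n) = (\<lambda>x. n * deriv smooth_step (n * x) - n * deriv smooth_step (n * (x - l) + 3))"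
    by (intro ext DERIV_imp_deriv DERIV_cutoff)
  show "deriv (deriv (cutoff l n)) =
    (\<lambda>x. n\<^sup>2 * deriv (deriv smooth_step) (n * x) - n\<^sup>2 * deriv (deriv smooth_step) (n * (x - l) + 3))"
    unfolding 1 by (intro ext DERIV_imp_deriv DERIV_cutoff)
qed

text \<open>With \<open>5 \<le> n * l\<close> the two transition layers are disjoint: near 0 both
  steps are still 0, near l both are already 1.\<close>

lemma cutoff_outer:
  assumes n: "0 < n" "5 \<le> n * l" and x: "n * x \<le> 1 \<or> n * (l - x) \<le> 1"
  shows "cutoff l n x = 0"
  using x
proof
  assume "n * x \<le> 1"
  moreover have "n * (x - l) + 3 \<le> 1" using calculation n by (simp add: right_diff_distrib)
  ultimately show ?thesis by (simp add: cutoff_def smooth_step_left)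
next
  assume "n * (l - x) \<le> 1"
  then have "2 \<le> n * (x - l) + 3" "2 \<le> n * x" using n by (simp_all add: right_diff_distrib)
  then show ?thesis by (simp add: cutoff_def smooth_step_right)
qed

text \<open>The strict inequalities place \<open>x\<close> in an open set where both steps are
  constant, which is why the derivatives vanish as well.\<close>

lemma cutoff_inner:
  assumes "2 < n * x" "2 < n * (l - x)"
  shows "cutoff l n x = 1" "deriv (cutoff l n) x = 0" "deriv (deriv (cutoff l n)) x = 0"
proof -
  have a: "n * (x - l) + 3 < 1" using assms by (simp add: right_diff_distrib)
  show "cutoff l n x = 1"
    using a assms by (simp add: cutoff_def smooth_step_left smooth_step_right)
  show "deriv (cutoff l n) x = 0"
    using a assms by (subst deriv_cutoff(1)) (simp add: deriv_smooth_step_zero)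
  show "deriv (deriv (cutoff l n)) x = 0"
    using a assms by (subst deriv_cutoff(2)) (simp add: deriv_deriv_smooth_step_zero)
qed

lemma cutoff_test_function:
  assumes \<psi>: "smooth \<psi>" and n: "0 < n" "5 \<le> n * l"
  shows "(\<lambda>x. \<psi> x * cutoff l n x) \<in> test_functions l"
proof -
  have K: "{1 / n..l - 1 / n} \<subseteq> {0<..<l}"
  proof
    fix x assume "x \<in> {1 / n..l - 1 / n}"
    moreover have "0 < 1 / n" using n by simp
    ultimately show "x \<in> {0<..<l}" unfolding atLeastAtMost_iff greaterThanLessThan_iff by linarith
  qed
  have "\<psi> x * cutoff l n x = 0" if "x \<notin> {1 / n..l - 1 / n}" for x
  proof -
    have "n * x \<le> 1 \<or> n * (l - x) \<le> 1"
      using that n by (auto simp: field_simps not_le)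
    then show ?thesis using cutoff_outer[OF n] by simp
  qed
  moreover have "smooth (\<lambda>x. \<psi> x * cutoff l n x)" by (intro smooth_mult \<psi> smooth_cutoff)
  ultimately show ?thesis
    unfolding test_functions_def smooth_def using K
    by (intro CollectI conjI exI[of _ "{1 / n..l - 1 / n}"]) (blast intro: compact_Icc)+
qed

lemma deriv_cutoff_bounded:
  obtains C where "C > 0" "\<And>l n x. 0 < n \<Longrightarrow> \<bar>deriv (cutoff l n) x\<bar> \<le> C * n"
    "\<And>l n x. 0 < n \<Longrightarrow> \<bar>deriv (deriv (cutoff l n)) x\<bar> \<le> C * n\<^sup>2"
proof -
  obtain C where C: "C > 0" "\<And>x. \<bar>deriv smooth_step x\<bar> \<le> C" "\<And>x. \<bar>deriv (deriv smooth_step) x\<bar> \<le> C"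
    using smooth_step_derivs_bounded by blast
  show ?thesis
  proof (rule that[of "2 * C"])
    fix l n x :: real assume n: "0 < n"
    have b: "\<bar>k * a - k * b\<bar> \<le> 2 * C * k" if "\<bar>a\<bar> \<le> C" "\<bar>b\<bar> \<le> C" "0 < k" for k a b :: real
    proof -
      have "\<bar>k * a - k * b\<bar> = k * \<bar>a - b\<bar>" using that by (simp add: right_diff_distrib[symmetric] abs_mult)
      also have "\<dots> \<le> k * (2 * C)" using that by (intro mult_left_mono) auto
      finally show ?thesis by (simp add: mult_ac)
    qed
    show "\<bar>deriv (cutoff l n) x\<bar> \<le> 2 * C * n" unfolding deriv_cutoff(1) using n by (intro b C)
    show "\<bar>deriv (deriv (cutoff l n)) x\<bar> \<le> 2 * C * n\<^sup>2" unfolding deriv_cutoff(2) using n by (intro b C) auto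
  qed (use C in auto)
qed

section \<open>Integrability on the open interval and removal of the cutoff\<close>

lemma integrable_lebesgue_on_Ioo_continuous:
  fixes h :: "real \<Rightarrow> real"
  assumes "continuous_on {a..b} h"
  shows "integrable (lebesgue_on {a<..<b}) h"
proof -
  have "h absolutely_integrable_on {a<..<b}"
    by (rule set_integrable_subset[OF absolutely_integrable_continuous_real[OF assms]]) auto
  then show ?thesis by (simp add: set_integrable_def integrable_restrict_space)
qed

lemma L2_on_integrable_mult:
  assumes v: "v \<in> L2_on l" and h: "continuous_on {0..l} h"
  shows "integrable (lebesgue_on {0<..<l}) (\<lambda>x. v x * h x)"
proof -
  obtain M where M: "M > 0" "\<And>x. x \<in> {0..l} \<Longrightarrow> \<bar>h x\<bar> \<le> M"
    using continuous_on_Icc_bounded[OF h] by blast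
  have hm: "h \<in> borel_measurable (lebesgue_on {0<..<l})"
    using integrable_lebesgue_on_Ioo_continuous[OF h] by (rule borel_measurable_integrable)
  have vm: "v \<in> borel_measurable (lebesgue_on {0<..<l})"
    and v2: "integrable (lebesgue_on {0<..<l}) (\<lambda>x. (v x)\<^sup>2)" using v by (auto simp: L2_on_def)
  have "integrable (lebesgue_on {0<..<l}) (\<lambda>x. M * (1 + (v x)\<^sup>2))"
    using v2 integrable_lebesgue_on_Ioo_continuous[of 0 l "\<lambda>_. 1"] by auto
  then show ?thesis
  proof (rule Bochner_Integration.integrable_bound)
    show "(\<lambda>x. v x * h x) \<in> borel_measurable (lebesgue_on {0<..<l})" using hm vm by measurable
    show "AE x in lebesgue_on {0<..<l}. norm (v x * h x) \<le> norm (M * (1 + (v x)\<^sup>2))"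
    proof (intro AE_I2)
      fix x assume "x \<in> space (lebesgue_on {0<..<l})"
      then have x: "x \<in> {0..l}" by auto
      \<comment> \<open>On an interval of finite length this puts square-integrable functions into
        L^1.\<close>
      have "\<bar>v x\<bar> \<le> 1 + (v x)\<^sup>2"
      proof -
        have "0 \<le> (\<bar>v x\<bar> - 1/2)\<^sup>2" by simp
        then have "\<bar>v x\<bar> \<le> (v x)\<^sup>2 + (1/2)\<^sup>2" by (simp add: power2_diff)
        also have "\<dots> \<le> 1 + (v x)\<^sup>2" by (simp add: power2_eq_square)
        finally show ?thesis .
      qed
      then have "\<bar>v x\<bar> * \<bar>h x\<bar> \<le> (1 + (v x)\<^sup>2) * M" using M(2)[OF x] M(1) by (intro mult_mono) auto
      then show "norm (v x * h x) \<le> norm (M * (1 + (v x)\<^sup>2))" using M(1) by (simp add: abs_mult mult.commute)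
    qed
  qed
qed

text \<open>The layers have width \<open>2 / n\<close>, which balances the growth of \<open>E n\<close>, and \<open>g\<close> is small on them.\<close>

lemma boundary_layer_tendsto_0:
  fixes g :: "real \<Rightarrow> real"
  assumes l: "0 < l" and g: "continuous_on {0..l} g" "g 0 = 0" "g l = 0" and C: "0 < C"
    and E: "\<And>n x. 0 < n \<Longrightarrow> x \<in> {0<..<l} \<Longrightarrow> \<bar>E n x\<bar> \<le> C * real n"
    and E0: "\<And>n x. x \<in> {0<..<l} \<Longrightarrow> 2 < real n * x \<Longrightarrow> 2 < real n * (l - x) \<Longrightarrow> E n x = 0"
  shows "(\<lambda>n. integral\<^sup>L (lebesgue_on {0<..<l}) (\<lambda>x. g x * E n x)) \<longlonglongrightarrow> 0"
proof (rule metric_LIMSEQ_I)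
  fix e :: real assume e: "0 < e"
  \<comment> \<open>Two layers of length 2 / n and the bound C * n on \<open>E n\<close> give 4 *
    \<delta> * C in total, which is below e.\<close>
  define \<delta> where "\<delta> = e / (5 * C)"
  have \<delta>: "\<delta> > 0" using e C by (simp add: \<delta>_def)
  have "uniformly_continuous_on {0..l} g" using g(1) compact_uniformly_continuous by blast
  then obtain d where d: "d > 0" "\<And>x y. x \<in> {0..l} \<Longrightarrow> y \<in> {0..l} \<Longrightarrow> \<bar>x - y\<bar> < d \<Longrightarrow> \<bar>g x - g y\<bar> < \<delta>"
    using \<delta> unfolding uniformly_continuous_on_def dist_real_def by metis
  obtain N :: nat where N: "real N > max (2 / d) (2 / l)" using reals_Archimedean2 by blast
  let ?L = "lebesgue_on {0<..<l}"
  show "\<exists>N. \<forall>n\<ge>N. dist (integral\<^sup>L ?L (\<lambda>x. g x * E n x)) 0 < e"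
  proof (intro exI[of _ N] allI impI)
    fix n assume n: "N \<le> n"
    have nn: "real n > 2 / d" "real n > 2 / l" using N n by (auto intro: less_le_trans)
    then have n0: "0 < real n" using l by (smt (verit) divide_pos_pos)
    have nd: "2 / real n < d" "2 / real n < l" using nn n0 d l by (simp_all add: field_simps)
    let ?A = "{0<..2 / real n}" and ?B = "{l - 2 / real n..<l}"
    have sub: "?A \<subseteq> {0<..<l}" "?B \<subseteq> {0<..<l}" using nd by auto
    have iA: "integrable ?L (indicator ?A :: real \<Rightarrow> real)" and iB: "integrable ?L (indicator ?B :: real \<Rightarrow> real)"
      using sub n0 by (auto simp: emeasure_restrict_space sets_restrict_space_iff intro!: integrable_real_indicator)
    have mA: "integral\<^sup>L ?L (indicator ?A) = 2 / real n"
      and mB: "integral\<^sup>L ?L (indicator ?B) = 2 / real n"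
      using sub n0 by (auto simp: measure_restrict_space Int_absorb1 Int_absorb2)
    have "norm (integral\<^sup>L ?L (\<lambda>x. g x * E n x)) \<le> integral\<^sup>L ?L (\<lambda>x. norm (g x * E n x))"
      by (rule integral_norm_bound)
    also have "\<dots> \<le> integral\<^sup>L ?L (\<lambda>x. (\<delta> * (C * real n)) * (indicator ?A x + indicator ?B x))"
    proof (rule integral_mono')
      show "integrable ?L (\<lambda>x. (\<delta> * (C * real n)) * (indicator ?A x + indicator ?B x))"
        using iA iB by auto
      fix x assume "x \<in> space ?L"
      then have x: "x \<in> {0<..<l}" by simp
      show "norm (g x * E n x) \<le> (\<delta> * (C * real n)) * (indicator ?A x + indicator ?B x)"
      proof (cases "x \<in> ?A \<or> x \<in> ?B")
        case True
        have "\<bar>g x\<bar> \<le> \<delta>"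
          using True d(2)[of x 0] d(2)[of x l] g x nd by auto
        then have "\<bar>g x\<bar> * \<bar>E n x\<bar> \<le> \<delta> * (C * real n)"
          using E[of n x] n0 x \<delta> by (intro mult_mono) auto
        also have "\<dots> \<le> (\<delta> * (C * real n)) * (indicator ?A x + indicator ?B x)"
          using True \<delta> C by (auto simp: indicator_def)
        finally show ?thesis by (simp add: abs_mult)
      next
        case False
        then have "2 < real n * x" "2 < real n * (l - x)" using n0 x by (auto simp: field_simps)
        then have "E n x = 0" using E0[OF x] by blast
        then show ?thesis using \<delta> C by simp
      qed
    qed (use \<delta> C in auto)
    also have "\<dots> = (\<delta> * (C * real n)) * (2 / real n + 2 / real n)"
      using iA iB mA mB by simp
    also have "\<dots> = 4 * \<delta> * C" using n0 by simp
    also have "\<dots> < e" using e C by (simp add: \<delta>_def)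
    finally show "dist (integral\<^sup>L ?L (\<lambda>x. g x * E n x)) 0 < e" by (simp add: dist_real_def)
  qed
qed

lemma cutoff_tendsto_1:
  assumes "0 < x" "x < l"
  shows "(\<lambda>n. cutoff l (real n) x) \<longlonglongrightarrow> 1"
proof -
  obtain N :: nat where N: "real N > max (2 / x) (2 / (l - x))" using reals_Archimedean2 by blast
  have "cutoff l (real n) x = 1" if "n \<ge> N" for n
  proof (rule cutoff_inner)
    have "real n > 2 / x" "real n > 2 / (l - x)" using N that by auto
    then show "2 < real n * x" "2 < real n * (l - x)" using assms by (simp_all add: field_simps)
  qed
  then have "eventually (\<lambda>n. 1 = cutoff l (real n) x) sequentially"
    unfolding eventually_sequentially by (metis)
  then show ?thesis by (rule Lim_transform_eventually[OF tendsto_const])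
qed

lemma cutoff_integral_tendsto:
  fixes f :: "real \<Rightarrow> real"
  assumes "integrable (lebesgue_on {0<..<l}) f"
  shows "(\<lambda>n. integral\<^sup>L (lebesgue_on {0<..<l}) (\<lambda>x. f x * cutoff l (real n) x)) \<longlonglongrightarrow> integral\<^sup>L (lebesgue_on {0<..<l}) f"
    and "integrable (lebesgue_on {0<..<l}) (\<lambda>x. f x * cutoff l r x)"
proof -
  let ?L = "lebesgue_on {0<..<l}"
  have cm: "cutoff l r \<in> borel_measurable ?L" for r
    using integrable_lebesgue_on_Ioo_continuous[OF smooth_continuous_on[OF smooth_cutoff]]
    by (rule borel_measurable_integrable)
  have fm: "f \<in> borel_measurable ?L" using assms by (rule borel_measurable_integrable)
  have b: "norm (f x * cutoff l r x) \<le> norm (f x)" for x r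
    using mult_left_le[OF cutoff_bounds[of l r x], of "\<bar>f x\<bar>"] by (simp add: abs_mult)
  show "(\<lambda>n. integral\<^sup>L ?L (\<lambda>x. f x * cutoff l (real n) x)) \<longlonglongrightarrow> integral\<^sup>L ?L f"
  proof (rule integral_dominated_convergence[where w = "\<lambda>x. norm (f x)"])
    show "AE x in ?L. (\<lambda>n. f x * cutoff l (real n) x) \<longlonglongrightarrow> f x"
    proof (intro AE_I2)
      fix x assume "x \<in> space ?L"
      then have "(\<lambda>n. f x * cutoff l (real n) x) \<longlonglongrightarrow> f x * 1"
        by (intro tendsto_intros cutoff_tendsto_1) auto
      then show "(\<lambda>n. f x * cutoff l (real n) x) \<longlonglongrightarrow> f x" by simp
    qed
  qed (use fm cm assms b in auto)
  show "integrable ?L (\<lambda>x. f x * cutoff l r x)"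
    by (rule Bochner_Integration.integrable_bound[OF assms]) (use fm cm b in auto)
qed

text \<open>The weak derivative may be tested with \<psi> times the cutoff. Terms in which
  derivatives fall on the cutoff are collected in \<open>E n\<close>; they live in layers of width
  of order 1 / n and grow at most like n, so the vanishing boundary values of \<open>g\<close> make
  their integral tend to 0.\<close>

lemma weak_deriv_tested_cutoff:
  assumes l: "0 < l" and g: "continuous_on {0..l} g" "g 0 = 0" "g l = 0"
    and v: "has_weak_deriv l j g v" and \<psi>: "smooth \<psi>" and C: "0 < C"
    and E: "\<And>n x. 0 < n \<Longrightarrow> x \<in> {0<..<l} \<Longrightarrow> \<bar>E n x\<bar> \<le> C * real n"
    and E0: "\<And>n x. x \<in> {0<..<l} \<Longrightarrow> 2 < real n * x \<Longrightarrow> 2 < real n * (l - x) \<Longrightarrow> E n x = 0"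
    and Ec: "\<And>n. continuous_on {0..l} (E n)"
    and D: "\<And>n x. (deriv ^^ j) (\<lambda>x. \<psi> x * cutoff l (real n) x) x = (deriv ^^ j) \<psi> x * cutoff l (real n) x + E n x"
  shows "integral\<^sup>L (lebesgue_on {0<..<l}) (\<lambda>x. g x * (deriv ^^ j) \<psi> x) =
     (-1) ^ j * integral\<^sup>L (lebesgue_on {0<..<l}) (\<lambda>x. v x * \<psi> x)"
proof -
  let ?L = "lebesgue_on {0<..<l}"
  have vL: "v \<in> L2_on l" using v by (simp add: has_weak_deriv_def)
  have "smooth ((deriv ^^ j) \<psi>)" by (induction j) (auto simp: \<psi> intro: smooth_deriv)
  then have i1: "integrable ?L (\<lambda>x. g x * (deriv ^^ j) \<psi> x)"
    by (intro integrable_lebesgue_on_Ioo_continuous continuous_intros g smooth_continuous_on)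
  have i2: "integrable ?L (\<lambda>x. v x * \<psi> x)" by (intro L2_on_integrable_mult vL smooth_continuous_on \<psi>)
  have iE: "integrable ?L (\<lambda>x. g x * E n x)" for n
    by (intro integrable_lebesgue_on_Ioo_continuous continuous_intros g Ec)
  have "(\<lambda>n. integral\<^sup>L ?L (\<lambda>x. g x * (deriv ^^ j) \<psi> x * cutoff l (real n) x) + integral\<^sup>L ?L (\<lambda>x. g x * E n x)
     - (-1) ^ j * integral\<^sup>L ?L (\<lambda>x. v x * \<psi> x * cutoff l (real n) x)) \<longlonglongrightarrow>
     integral\<^sup>L ?L (\<lambda>x. g x * (deriv ^^ j) \<psi> x) + 0 - (-1) ^ j * integral\<^sup>L ?L (\<lambda>x. v x * \<psi> x)"
    by (intro tendsto_intros cutoff_integral_tendsto i1 i2 boundary_layer_tendsto_0[OF l g C E E0])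
  moreover have "eventually (\<lambda>n. integral\<^sup>L ?L (\<lambda>x. g x * (deriv ^^ j) \<psi> x * cutoff l (real n) x) + integral\<^sup>L ?L (\<lambda>x. g x * E n x)
     - (-1) ^ j * integral\<^sup>L ?L (\<lambda>x. v x * \<psi> x * cutoff l (real n) x) = 0) sequentially"
  proof -
    obtain N :: nat where N: "real N > 5 / l" using reals_Archimedean2 by blast
    have "integral\<^sup>L ?L (\<lambda>x. g x * (deriv ^^ j) \<psi> x * cutoff l (real n) x) + integral\<^sup>L ?L (\<lambda>x. g x * E n x)
     - (-1) ^ j * integral\<^sup>L ?L (\<lambda>x. v x * \<psi> x * cutoff l (real n) x) = 0" if n: "n \<ge> N" for n
    proof -
      have "real n > 5 / l" using n N by auto
      then have n5: "5 \<le> real n * l" using l by (simp add: field_simps)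
      then have n0: "0 < real n" using l by (cases "n = 0") auto
      have "integral\<^sup>L ?L (\<lambda>x. g x * (deriv ^^ j) (\<lambda>x. \<psi> x * cutoff l (real n) x) x) =
        (-1) ^ j * integral\<^sup>L ?L (\<lambda>x. v x * (\<psi> x * cutoff l (real n) x))"
        using v cutoff_test_function[OF \<psi> n0 n5] by (simp add: has_weak_deriv_def)
      moreover have "integral\<^sup>L ?L (\<lambda>x. g x * (deriv ^^ j) (\<lambda>x. \<psi> x * cutoff l (real n) x) x) =
         integral\<^sup>L ?L (\<lambda>x. g x * (deriv ^^ j) \<psi> x * cutoff l (real n) x + g x * E n x)"
        unfolding D by (simp add: distrib_left mult.assoc)
      ultimately show ?thesis
        using cutoff_integral_tendsto(2)[OF i1] iE by (simp add: mult.assoc)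
    qed
    then show ?thesis unfolding eventually_sequentially by blast
  qed
  ultimately have "(\<lambda>n::nat. 0) \<longlonglongrightarrow> integral\<^sup>L ?L (\<lambda>x. g x * (deriv ^^ j) \<psi> x) + 0 - (-1) ^ j * integral\<^sup>L ?L (\<lambda>x. v x * \<psi> x)"
    by (rule Lim_transform_eventually)
  from LIMSEQ_unique[OF this tendsto_const] show ?thesis by simp
qed

lemma weak_deriv_1_tested:
  assumes l: "0 < l" and g: "continuous_on {0..l} g" "g 0 = 0" "g l = 0"
    and v: "has_weak_deriv l 1 g v" and \<psi>: "smooth \<psi>"
  shows "integral\<^sup>L (lebesgue_on {0<..<l}) (\<lambda>x. g x * deriv \<psi> x) =
     - integral\<^sup>L (lebesgue_on {0<..<l}) (\<lambda>x. v x * \<psi> x)"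
proof -
  obtain C where C: "C > 0" "\<And>n x. 0 < n \<Longrightarrow> \<bar>deriv (cutoff l n) x\<bar> \<le> C * n"
    using deriv_cutoff_bounded by metis
  obtain M where M: "M > 0" "\<And>x. x \<in> {0..l} \<Longrightarrow> \<bar>\<psi> x\<bar> \<le> M"
    using continuous_on_Icc_bounded[OF smooth_continuous_on[OF \<psi>]] by blast
  have "integral\<^sup>L (lebesgue_on {0<..<l}) (\<lambda>x. g x * (deriv ^^ 1) \<psi> x) =
     (-1) ^ 1 * integral\<^sup>L (lebesgue_on {0<..<l}) (\<lambda>x. v x * \<psi> x)"
  proof (rule weak_deriv_tested_cutoff[OF l g v \<psi>, of "M * C" "\<lambda>n x. \<psi> x * deriv (cutoff l (real n)) x"])
    fix n :: nat and x assume "0 < n" "x \<in> {0<..<l}"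
    then have "\<bar>\<psi> x\<bar> * \<bar>deriv (cutoff l (real n)) x\<bar> \<le> M * (C * real n)" using M C by (intro mult_mono) auto
    then show "\<bar>\<psi> x * deriv (cutoff l (real n)) x\<bar> \<le> M * C * real n" by (simp add: abs_mult)
  next
    fix n :: nat and x
    have "((\<lambda>x. \<psi> x * cutoff l (real n) x) has_real_derivative deriv \<psi> x * cutoff l (real n) x + deriv (cutoff l (real n)) x * \<psi> x) (at x)"
      by (intro DERIV_mult smooth_DERIV \<psi> smooth_cutoff)
    then show "(deriv ^^ 1) (\<lambda>x. \<psi> x * cutoff l (real n) x) x = (deriv ^^ 1) \<psi> x * cutoff l (real n) x + \<psi> x * deriv (cutoff l (real n)) x"
      by (simp add: DERIV_imp_deriv mult.commute)
    show "continuous_on {0..l} (\<lambda>x. \<psi> x * deriv (cutoff l (real n)) x)"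
      by (intro smooth_continuous_on smooth_mult \<psi> smooth_deriv smooth_cutoff)
  qed (use M C cutoff_inner(2) in auto)
  then show ?thesis by simp
qed

text \<open>The second derivative of the cutoff grows like n^2, too fast for the boundary layers.
  Since \<psi> vanishes at both ends, it is of order 1 / n there, and the product is again of order
  n. This is why sines, but not cosines, are admissible here.\<close>

lemma weak_deriv_2_tested:
  assumes l: "0 < l" and g: "continuous_on {0..l} g" "g 0 = 0" "g l = 0"
    and v: "has_weak_deriv l 2 g v" and \<psi>: "smooth \<psi>" "\<psi> 0 = 0" "\<psi> l = 0"
  shows "integral\<^sup>L (lebesgue_on {0<..<l}) (\<lambda>x. g x * deriv (deriv \<psi>) x) =
     integral\<^sup>L (lebesgue_on {0<..<l}) (\<lambda>x. v x * \<psi> x)"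
proof -
  obtain C where C: "C > 0" "\<And>n x. 0 < n \<Longrightarrow> \<bar>deriv (cutoff l n) x\<bar> \<le> C * n"
    "\<And>n x. 0 < n \<Longrightarrow> \<bar>deriv (deriv (cutoff l n)) x\<bar> \<le> C * n\<^sup>2"
    using deriv_cutoff_bounded by metis
  obtain M where M: "M > 0" "\<And>x. x \<in> {0..l} \<Longrightarrow> \<bar>deriv \<psi> x\<bar> \<le> M"
    using continuous_on_Icc_bounded[OF smooth_continuous_on[OF smooth_deriv[OF \<psi>(1)]]] by blast
  have lip: "\<bar>\<psi> x - \<psi> y\<bar> \<le> M * \<bar>x - y\<bar>" if "x \<in> {0..l}" "y \<in> {0..l}" for x y
    using field_differentiable_bound[of "{0..l}" \<psi> "deriv \<psi>" M x y] M(2) that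
    by (auto intro: has_field_derivative_at_within smooth_DERIV \<psi>)
  let ?E = "\<lambda>n x. 2 * deriv \<psi> x * deriv (cutoff l (real n)) x + \<psi> x * deriv (deriv (cutoff l (real n))) x"
  have "integral\<^sup>L (lebesgue_on {0<..<l}) (\<lambda>x. g x * (deriv ^^ 2) \<psi> x) =
     (-1) ^ 2 * integral\<^sup>L (lebesgue_on {0<..<l}) (\<lambda>x. v x * \<psi> x)"
  \<comment> \<open>Each of the two terms of \<open>?E\<close> contributes 2 * M * C.\<close>
  proof (rule weak_deriv_tested_cutoff[OF l g v \<psi>(1), of "4 * M * C" ?E])
    fix n :: nat and x assume n: "0 < n" and x: "x \<in> {0<..<l}"
    show "\<bar>?E n x\<bar> \<le> 4 * M * C * real n"
    proof (cases "2 < real n * x \<and> 2 < real n * (l - x)")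
      case True
      then show ?thesis using cutoff_inner[of "real n" x l] M C by simp
    next
      case False
      then have "x \<le> 2 / real n \<or> l - x \<le> 2 / real n"
        using n by (auto simp: pos_le_divide_eq not_less mult.commute)
      then have "min x (l - x) \<le> 2 / real n" by (auto simp: min_le_iff_disj)
      then have "\<bar>\<psi> x\<bar> \<le> M * (2 / real n)"
      proof -
        assume m: "min x (l - x) \<le> 2 / real n"
        have "\<bar>\<psi> x\<bar> \<le> M * min x (l - x)"
          using lip[of x 0] lip[of x l] x \<psi> by (auto simp: min_def)
        also have "\<dots> \<le> M * (2 / real n)" using m M by (intro mult_left_mono) auto
        finally show ?thesis .
      qed
      then have "\<bar>\<psi> x\<bar> * \<bar>deriv (deriv (cutoff l (real n))) x\<bar> \<le> (M * (2 / real n)) * (C * (real n)\<^sup>2)"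
        using M C n by (intro mult_mono) auto
      also have "\<dots> = 2 * M * C * real n" using n by (simp add: power2_eq_square)
      finally have 1: "\<bar>\<psi> x * deriv (deriv (cutoff l (real n))) x\<bar> \<le> 2 * M * C * real n" by (simp add: abs_mult)
      have "\<bar>deriv \<psi> x\<bar> * \<bar>deriv (cutoff l (real n)) x\<bar> \<le> M * (C * real n)"
        using M C n x by (intro mult_mono) auto
      then have "\<bar>deriv \<psi> x * deriv (cutoff l (real n)) x\<bar> \<le> M * C * real n" by (simp add: abs_mult)
      with 1 show ?thesis by linarith
    qed
  next
    fix n :: nat and x
    let ?\<eta> = "cutoff l (real n)"
    have "((\<lambda>x. \<psi> x * ?\<eta> x) has_real_derivative deriv \<psi> x * ?\<eta> x + deriv ?\<eta> x * \<psi> x) (at x)" for x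
      by (intro DERIV_mult smooth_DERIV \<psi> smooth_cutoff)
    then have 1: "deriv (\<lambda>x. \<psi> x * ?\<eta> x) = (\<lambda>x. deriv \<psi> x * ?\<eta> x + deriv ?\<eta> x * \<psi> x)"
      by (intro ext DERIV_imp_deriv)
    have "((\<lambda>x. deriv \<psi> x * ?\<eta> x + deriv ?\<eta> x * \<psi> x) has_real_derivative
       (deriv (deriv \<psi>) x * ?\<eta> x + deriv ?\<eta> x * deriv \<psi> x) + (deriv (deriv ?\<eta>) x * \<psi> x + deriv \<psi> x * deriv ?\<eta> x)) (at x)"
      by (intro DERIV_add DERIV_mult smooth_DERIV \<psi> smooth_cutoff smooth_deriv)
    from DERIV_imp_deriv[OF this]
    show "(deriv ^^ 2) (\<lambda>x. \<psi> x * ?\<eta> x) x = (deriv ^^ 2) \<psi> x * ?\<eta> x + ?E n x"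
      by (simp add: numeral_2_eq_2 1 mult_ac)
    show "continuous_on {0..l} (?E n)"
      by (intro smooth_continuous_on smooth_add smooth_mult smooth_const \<psi> smooth_deriv smooth_cutoff)
  qed (use M C cutoff_inner in auto)
  then show ?thesis by (simp add: numeral_2_eq_2)
qed

section \<open>Sine series\<close>

text \<open>Modes are numbered from 0, so mode k carries the (k + 1)-st sine.\<close>

definition freq :: "real \<Rightarrow> nat \<Rightarrow> real" where
  "freq l k = real (Suc k) * pi / l"

definition sine_coeff :: "real \<Rightarrow> (real \<Rightarrow> real) \<Rightarrow> nat \<Rightarrow> real" where
  "sine_coeff l g k = 2 / l * integral {0..l} (\<lambda>x. g x * sin (freq l k * x))"

lemma freq_pos: "0 < l \<Longrightarrow> 0 < freq l k"
  by (simp add: freq_def)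

lemma sin_freq_end: "0 < l \<Longrightarrow> sin (freq l k * l) = 0"
  unfolding freq_def using sin_npi[of "Suc k"] by (simp del: of_nat_Suc)

lemma has_integral_cos_int_freq:
  fixes l :: real
  assumes l: "0 < l"
  shows "((\<lambda>x. cos (of_int j * pi / l * x)) has_integral (if j = 0 then l else 0)) {0..l}"
proof (cases "j = 0")
  case True
  then show ?thesis using has_integral_const_real[of "1::real" 0 l] l by simp
next
  case False
  define c where "c = of_int j * pi / l"
  have c: "c \<noteq> 0" using False l by (simp add: c_def)
  have "((\<lambda>x. cos (c * x)) has_integral (sin (c * l) / c - sin (c * 0) / c)) {0..l}"
  proof (rule fundamental_theorem_of_calculus)
    fix x assume "x \<in> {0..l}"
    have "((\<lambda>x. sin (c * x) / c) has_real_derivative cos (c * x)) (at x within {0..l})"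
      using c by (auto intro!: derivative_eq_intros)
    then show "((\<lambda>x. sin (c * x) / c) has_vector_derivative cos (c * x)) (at x within {0..l})"
      by (simp add: has_real_derivative_iff_has_vector_derivative)
  qed (use l in auto)
  moreover have "sin (c * l) = 0" using l by (auto simp: c_def sin_zero_iff_int2)
  ultimately show ?thesis using False by (simp add: c_def)
qed

lemma freq_diff_add:
  "freq l k * x - freq l m * x = of_int (int k - int m) * pi / l * x"
  "freq l k * x + freq l m * x = of_int (int k + int m + 2) * pi / l * x"
  by (cases "l = 0"; simp add: freq_def field_simps)+

lemma has_integral_sin_sin:
  assumes l: "0 < l"
  shows "((\<lambda>x. sin (freq l k * x) * sin (freq l m * x)) has_integral (if k = m then l / 2 else 0)) {0..l}"
proof -
  have "((\<lambda>x. (cos (of_int (int k - int m) * pi / l * x) - cos (of_int (int k + int m + 2) * pi / l * x)) / 2) has_integral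
     ((if int k - int m = 0 then l else 0) - (if int k + int m + 2 = 0 then l else 0)) / 2) {0..l}"
    by (intro has_integral_divide has_integral_diff has_integral_cos_int_freq l)
  then show ?thesis unfolding sin_times_sin freq_diff_add by (simp split: if_splits)
qed

lemma has_integral_cos_cos:
  assumes l: "0 < l"
  shows "((\<lambda>x. cos (freq l k * x) * cos (freq l m * x)) has_integral (if k = m then l / 2 else 0)) {0..l}"
proof -
  have "((\<lambda>x. (cos (of_int (int k - int m) * pi / l * x) + cos (of_int (int k + int m + 2) * pi / l * x)) / 2) has_integral
     ((if int k - int m = 0 then l else 0) + (if int k + int m + 2 = 0 then l else 0)) / 2) {0..l}"
    by (intro has_integral_divide has_integral_add has_integral_cos_int_freq l)
  then show ?thesis unfolding cos_times_cos freq_diff_add by (simp split: if_splits)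
qed

text \<open>With \<theta> = pi x / l, a factor cos \<theta> turns sin (j \<theta>) into the mean of
  sin ((j + 1) \<theta>) and sin ((j - 1) \<theta>). Frequencies move both ways, so the induction on
  the power runs for all \<open>j\<close>, and j = 0 is the zero integrand.\<close>

lemma integral_sin_cos_power_zero:
  assumes g: "continuous_on {0..l} g"
    and z: "\<And>k. integral {0..l} (\<lambda>x. g x * sin (freq l k * x)) = 0"
  shows "integral {0..l} (\<lambda>x. g x * (sin (real j * pi / l * x) * cos (pi / l * x) ^ n)) = 0"
proof (induction n arbitrary: j)
  case 0
  show ?case
  proof (cases j)
    case (Suc k)
    then show ?thesis using z[of k] by (simp add: freq_def)
  qed simp
next
  case (Suc n)
  show ?case
  proof (cases j)
    case 0
    then show ?thesis by simp
  next
    case (Suc k)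
    have e: "sin (real j * pi / l * x) * cos (pi / l * x) =
       (sin (real (Suc j) * pi / l * x) + sin (real k * pi / l * x)) / 2" for x
    proof -
      have "real j * pi / l * x + pi / l * x = real (Suc j) * pi / l * x"
        "real j * pi / l * x - pi / l * x = real k * pi / l * x"
        using Suc by (cases "l = 0"; simp add: field_simps)+
      then show ?thesis unfolding sin_times_cos by simp
    qed
    have int: "(\<lambda>x. g x * (sin (real j * pi / l * x) * cos (pi / l * x) ^ n)) integrable_on {0..l}" for j
      by (intro integrable_continuous_interval continuous_intros g)
    have "(\<lambda>x. g x * (sin (real j * pi / l * x) * cos (pi / l * x) ^ Suc n)) =
       (\<lambda>x. (g x * (sin (real (Suc j) * pi / l * x) * cos (pi / l * x) ^ n) + g x * (sin (real k * pi / l * x) * cos (pi / l * x) ^ n)) / 2)"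
    proof
      fix x
      have "g x * (sin (real j * pi / l * x) * cos (pi / l * x) ^ Suc n) =
         g x * ((sin (real j * pi / l * x) * cos (pi / l * x)) * cos (pi / l * x) ^ n)" by simp
      also have "\<dots> = (g x * (sin (real (Suc j) * pi / l * x) * cos (pi / l * x) ^ n) + g x * (sin (real k * pi / l * x) * cos (pi / l * x) ^ n)) / 2"
        unfolding e by (simp add: algebra_simps del: of_nat_Suc)
      finally show "g x * (sin (real j * pi / l * x) * cos (pi / l * x) ^ Suc n) = (g x * (sin (real (Suc j) * pi / l * x) * cos (pi / l * x) ^ n) + g x * (sin (real k * pi / l * x) * cos (pi / l * x) ^ n)) / 2" .
    qed
    then have "integral {0..l} (\<lambda>x. g x * (sin (real j * pi / l * x) * cos (pi / l * x) ^ Suc n)) =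
      integral {0..l} (\<lambda>x. g x * (sin (real (Suc j) * pi / l * x) * cos (pi / l * x) ^ n) + g x * (sin (real k * pi / l * x) * cos (pi / l * x) ^ n)) / 2"
      by simp
    also have "\<dots> = 0"
      using Suc.IH by (subst integral_add[OF int int]) (simp del: of_nat_Suc)
    finally show ?thesis .
  qed
qed

text \<open>\<open>sin (k \<theta>)\<close> is \<open>sin \<theta>\<close> times a polynomial in \<open>cos \<theta>\<close>, and all polynomials arise;
  so the Weierstrass theorem in the variable \<open>y = cos \<theta>\<close> applies.\<close>

lemma sine_system_complete:
  assumes l: "0 < l" and g: "continuous_on {0..l} g" "g 0 = 0" "g l = 0"
    and z: "\<And>k. integral {0..l} (\<lambda>x. g x * sin (freq l k * x)) = 0"
    and x: "x \<in> {0..l}"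
  shows "g x = 0"
proof -
  let ?s = "\<lambda>x. sin (pi / l * x)" and ?c = "\<lambda>x. cos (pi / l * x)"
  have poly: "integral {0..l} (\<lambda>x. g x * ?s x * p (?c x)) = 0" if "real_polynomial_function p" for p
  proof -
    obtain a n where p: "p = (\<lambda>x. \<Sum>i\<le>n. a i * x ^ i)"
      using \<open>real_polynomial_function p\<close> unfolding real_polynomial_function_iff_sum by blast
    have "(\<lambda>x. g x * ?s x * p (?c x)) = (\<lambda>x. \<Sum>i\<le>n. a i * (g x * (sin (real 1 * pi / l * x) * ?c x ^ i)))"
      by (simp add: p sum_distrib_left mult_ac)
    moreover have "integral {0..l} (\<lambda>x. \<Sum>i\<le>n. a i * (g x * (sin (real 1 * pi / l * x) * ?c x ^ i))) =
      (\<Sum>i\<le>n. integral {0..l} (\<lambda>x. a i * (g x * (sin (real 1 * pi / l * x) * ?c x ^ i))))"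
      by (intro integral_sum integrable_continuous_interval continuous_intros g) auto
    ultimately show ?thesis using integral_sin_cos_power_zero[OF g(1) z, of 1] by simp
  qed
  define G where "G y = g (l / pi * arccos y)" for y
  have rng: "l / pi * arccos y \<in> {0..l}" if "y \<in> {-1..1}" for y
    using arccos_lbound[of y] arccos_ubound[of y] that l
    by (auto simp: field_simps intro!: mult_left_mono)
  have Gc: "continuous_on {-1..1} G"
    unfolding G_def using rng
    by (intro continuous_on_compose2[OF g(1)] continuous_intros) auto
  have Gg: "G (?c x) = g x" if "x \<in> {0..l}" for x
  proof -
    have "arccos (?c x) = pi / l * x" using that l by (intro arccos_cos) (auto simp: field_simps)
    then show ?thesis using l by (simp add: G_def)
  qed
  obtain M where M: "M > 0" "\<And>x. x \<in> {0..l} \<Longrightarrow> \<bar>g x\<bar> \<le> M"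
    using continuous_on_Icc_bounded[OF g(1)] by blast
  have s: "0 \<le> ?s x" "?s x \<le> 1" if "x \<in> {0..l}" for x
    using that l by (auto intro!: sin_ge_zero simp: field_simps)
  have nn: "0 \<le> g x * g x * ?s x" if "x \<in> {0..l}" for x
    using s(1)[OF that] by (intro mult_nonneg_nonneg[of "g x * g x"]) auto
  have le: "integral {0..l} (\<lambda>x. g x * g x * ?s x) \<le> e * (M * l)" if e: "e > 0" for e
  proof -
    obtain p where p: "real_polynomial_function p" "\<And>y. y \<in> {-1..1} \<Longrightarrow> \<bar>G y - p y\<bar> < e"
      using Stone_Weierstrass_real_polynomial_function[OF _ Gc e] by auto
    have pc: "continuous_on UNIV p"
      using p(1) by (intro continuous_on_polymonial_function) (simp add: real_polynomial_function_eq)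
    have int: "(\<lambda>x. g x * ?s x * p (?c x)) integrable_on {0..l}"
      by (intro integrable_continuous_interval continuous_intros g continuous_on_compose2[OF pc]) auto
    have int2: "(\<lambda>x. g x * g x * ?s x) integrable_on {0..l}"
      by (intro integrable_continuous_interval continuous_intros g)
    \<comment> \<open>Orthogonality allows one of the two factors g to be replaced by its distance
      from the polynomial in cos.\<close>
    have "integral {0..l} (\<lambda>x. g x * g x * ?s x) = integral {0..l} (\<lambda>x. g x * g x * ?s x) - integral {0..l} (\<lambda>x. g x * ?s x * p (?c x))"
      using poly[OF p(1)] by simp
    also have "\<dots> = integral {0..l} (\<lambda>x. g x * g x * ?s x - g x * ?s x * p (?c x))"
      by (intro Henstock_Kurzweil_Integration.integral_diff[symmetric] int int2)
    also have "\<dots> \<le> integral {0..l} (\<lambda>x. M * e)"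
    proof (rule integral_le)
      fix x assume x: "x \<in> {0..l}"
      have "g x * g x * ?s x - g x * ?s x * p (?c x) = g x * ?s x * (G (?c x) - p (?c x))"
        unfolding Gg[OF x] by (simp add: algebra_simps)
      also have "\<dots> \<le> \<bar>g x * ?s x\<bar> * \<bar>G (?c x) - p (?c x)\<bar>" by (simp add: abs_mult[symmetric])
      also have "\<bar>g x * ?s x\<bar> * \<bar>G (?c x) - p (?c x)\<bar> \<le> (M * 1) * e"
        unfolding abs_mult using M(1) M(2)[OF x] s[OF x] p(2)[of "?c x"]
        by (intro mult_mono) auto
      finally show "g x * g x * ?s x - g x * ?s x * p (?c x) \<le> M * e" by simp
    next
      show "(\<lambda>x. g x * g x * ?s x - g x * ?s x * p (?c x)) integrable_on {0..l}"
        by (intro integrable_diff int int2)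
    qed (auto intro!: integrable_continuous_interval)
    also have "\<dots> = e * (M * l)" using l by simp
    finally show ?thesis .
  qed
  have "integral {0..l} (\<lambda>x. g x * g x * ?s x) \<le> 0"
  proof (rule field_le_epsilon)
    fix e :: real assume "0 < e"
    then show "integral {0..l} (\<lambda>x. g x * g x * ?s x) \<le> 0 + e"
      using le[of "e / (M * l)"] M(1) l by simp
  qed
  moreover have "0 \<le> integral {0..l} (\<lambda>x. g x * g x * ?s x)"
    by (intro Henstock_Kurzweil_Integration.integral_nonneg integrable_continuous_interval continuous_intros g nn)
  ultimately have "integral {0..l} (\<lambda>x. g x * g x * ?s x) = 0" by linarith
  then have zero: "g x * g x * ?s x = 0"
  proof -
    have "continuous_on {0..l} (\<lambda>x. g x * g x * ?s x)" by (intro continuous_intros g)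
    then show ?thesis
      using x l integral_eq_0_iff[of 0 l "\<lambda>x. g x * g x * ?s x"] nn
        \<open>integral {0..l} (\<lambda>x. g x * g x * ?s x) = 0\<close> by blast
  qed
  show ?thesis
  \<comment> \<open>The weight \<open>?s\<close> vanishes exactly at the two ends, where the
    boundary values of \<open>g\<close> take over.\<close>
  proof (cases "x = 0 \<or> x = l")
    case False
    then have "?s x > 0" using x l by (intro sin_gt_zero) (auto simp: field_simps)
    then show ?thesis using zero by auto
  qed (use g in auto)
qed

text \<open>Absolute summability makes the sum of the series continuous, with zero boundary values
  and the same sine coefficients as \<open>g\<close>; completeness of the sines identifies the two.
  No convergence theorem for Fourier series is involved.\<close>

lemma sine_series:
  assumes l: "0 < l" and g: "continuous_on {0..l} g" "g 0 = 0" "g l = 0"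
    and s: "summable (\<lambda>k. \<bar>sine_coeff l g k\<bar>)"
    and x: "x \<in> {0..l}"
  shows "(\<lambda>k. sine_coeff l g k * sin (freq l k * x)) sums g x"
proof -
  let ?a = "\<lambda>k x. sine_coeff l g k * sin (freq l k * x)"
  have b: "norm (?a k x) \<le> \<bar>sine_coeff l g k\<bar>" for k x
    by (simp add: abs_mult mult_left_le)
  have sm: "summable (\<lambda>k. ?a k x)" for x
    by (rule summable_comparison_test'[OF s, of 0]) (use b in auto)
  define S where "S x = (\<Sum>k. ?a k x)" for x
  have ul: "uniform_limit {0..l} (\<lambda>n x. \<Sum>k<n. ?a k x) S sequentially"
    unfolding S_def by (rule Weierstrass_m_test[OF b s])
  have Sc: "continuous_on {0..l} S"
    by (rule uniform_limit_theorem[OF _ ul]) (auto intro!: always_eventually continuous_intros)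
  have SI: "integral {0..l} (\<lambda>x. S x * sin (freq l m * x)) = sine_coeff l g m * (l / 2)" for m
  proof -
    have "uniform_limit {0..l} (\<lambda>n x. \<Sum>k<n. ?a k x * sin (freq l m * x)) (\<lambda>x. \<Sum>k. ?a k x * sin (freq l m * x)) sequentially"
    proof (rule Weierstrass_m_test[OF _ s])
      fix n x
      have "norm (?a n x) * \<bar>sin (freq l m * x)\<bar> \<le> \<bar>sine_coeff l g n\<bar> * 1" by (intro mult_mono b) auto
      then show "norm (?a n x * sin (freq l m * x)) \<le> \<bar>sine_coeff l g n\<bar>" by (simp add: abs_mult)
    qed
    moreover have "(\<Sum>k. ?a k x * sin (freq l m * x)) = S x * sin (freq l m * x)" for x
      unfolding S_def by (rule suminf_mult2[OF sm, symmetric])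
    ultimately have "uniform_limit {0..l} (\<lambda>n x. \<Sum>k<n. ?a k x * sin (freq l m * x)) (\<lambda>x. S x * sin (freq l m * x)) sequentially"
      by simp
    then obtain I J where IJ: "\<And>n. ((\<lambda>x. \<Sum>k<n. ?a k x * sin (freq l m * x)) has_integral I n) {0..l}"
      "((\<lambda>x. S x * sin (freq l m * x)) has_integral J) {0..l}" "I \<longlonglongrightarrow> J"
      by (rule uniform_limit_integral) (auto intro!: continuous_intros)
    have "((\<lambda>x. \<Sum>k<n. sine_coeff l g k * (sin (freq l k * x) * sin (freq l m * x))) has_integral
       (\<Sum>k<n. sine_coeff l g k * (if k = m then l / 2 else 0))) {0..l}" for n
      by (intro has_integral_sum has_integral_mult_right has_integral_sin_sin l) auto
    then have "I n = (\<Sum>k<n. sine_coeff l g k * (if k = m then l / 2 else 0))" for n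
      using has_integral_unique[OF IJ(1)[of n]] by (simp add: mult.assoc)
    also have "(\<Sum>k<n. sine_coeff l g k * (if k = m then l / 2 else 0)) = (if m < n then sine_coeff l g m * (l / 2) else 0)" for n
      by (simp add: if_distrib sum.delta cong: if_cong)
    finally have "eventually (\<lambda>n. sine_coeff l g m * (l / 2) = I n) sequentially"
      by (auto simp: eventually_sequentially intro!: exI[of _ "Suc m"])
    then have "I \<longlonglongrightarrow> sine_coeff l g m * (l / 2)" by (rule Lim_transform_eventually[OF tendsto_const])
    then show ?thesis using IJ LIMSEQ_unique integral_unique by blast
  qed
  have gI: "integral {0..l} (\<lambda>x. g x * sin (freq l m * x)) = sine_coeff l g m * (l / 2)" for m
    using l by (simp add: sine_coeff_def)
  have "g x - S x = 0"
  proof (rule sine_system_complete[OF l _ _ _ _ x])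
    show "continuous_on {0..l} (\<lambda>x. g x - S x)" by (intro continuous_intros g Sc)
    show "g 0 - S 0 = 0" using g by (simp add: S_def)
    show "g l - S l = 0" using g l by (simp add: S_def sin_freq_end)
    fix k
    have "integral {0..l} (\<lambda>x. g x * sin (freq l k * x) - S x * sin (freq l k * x)) =
       integral {0..l} (\<lambda>x. g x * sin (freq l k * x)) - integral {0..l} (\<lambda>x. S x * sin (freq l k * x))"
      by (intro Henstock_Kurzweil_Integration.integral_diff integrable_continuous_interval continuous_intros g Sc)
    then show "integral {0..l} (\<lambda>x. (g x - S x) * sin (freq l k * x)) = 0"
      by (simp add: gI SI left_diff_distrib)
  qed
  then show ?thesis using summable_sums[OF sm[of x]] by (simp add: S_def)
qed

section \<open>Decay of sine coefficients from weak derivatives\<close>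

lemma lebesgue_on_Ioo_integral:
  fixes h :: "real \<Rightarrow> real"
  assumes "continuous_on {a..b} h"
  shows "integral\<^sup>L (lebesgue_on {a<..<b}) h = integral {a..b} h"
proof -
  have "integral\<^sup>L (lebesgue_on {a<..<b}) h = integral {a<..<b} h"
    by (intro lebesgue_integral_eq_integral integrable_lebesgue_on_Ioo_continuous assms) auto
  also have "\<dots> = integral {a..b} h" by (simp add: integral_open_interval_real)
  finally show ?thesis .
qed

text \<open>Expands the square of v - p, where p is the partial cosine sum with the normalized
  coefficients 2 / l * b k. Cosines occur because the derivative of a sine series is a cosine
  series.\<close>

lemma bessel_cos:
  assumes l: "0 < l" and v: "v \<in> L2_on l"
  shows "(\<Sum>k<n. (integral\<^sup>L (lebesgue_on {0<..<l}) (\<lambda>x. v x * cos (freq l k * x)))\<^sup>2)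
     \<le> l / 2 * integral\<^sup>L (lebesgue_on {0<..<l}) (\<lambda>x. (v x)\<^sup>2)"
proof -
  let ?L = "lebesgue_on {0<..<l}"
  define b where "b k = integral\<^sup>L ?L (\<lambda>x. v x * cos (freq l k * x))" for k
  define p where "p x = (\<Sum>k<n. 2 / l * b k * cos (freq l k * x))" for x
  have pc: "continuous_on {0..l} p" unfolding p_def by (intro continuous_intros)
  have v2: "integrable ?L (\<lambda>x. (v x)\<^sup>2)" using v by (simp add: L2_on_def)
  have vp: "integrable ?L (\<lambda>x. v x * p x)" by (rule L2_on_integrable_mult[OF v pc])
  have pp: "integrable ?L (\<lambda>x. p x * p x)" by (intro integrable_lebesgue_on_Ioo_continuous continuous_intros pc)
  have "integral\<^sup>L ?L (\<lambda>x. v x * p x) = integral\<^sup>L ?L (\<lambda>x. \<Sum>k<n. 2 / l * b k * (v x * cos (freq l k * x)))"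
    by (simp add: p_def sum_distrib_left mult_ac)
  also have "\<dots> = (\<Sum>k<n. 2 / l * b k * b k)"
    unfolding b_def by (subst Bochner_Integration.integral_sum) (auto intro!: integrable_mult_right L2_on_integrable_mult v continuous_intros)
  finally have VP: "integral\<^sup>L ?L (\<lambda>x. v x * p x) = 2 / l * (\<Sum>k<n. (b k)\<^sup>2)"
    by (simp add: sum_distrib_left power2_eq_square mult_ac)
  have "((\<lambda>x. \<Sum>k<n. \<Sum>m<n. (2 / l * b k) * (2 / l * b m) * (cos (freq l k * x) * cos (freq l m * x))) has_integral
     (\<Sum>k<n. \<Sum>m<n. (2 / l * b k) * (2 / l * b m) * (if k = m then l / 2 else 0))) {0..l}"
    by (intro has_integral_sum has_integral_mult_right has_integral_cos_cos l) auto
  moreover have "(\<lambda>x. \<Sum>k<n. \<Sum>m<n. (2 / l * b k) * (2 / l * b m) * (cos (freq l k * x) * cos (freq l m * x))) = (\<lambda>x. p x * p x)"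
    by (simp add: p_def sum_product mult_ac)
  moreover have "(\<Sum>k<n. \<Sum>m<n. (2 / l * b k) * (2 / l * b m) * (if k = m then l / 2 else 0)) = 2 / l * (\<Sum>k<n. (b k)\<^sup>2)"
    using l by (simp add: if_distrib sum.delta sum_distrib_left power2_eq_square field_simps cong: if_cong)
  ultimately have PP: "integral\<^sup>L ?L (\<lambda>x. p x * p x) = 2 / l * (\<Sum>k<n. (b k)\<^sup>2)"
    by (subst lebesgue_on_Ioo_integral) (auto intro!: continuous_intros pc integral_unique)
  have "0 \<le> integral\<^sup>L ?L (\<lambda>x. (v x - p x)\<^sup>2)" by (simp add: integral_nonneg_AE)
  also have "\<dots> = integral\<^sup>L ?L (\<lambda>x. (v x)\<^sup>2 - 2 * (v x * p x) + p x * p x)"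
    by (simp add: power2_eq_square algebra_simps)
  also have "\<dots> = integral\<^sup>L ?L (\<lambda>x. (v x)\<^sup>2) - 2 * integral\<^sup>L ?L (\<lambda>x. v x * p x) + integral\<^sup>L ?L (\<lambda>x. p x * p x)"
    using v2 vp pp by simp
  finally have "2 / l * (\<Sum>k<n. (b k)\<^sup>2) \<le> integral\<^sup>L ?L (\<lambda>x. (v x)\<^sup>2)" by (simp add: VP PP)
  then have "l / 2 * (2 / l * (\<Sum>k<n. (b k)\<^sup>2)) \<le> l / 2 * integral\<^sup>L ?L (\<lambda>x. (v x)\<^sup>2)"
    using l by (intro mult_left_mono) auto
  then show ?thesis using l by (simp add: b_def)
qed

lemma deriv_sin_cos_affine:
  "deriv (\<lambda>x::real. sin (c * x)) = (\<lambda>x. c * cos (c * x))"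
  "deriv (\<lambda>x::real. c * cos (c * x)) = (\<lambda>x. - c\<^sup>2 * sin (c * x))"
  "deriv (\<lambda>x::real. cos (c * x)) = (\<lambda>x. - c * sin (c * x))"
  by (auto intro!: ext DERIV_imp_deriv derivative_eq_intros simp: power2_eq_square)

lemma summable_inverse_squares_Suc: "summable (\<lambda>k. 1 / (real (Suc k))\<^sup>2)"
  using inverse_power_summable[of 2] by (subst summable_Suc_iff) (simp add: inverse_eq_divide)

text \<open>Testing with a cosine gives freq * coefficient = 2 / l * b k, where b is square
  summable. The inequality 2 |b k| / freq <= 1 / freq^2 + (b k)^2 then trades one power of the
  frequency for absolute summability.\<close>

lemma summable_sine_coeff_W1:
  assumes l: "0 < l" and g: "continuous_on {0..l} g" "g 0 = 0" "g l = 0" and W: "g \<in> sobolev_W2 1 l"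
  shows "summable (\<lambda>k. \<bar>sine_coeff l g k\<bar>)"
proof -
  let ?L = "lebesgue_on {0<..<l}"
  obtain v where v: "has_weak_deriv l 1 g v" using W by (auto simp: sobolev_W2_def)
  then have vL: "v \<in> L2_on l" by (simp add: has_weak_deriv_def)
  define b where "b k = integral\<^sup>L ?L (\<lambda>x. v x * cos (freq l k * x))" for k
  have c: "freq l k * sine_coeff l g k = 2 / l * b k" for k
  proof -
    have "integral\<^sup>L ?L (\<lambda>x. g x * deriv (\<lambda>x. cos (freq l k * x)) x) = - b k"
      unfolding b_def by (intro weak_deriv_1_tested l g v smooth_cos_affine)
    moreover have "integral\<^sup>L ?L (\<lambda>x. g x * deriv (\<lambda>x. cos (freq l k * x)) x) = integral {0..l} (\<lambda>x. - freq l k * (g x * sin (freq l k * x)))"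
      unfolding deriv_sin_cos_affine
      by (subst lebesgue_on_Ioo_integral) (auto intro!: continuous_intros g simp: mult_ac)
    ultimately have "freq l k * integral {0..l} (\<lambda>x. g x * sin (freq l k * x)) = b k"
      by (simp only: integral_mult_right)
    then show ?thesis by (simp add: sine_coeff_def mult_ac)
  qed
  have "summable (\<lambda>k. (b k)\<^sup>2)"
    using bessel_cos[OF l vL] by (intro summableI_nonneg_bounded[of _ "l / 2 * integral\<^sup>L ?L (\<lambda>x. (v x)\<^sup>2)"]) (auto simp: b_def)
  then have "summable (\<lambda>k. 1 / l * ((l / pi)\<^sup>2 * (1 / (real (Suc k))\<^sup>2) + (b k)\<^sup>2))"
    by (intro summable_mult summable_add summable_inverse_squares_Suc)
  then show ?thesis
  proof (rule summable_comparison_test'[of _ 0])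
    fix k
    have fp: "freq l k > 0" by (rule freq_pos[OF l])
    have "\<bar>sine_coeff l g k\<bar> = 1 / l * (2 * (1 / freq l k) * \<bar>b k\<bar>)"
    proof -
      have "sine_coeff l g k = 2 / l * b k / freq l k" using c[of k] fp
        by (subst nonzero_eq_divide_eq) (simp_all add: mult.commute)
      then show ?thesis using fp l by (simp add: abs_mult)
    qed
    also have "2 * (1 / freq l k) * \<bar>b k\<bar> \<le> (1 / freq l k)\<^sup>2 + \<bar>b k\<bar>\<^sup>2" by (rule sum_squares_bound)
    finally have "\<bar>sine_coeff l g k\<bar> \<le> 1 / l * ((1 / freq l k)\<^sup>2 + \<bar>b k\<bar>\<^sup>2)"
      using l by (simp add: divide_right_mono)
    also have "(1 / freq l k)\<^sup>2 = (l / pi)\<^sup>2 * (1 / (real (Suc k))\<^sup>2)"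
      by (simp add: freq_def power_divide power_mult_distrib)
    finally show "norm \<bar>sine_coeff l g k\<bar> \<le> 1 / l * ((l / pi)\<^sup>2 * (1 / (real (Suc k))\<^sup>2) + (b k)\<^sup>2)" by simp
  qed
qed

text \<open>The weighted inequality |v| <= (N + v^2 / N) / 2 takes the place of Cauchy-Schwarz and
  integrates to (l + 1) * N / 2. The bound is linear in \<open>N\<close>, so small Sobolev norms of
  differences will give small differences of coefficients.\<close>

lemma sine_coeff_weak_deriv_2_bound:
  assumes l: "0 < l" and g: "continuous_on {0..l} g" "g 0 = 0" "g l = 0" and v: "has_weak_deriv l 2 g v"
    and N: "0 < N" "integral\<^sup>L (lebesgue_on {0<..<l}) (\<lambda>x. (v x)\<^sup>2) \<le> N\<^sup>2"
  shows "\<bar>sine_coeff l g k\<bar> \<le> (l + 1) * l / pi\<^sup>2 * N / (real (Suc k))\<^sup>2"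
proof -
  let ?L = "lebesgue_on {0<..<l}"
  have vL: "v \<in> L2_on l" using v by (simp add: has_weak_deriv_def)
  have v2: "integrable ?L (\<lambda>x. (v x)\<^sup>2)" using vL by (simp add: L2_on_def)
  have one: "integrable ?L (\<lambda>x. 1::real)" by (intro integrable_lebesgue_on_Ioo_continuous continuous_intros)
  have "integral\<^sup>L ?L (\<lambda>x. g x * deriv (deriv (\<lambda>x. sin (freq l k * x))) x) = integral\<^sup>L ?L (\<lambda>x. v x * sin (freq l k * x))"
    using l by (intro weak_deriv_2_tested g v smooth_sin_affine) (auto simp: sin_freq_end)
  moreover have "integral\<^sup>L ?L (\<lambda>x. g x * deriv (deriv (\<lambda>x. sin (freq l k * x))) x) = integral {0..l} (\<lambda>x. - (freq l k)\<^sup>2 * (g x * sin (freq l k * x)))"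
    unfolding deriv_sin_cos_affine
    by (subst lebesgue_on_Ioo_integral) (auto intro!: continuous_intros g simp: mult_ac)
  ultimately have "- (freq l k)\<^sup>2 * integral {0..l} (\<lambda>x. g x * sin (freq l k * x)) = integral\<^sup>L ?L (\<lambda>x. v x * sin (freq l k * x))"
    by (simp only: integral_mult_right)
  then have "\<bar>- (freq l k)\<^sup>2 * integral {0..l} (\<lambda>x. g x * sin (freq l k * x))\<bar> = \<bar>integral\<^sup>L ?L (\<lambda>x. v x * sin (freq l k * x))\<bar>"
    by (rule arg_cong)
  then have "(freq l k)\<^sup>2 * \<bar>integral {0..l} (\<lambda>x. g x * sin (freq l k * x))\<bar> = \<bar>integral\<^sup>L ?L (\<lambda>x. v x * sin (freq l k * x))\<bar>"
    by (simp add: abs_mult)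
  also have "\<dots> \<le> integral\<^sup>L ?L (\<lambda>x. norm (v x * sin (freq l k * x)))"
    using integral_norm_bound[of ?L "\<lambda>x. v x * sin (freq l k * x)"] by simp
  also have "\<dots> \<le> integral\<^sup>L ?L (\<lambda>x. (N * 1 + (v x)\<^sup>2 / N) / 2)"
  proof (rule integral_mono')
    show "integrable ?L (\<lambda>x. (N * 1 + (v x)\<^sup>2 / N) / 2)" using v2 one by (intro integrable_divide Bochner_Integration.integrable_add integrable_mult_right) auto
    fix x
    have "norm (v x * sin (freq l k * x)) \<le> \<bar>v x\<bar>" by (simp add: abs_mult mult_left_le)
    also have "2 * N * \<bar>v x\<bar> \<le> N\<^sup>2 + \<bar>v x\<bar>\<^sup>2" by (rule sum_squares_bound)
    then have "\<bar>v x\<bar> \<le> (N * 1 + (v x)\<^sup>2 / N) / 2" using N(1) by (simp add: field_simps power2_eq_square)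
    finally show "norm (v x * sin (freq l k * x)) \<le> (N * 1 + (v x)\<^sup>2 / N) / 2" .
  qed (use N in auto)
  also have "\<dots> = (integral\<^sup>L ?L (\<lambda>x. N * 1) + integral\<^sup>L ?L (\<lambda>x. (v x)\<^sup>2 / N)) / 2"
    using v2 one
    by (simp only: integral_divide_zero, subst Bochner_Integration.integral_add) (intro integrable_mult_right integrable_divide | simp)+
  also have "\<dots> = (N * integral\<^sup>L ?L (\<lambda>x. 1) + integral\<^sup>L ?L (\<lambda>x. (v x)\<^sup>2) / N) / 2"
    by (simp only: integral_mult_right_zero integral_divide_zero)
  also have "integral\<^sup>L ?L (\<lambda>x. 1::real) = l" using l by (subst lebesgue_on_Ioo_integral) auto
  also have "(N * l + integral\<^sup>L ?L (\<lambda>x. (v x)\<^sup>2) / N) / 2 \<le> (N * l + N\<^sup>2 / N) / 2"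
    using N by (intro divide_right_mono add_left_mono) auto
  also have "\<dots> = (l + 1) * N / 2" using N by (simp add: power2_eq_square algebra_simps)
  finally have "\<bar>integral {0..l} (\<lambda>x. g x * sin (freq l k * x))\<bar> \<le> (l + 1) * N / 2 / (freq l k)\<^sup>2"
    using freq_pos[OF l, of k] by (simp add: field_simps)
  then have "2 / l * \<bar>integral {0..l} (\<lambda>x. g x * sin (freq l k * x))\<bar> \<le> 2 / l * ((l + 1) * N / 2 / (freq l k)\<^sup>2)"
    using l by (intro mult_left_mono) auto
  also have "\<dots> = (l + 1) * l / pi\<^sup>2 * N / (real (Suc k))\<^sup>2"
    using l by (simp add: freq_def power_divide power_mult_distrib power2_eq_square field_simps del: of_nat_Suc)
  finally show ?thesis using l by (simp add: sine_coeff_def abs_mult)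
qed

section \<open>Sine coefficients of the source term\<close>

lemma L2_on_diff:
  assumes "v \<in> L2_on l" "w \<in> L2_on l"
  shows "(\<lambda>x. v x - w x) \<in> L2_on l"
proof -
  let ?L = "lebesgue_on {0<..<l}"
  have m: "v \<in> borel_measurable ?L" "w \<in> borel_measurable ?L"
    and i: "integrable ?L (\<lambda>x. (v x)\<^sup>2)" "integrable ?L (\<lambda>x. (w x)\<^sup>2)" using assms by (auto simp: L2_on_def)
  have "integrable ?L (\<lambda>x. 2 * (v x)\<^sup>2 + 2 * (w x)\<^sup>2)" using i by auto
  then have "integrable ?L (\<lambda>x. (v x - w x)\<^sup>2)"
  proof (rule Bochner_Integration.integrable_bound)
    show "AE x in ?L. norm ((v x - w x)\<^sup>2) \<le> norm (2 * (v x)\<^sup>2 + 2 * (w x)\<^sup>2)"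
    proof (intro AE_I2)
      fix x
      have "0 \<le> (v x + w x)\<^sup>2" by simp
      then have "(v x - w x)\<^sup>2 \<le> 2 * (v x)\<^sup>2 + 2 * (w x)\<^sup>2" by (simp add: power2_sum power2_diff)
      then show "norm ((v x - w x)\<^sup>2) \<le> norm (2 * (v x)\<^sup>2 + 2 * (w x)\<^sup>2)" by simp
    qed
  qed (use m in measurable)
  then show ?thesis using m by (auto simp: L2_on_def)
qed

lemma test_function_derivs_continuous:
  assumes "\<psi> \<in> test_functions l"
  shows "continuous_on A ((deriv ^^ j) \<psi>)"
proof -
  have "smooth \<psi>" using assms by (simp add: test_functions_def smooth_def)
  then have "smooth ((deriv ^^ j) \<psi>)" by (induction j) (auto intro: smooth_deriv)
  then show ?thesis by (rule smooth_continuous_on)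
qed

lemma has_weak_deriv_diff:
  assumes g: "continuous_on {0..l} g" "continuous_on {0..l} h"
    and v: "has_weak_deriv l j g v" "has_weak_deriv l j h w"
  shows "has_weak_deriv l j (\<lambda>x. g x - h x) (\<lambda>x. v x - w x)"
  unfolding has_weak_deriv_def
proof (intro conjI ballI)
  let ?L = "lebesgue_on {0<..<l}"
  have L: "v \<in> L2_on l" "w \<in> L2_on l" using v by (auto simp: has_weak_deriv_def)
  then show "(\<lambda>x. v x - w x) \<in> L2_on l" by (rule L2_on_diff)
  fix \<psi> assume \<psi>: "\<psi> \<in> test_functions l"
  have c: "continuous_on {0..l} ((deriv ^^ j) \<psi>)" "continuous_on {0..l} \<psi>"
    using test_function_derivs_continuous[OF \<psi>, of _ j] test_function_derivs_continuous[OF \<psi>, of _ 0] by auto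
  have i: "integrable ?L (\<lambda>x. g x * (deriv ^^ j) \<psi> x)" "integrable ?L (\<lambda>x. h x * (deriv ^^ j) \<psi> x)"
    "integrable ?L (\<lambda>x. v x * \<psi> x)" "integrable ?L (\<lambda>x. w x * \<psi> x)"
    by (intro integrable_lebesgue_on_Ioo_continuous L2_on_integrable_mult continuous_on_mult g c L)+
  have "integral\<^sup>L ?L (\<lambda>x. g x * (deriv ^^ j) \<psi> x) = (-1) ^ j * integral\<^sup>L ?L (\<lambda>x. v x * \<psi> x)"
    "integral\<^sup>L ?L (\<lambda>x. h x * (deriv ^^ j) \<psi> x) = (-1) ^ j * integral\<^sup>L ?L (\<lambda>x. w x * \<psi> x)"
    using v \<psi> by (auto simp: has_weak_deriv_def)
  then show "integral\<^sup>L ?L (\<lambda>x. (g x - h x) * (deriv ^^ j) \<psi> x) = (-1) ^ j * integral\<^sup>L ?L (\<lambda>x. (v x - w x) * \<psi> x)"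
    using i by (simp add: left_diff_distrib right_diff_distrib)
qed

text \<open>Where some weak derivative exists, the one selected by \<open>weak_deriv\<close> is
  genuine, and it is this representative that the norm controls.\<close>

lemma weak_deriv_L2_le_sobolev_norm:
  assumes "\<exists>v. has_weak_deriv l j g v" "j \<le> m"
  shows "has_weak_deriv l j g (weak_deriv l j g)"
    "integral\<^sup>L (lebesgue_on {0<..<l}) (\<lambda>x. (weak_deriv l j g x)\<^sup>2) \<le> (sobolev_norm m l g)\<^sup>2"
proof -
  show "has_weak_deriv l j g (weak_deriv l j g)"
    unfolding weak_deriv_def using assms(1) by (rule someI_ex)
  have "integral\<^sup>L (lebesgue_on {0<..<l}) (\<lambda>x. (weak_deriv l j g x)\<^sup>2) \<le>
      (\<Sum>j\<le>m. integral\<^sup>L (lebesgue_on {0<..<l}) (\<lambda>x. (weak_deriv l j g x)\<^sup>2))"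
    using assms(2) by (intro member_le_sum) (auto intro!: integral_nonneg_AE)
  also have "\<dots> = (sobolev_norm m l g)\<^sup>2"
    unfolding sobolev_norm_def by (intro real_sqrt_pow2[symmetric] sum_nonneg integral_nonneg_AE) auto
  finally show "integral\<^sup>L (lebesgue_on {0<..<l}) (\<lambda>x. (weak_deriv l j g x)\<^sup>2) \<le> (sobolev_norm m l g)\<^sup>2" .
qed

text \<open>The constant must be uniform in k and t. Norms are taken of differences only: near each
  t the coefficients stay within a fixed multiple of 1 / k^2 of those at t, and bisection of [0, T]
  joins the local bounds. A triangle inequality for \<open>sobolev_norm\<close> is thereby
  avoided.\<close>

lemma source_sine_coeffs:
  assumes l: "0 < l" and T: "0 \<le> T" and f: "continuous_into_sobolev T m l f" and m: "2 \<le> m"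
    and fc: "\<And>t. t \<in> {0..T} \<Longrightarrow> continuous_on {0..l} (\<lambda>x. f x t)"
    and f0: "\<And>t. t \<in> {0..T} \<Longrightarrow> f 0 t = 0 \<and> f l t = 0"
  obtains K where "\<And>k t. t \<in> {0..T} \<Longrightarrow> \<bar>sine_coeff l (\<lambda>x. f x t) k\<bar> \<le> K / (real (Suc k))\<^sup>2"
    "\<And>k. continuous_on {0..T} (\<lambda>t. sine_coeff l (\<lambda>x. f x t) k)"
proof -
  define F where "F k t = sine_coeff l (\<lambda>x. f x t) k" for k t
  define B where "B = (l + 1) * l / pi\<^sup>2"
  have B: "B > 0" using l by (simp add: B_def)
  have ex: "\<exists>v. has_weak_deriv l 2 (\<lambda>x. f x t) v" if "t \<in> {0..T}" for t
    using f m that by (auto simp: continuous_into_sobolev_def sobolev_W2_def)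
  have diff: "\<bar>F k s - F k t\<bar> \<le> B * N / (real (Suc k))\<^sup>2"
    if st: "s \<in> {0..T}" "t \<in> {0..T}" and N: "sobolev_norm m l (\<lambda>x. f x s - f x t) \<le> N" "0 < N" for k s t N
  proof -
    let ?d = "\<lambda>x. f x s - f x t"
    have "\<exists>v. has_weak_deriv l 2 ?d v"
      using ex[OF st(1)] ex[OF st(2)] has_weak_deriv_diff[OF fc[OF st(1)] fc[OF st(2)]] by blast
    note w = weak_deriv_L2_le_sobolev_norm[OF this m]
    have "0 \<le> sobolev_norm m l ?d" unfolding sobolev_norm_def by (intro real_sqrt_ge_zero sum_nonneg integral_nonneg_AE) auto
    then have "(sobolev_norm m l ?d)\<^sup>2 \<le> N\<^sup>2" using N by (intro power_mono) auto
    then have "\<bar>sine_coeff l ?d k\<bar> \<le> (l + 1) * l / pi\<^sup>2 * N / (real (Suc k))\<^sup>2"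
      using w(2) f0 st N by (intro sine_coeff_weak_deriv_2_bound[OF l _ _ _ w(1)] continuous_intros fc) auto
    moreover have "sine_coeff l ?d k = F k s - F k t"
    proof -
      have "integral {0..l} (\<lambda>x. f x s * sin (freq l k * x) - f x t * sin (freq l k * x)) =
        integral {0..l} (\<lambda>x. f x s * sin (freq l k * x)) - integral {0..l} (\<lambda>x. f x t * sin (freq l k * x))"
        by (intro Henstock_Kurzweil_Integration.integral_diff integrable_continuous_interval continuous_intros fc st)
      then show ?thesis by (simp add: F_def sine_coeff_def left_diff_distrib right_diff_distrib)
    qed
    ultimately show ?thesis by (simp add: B_def)
  qed
  have near: "\<exists>d>0. \<forall>s\<in>{0..T}. \<bar>s - t\<bar> < d \<longrightarrow> (\<forall>k. \<bar>F k s - F k t\<bar> \<le> B * N / (real (Suc k))\<^sup>2)"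
    if t: "t \<in> {0..T}" and N: "0 < N" for t N
  proof -
    have "((\<lambda>s. sobolev_norm m l (\<lambda>x. f x s - f x t)) \<longlongrightarrow> 0) (at t within {0..T})"
      using f t by (auto simp: continuous_into_sobolev_def)
    from order_tendstoD(2)[OF this N] obtain d where d: "d > 0"
      "\<And>s. s \<in> {0..T} \<Longrightarrow> s \<noteq> t \<Longrightarrow> \<bar>s - t\<bar> < d \<Longrightarrow> sobolev_norm m l (\<lambda>x. f x s - f x t) < N"
      unfolding eventually_at dist_real_def by blast
    have "\<bar>F k s - F k t\<bar> \<le> B * N / (real (Suc k))\<^sup>2" if "s \<in> {0..T}" "\<bar>s - t\<bar> < d" for s k
    proof (cases "s = t")
      case True
      then show ?thesis using B N by simp
    next
      case False
      then show ?thesis using diff[OF that(1) t less_imp_le[OF d(2)] N] that by auto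
    qed
    then show ?thesis using d(1) by blast
  qed
  have pt: "\<exists>K. \<forall>k. \<bar>F k t\<bar> \<le> K / (real (Suc k))\<^sup>2" if t: "t \<in> {0..T}" for t
  proof -
    obtain v where v: "has_weak_deriv l 2 (\<lambda>x. f x t) v" using ex[OF t] by blast
    define I where "I = integral\<^sup>L (lebesgue_on {0<..<l}) (\<lambda>x. (v x)\<^sup>2)"
    have "0 \<le> I" unfolding I_def by (intro integral_nonneg_AE) auto
    \<comment> \<open>The number I + 1 serves as \<open>N\<close>: it is positive and its square
      dominates I, without a root being taken.\<close>
    then have "I \<le> (I + 1)\<^sup>2" "0 < I + 1" by (auto simp: power2_eq_square algebra_simps)
    then have "\<bar>F k t\<bar> \<le> B * (I + 1) / (real (Suc k))\<^sup>2" for k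
      unfolding F_def B_def using f0[OF t]
      by (intro sine_coeff_weak_deriv_2_bound[OF l fc[OF t] _ _ v]) (auto simp: I_def)
    then show ?thesis by blast
  qed
  define P where "P a b \<longleftrightarrow> (\<exists>K. \<forall>s\<in>{a..b}. \<forall>k. \<bar>F k s\<bar> \<le> K / (real (Suc k))\<^sup>2)" for a b
  have mono: "K / (real (Suc k))\<^sup>2 \<le> L / (real (Suc k))\<^sup>2" if "K \<le> L" for K L :: real and k :: nat
    using that by (intro divide_right_mono) auto
  \<comment> \<open>\<open>Bolzano\<close> asks for the local property on all short intervals around
    t, also on those leaving [0, T]; the guards in \<open>P'\<close> make these trivial.\<close>
  have "P' 0 T" if P': "P' = (\<lambda>a b. 0 \<le> a \<longrightarrow> b \<le> T \<longrightarrow> P a b)" for P'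
    using T
  proof (induction rule: Bolzano)
    case (trans a b c)
    show ?case unfolding P'
    proof (intro impI)
      assume "0 \<le> a" "c \<le> T"
      then obtain K L where "\<forall>s\<in>{a..b}. \<forall>k. \<bar>F k s\<bar> \<le> K / (real (Suc k))\<^sup>2" "\<forall>s\<in>{b..c}. \<forall>k. \<bar>F k s\<bar> \<le> L / (real (Suc k))\<^sup>2"
        using trans unfolding P' P_def by auto
      then have "\<forall>s\<in>{a..c}. \<forall>k. \<bar>F k s\<bar> \<le> max K L / (real (Suc k))\<^sup>2"
        using mono[of K "max K L"] mono[of L "max K L"] by (metis atLeastAtMost_iff linear max.cobounded1 max.cobounded2 order_trans)
      then show "P a c" unfolding P_def by blast
    qed
  next
    case (local t)
    then have t: "t \<in> {0..T}" by auto
    obtain d where d: "d > 0" "\<forall>s\<in>{0..T}. \<bar>s - t\<bar> < d \<longrightarrow> (\<forall>k. \<bar>F k s - F k t\<bar> \<le> B * 1 / (real (Suc k))\<^sup>2)"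
      using near[OF t zero_less_one] by blast
    obtain K where K: "\<forall>k. \<bar>F k t\<bar> \<le> K / (real (Suc k))\<^sup>2" using pt[OF t] by blast
    show ?case
    proof (intro exI[of _ d] conjI allI impI d(1))
      fix a b assume ab: "a \<le> t \<and> t \<le> b \<and> b - a < d"
      show "P' a b" unfolding P' P_def
      proof (intro impI exI[of _ "K + B"] ballI allI)
        fix s k assume "0 \<le> a" "b \<le> T" "s \<in> {a..b}"
        then have "\<bar>F k s - F k t\<bar> \<le> B * 1 / (real (Suc k))\<^sup>2" using d(2) ab by auto
        moreover have "\<bar>F k t\<bar> \<le> K / (real (Suc k))\<^sup>2" using K by blast
        ultimately show "\<bar>F k s\<bar> \<le> (K + B) / (real (Suc k))\<^sup>2" unfolding add_divide_distrib by linarith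
      qed
    qed
  qed
  then have "P 0 T" by auto
  then obtain K where K: "\<And>s k. s \<in> {0..T} \<Longrightarrow> \<bar>F k s\<bar> \<le> K / (real (Suc k))\<^sup>2" unfolding P_def by blast
  have "continuous_on {0..T} (F k)" for k
    unfolding continuous_on_iff
  proof (intro ballI allI impI)
    fix t e :: real assume t: "t \<in> {0..T}" and e: "0 < e"
    obtain d where d: "d > 0" "\<forall>s\<in>{0..T}. \<bar>s - t\<bar> < d \<longrightarrow> (\<forall>k. \<bar>F k s - F k t\<bar> \<le> B * (e / (2 * B)) / (real (Suc k))\<^sup>2)"
      using near[OF t, of "e / (2 * B)"] e B by auto
    have "B * (e / (2 * B)) / (real (Suc k))\<^sup>2 \<le> B * (e / (2 * B)) / 1"
      using B e one_le_power[of "real (Suc k)" 2] by (intro divide_left_mono) auto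
    also have "\<dots> < e" using B e by simp
    finally show "\<exists>d>0. \<forall>s\<in>{0..T}. dist s t < d \<longrightarrow> dist (F k s) (F k t) < e"
      using d unfolding dist_real_def by (meson le_less_trans)
  qed
  then show ?thesis using K by (intro that[of K]) (simp_all add: F_def[abs_def])
qed

section \<open>Uniqueness\<close>

text \<open>If D were positive, p' would be positive just to the right of its zero x, and p would
  rise above its maximum.\<close>

lemma second_deriv_nonpos_at_max:
  fixes p p' :: "real \<Rightarrow> real"
  assumes x: "x \<in> {a<..<b}"
    and p: "\<And>y. y \<in> {a..b} \<Longrightarrow> (p has_real_derivative p' y) (at y within {a..b})"
    and p': "(p' has_real_derivative D) (at x within {a..b})"
    and max: "\<And>y. y \<in> {a..b} \<Longrightarrow> p y \<le> p x"
  shows "D \<le> 0"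
proof (rule ccontr)
  assume "\<not> D \<le> 0"
  then have D: "D > 0" by simp
  have at: "at y within {a..b} = at y" if "y \<in> {a<..<b}" for y
    using that by (intro at_within_Icc_at) auto
  have dp: "(p has_real_derivative p' y) (at y)" if "y \<in> {a<..<b}" for y
    using p[of y] that by (simp add: at)
  have zero: "p' x = 0"
  proof (rule DERIV_local_max[OF dp[OF x], of "min (x - a) (b - x)"])
    show "0 < min (x - a) (b - x)" using x by auto
    show "\<forall>y. \<bar>x - y\<bar> < min (x - a) (b - x) \<longrightarrow> p y \<le> p x"
      using max by (auto simp: abs_less_iff)
  qed
  have "(p' has_real_derivative D) (at x)" using p' at[OF x] by simp
  from DERIV_pos_inc_right[OF this D] obtain d where d: "d > 0" "\<And>h. 0 < h \<Longrightarrow> h < d \<Longrightarrow> p' x < p' (x + h)"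
    by blast
  define h where "h = min d (b - x) / 2"
  have h: "0 < h" "h < d" "x + h < b" using d x by (auto simp: h_def min_def field_simps)
  have "p x < p (x + h)"
  proof (rule DERIV_pos_imp_increasing_open[of x "x + h" p])
    fix y assume y: "x < y" "y < x + h"
    then have "p' y > 0" using d(2)[of "y - x"] h zero by auto
    then show "\<exists>z. (p has_real_derivative z) (at y) \<and> 0 < z" using dp[of y] y x h by auto
  next
    show "continuous_on {x..x + h} p"
      by (intro continuous_at_imp_continuous_on ballI, rule DERIV_isCont[OF dp]) (use x h in auto)
  qed (use h in auto)
  then show False using max[of "x + h"] x h by auto
qed

text \<open>One inequality is enough, as u and v may be exchanged. With \<psi> = cos (r * (x - l /
  2)) one has \<psi>'' = - r^2 \<psi>. At a positive maximum of (v - u) / \<psi> this yields (v -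
  u)_xx <= - r^2 (v - u), so diffusion adds at least m * r^2 to the zeroth order coefficient and
  outweighs a negative \<open>q\<close>.\<close>

lemma classical_solution_le:
  fixes \<sigma> q \<phi> :: "real \<Rightarrow> real" and f u v :: "real \<Rightarrow> real \<Rightarrow> real"
  assumes \<rho>: "0 < \<rho>" "\<rho> < 1" and l: "l > 0" and T: "T > 0"
    and m: "0 < m" and \<sigma>: "\<And>t. t \<in> {0..T} \<Longrightarrow> m \<le> \<sigma> t"
    and nq: "- (m * pi\<^sup>2 / l\<^sup>2) < n" and q: "\<And>t. t \<in> {0..T} \<Longrightarrow> n \<le> q t"
    and u: "classical_solution \<rho> l T \<sigma> q f \<phi> u" and v: "classical_solution \<rho> l T \<sigma> q f \<phi> v"
    and x: "x \<in> {0..l}" and t: "t \<in> {0..T}"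
  shows "v x t \<le> u x t"
proof (rule ccontr)
  assume neg: "\<not> v x t \<le> u x t"
  \<comment> \<open>At r = pi / l the sum m * r^2 + n is positive by \<open>nq\<close>, but \<psi>
    would vanish at both ends. A slightly smaller r keeps the sum positive and makes \<psi> positive
    on the closed interval.\<close>
  obtain r where r: "0 < r" "r < pi / l" "0 < m * r\<^sup>2 + n"
  proof -
    have "((\<lambda>r. m * r\<^sup>2 + n) \<longlongrightarrow> m * (pi / l)\<^sup>2 + n) (at_left (pi / l))"
      by (intro tendsto_intros)
    moreover have "0 < m * (pi / l)\<^sup>2 + n" using nq by (simp add: power_divide)
    ultimately have "eventually (\<lambda>r. 0 < m * r\<^sup>2 + n) (at_left (pi / l))" by (rule order_tendstoD)
    moreover have "eventually (\<lambda>r. r \<in> {0<..<pi / l}) (at_left (pi / l))"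
      using l by (intro eventually_at_left_real) auto
    ultimately have "eventually (\<lambda>r. 0 < r \<and> r < pi / l \<and> 0 < m * r\<^sup>2 + n) (at_left (pi / l))"
      by eventually_elim auto
    then show ?thesis using that eventually_happens'[OF trivial_limit_at_left_real] by blast
  qed
  obtain Du ux uxx where U: "\<And>x t. x \<in> {0..l} \<Longrightarrow> t \<in> {0<..T} \<Longrightarrow> has_caputo_deriv \<rho> (u x) t (Du x t)"
    "\<And>x t. x \<in> {0..l} \<Longrightarrow> t \<in> {0<..T} \<Longrightarrow> ((\<lambda>y. u y t) has_real_derivative ux x t) (at x within {0..l})"
    "\<And>x t. x \<in> {0..l} \<Longrightarrow> t \<in> {0<..T} \<Longrightarrow> ((\<lambda>y. ux y t) has_real_derivative uxx x t) (at x within {0..l})"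
    "\<And>x t. x \<in> {0<..<l} \<Longrightarrow> t \<in> {0<..T} \<Longrightarrow> Du x t - \<sigma> t * uxx x t + q t * u x t = f x t"
    using u unfolding classical_solution_def by blast
  obtain Dv vx vxx where V: "\<And>x t. x \<in> {0..l} \<Longrightarrow> t \<in> {0<..T} \<Longrightarrow> has_caputo_deriv \<rho> (v x) t (Dv x t)"
    "\<And>x t. x \<in> {0..l} \<Longrightarrow> t \<in> {0<..T} \<Longrightarrow> ((\<lambda>y. v y t) has_real_derivative vx x t) (at x within {0..l})"
    "\<And>x t. x \<in> {0..l} \<Longrightarrow> t \<in> {0<..T} \<Longrightarrow> ((\<lambda>y. vx y t) has_real_derivative vxx x t) (at x within {0..l})"
    "\<And>x t. x \<in> {0<..<l} \<Longrightarrow> t \<in> {0<..T} \<Longrightarrow> Dv x t - \<sigma> t * vxx x t + q t * v x t = f x t"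
    using v unfolding classical_solution_def by blast
  have c: "continuous_on ({0..l} \<times> {0..T}) (\<lambda>z. u (fst z) (snd z))"
    "continuous_on ({0..l} \<times> {0..T}) (\<lambda>z. v (fst z) (snd z))"
    using u v by (auto simp: classical_solution_def case_prod_unfold)
  define \<psi> where "\<psi> x = cos (r * (x - l / 2))" for x
  have \<psi>: "\<psi> x > 0" if "x \<in> {0..l}" for x
  proof -
    have h: "\<bar>x - l / 2\<bar> \<le> l / 2" using that by (simp add: abs_if)
    have "\<bar>r * (x - l / 2)\<bar> = r * \<bar>x - l / 2\<bar>" using r by (simp add: abs_mult)
    also have "\<dots> \<le> r * (l / 2)" using h r by (intro mult_left_mono) auto
    also have "\<dots> < (pi / l) * (l / 2)" using r l by (intro mult_strict_right_mono) auto
    also have "\<dots> = pi / 2" using l by simp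
    finally show ?thesis unfolding \<psi>_def by (intro cos_gt_zero_pi) (auto simp: abs_less_iff)
  qed
  let ?z = "\<lambda>z. (v (fst z) (snd z) - u (fst z) (snd z)) / \<psi> (fst z)"
  have "continuous_on ({0..l} \<times> {0..T}) (\<lambda>z. \<psi> (fst z))"
    unfolding \<psi>_def by (intro continuous_intros)
  moreover have "\<forall>z\<in>{0..l} \<times> {0..T}. \<psi> (fst z) \<noteq> 0" using \<psi> by fastforce
  ultimately have "continuous_on ({0..l} \<times> {0..T}) ?z"
    by (intro continuous_on_divide continuous_on_diff c) auto
  moreover have "compact ({0..l} \<times> {0..T})" by (intro compact_Times) auto
  ultimately obtain z where z: "z \<in> {0..l} \<times> {0..T}" "\<And>z'. z' \<in> {0..l} \<times> {0..T} \<Longrightarrow> ?z z' \<le> ?z z"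
    using continuous_attains_sup[of "{0..l} \<times> {0..T}" ?z] l T by auto
  obtain y s where ys: "z = (y, s)" by (cases z)
  have y: "y \<in> {0..l}" and s: "s \<in> {0..T}" using z(1) ys by auto
  \<comment> \<open>The quotient only locates the touching point: v - u lies below M * \<psi> with
    equality at (y, s), so no quotient has to be differentiated.\<close>
  define M where "M = (v y s - u y s) / \<psi> y"
  have le: "v x' t' - u x' t' \<le> M * \<psi> x'" if "x' \<in> {0..l}" "t' \<in> {0..T}" for x' t'
    using z(2)[of "(x', t')"] that \<psi>[OF that(1)] by (simp add: ys M_def pos_divide_le_eq)
  have "0 < M * \<psi> x" using le[OF x t] neg by linarith
  then have M: "M > 0" using \<psi>[OF x] by (simp add: zero_less_mult_iff)
  have ev: "v y s - u y s = M * \<psi> y" using \<psi>[OF y] by (simp add: M_def)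
  then have pos: "v y s - u y s > 0" using M \<psi>[OF y] by simp
  have s0: "s \<in> {0<..T}"
  proof (rule ccontr)
    assume "s \<notin> {0<..T}"
    then have "s = 0" using s by auto
    then show False using pos u v y by (auto simp: classical_solution_def)
  qed
  have y0: "y \<in> {0<..<l}"
  proof (rule ccontr)
    assume "y \<notin> {0<..<l}"
    then have "y = 0 \<or> y = l" using y by auto
    then show False using pos u v s by (auto simp: classical_solution_def)
  qed
  have "vxx y s - uxx y s + M * r\<^sup>2 * \<psi> y \<le> 0"
  proof (rule second_deriv_nonpos_at_max[OF y0])
    show "((\<lambda>x. v x s - u x s - M * \<psi> x) has_real_derivative vx x' s - ux x' s + M * r * sin (r * (x' - l / 2))) (at x' within {0..l})"
      if "x' \<in> {0..l}" for x'
      unfolding \<psi>_def using U(2)[OF that s0] V(2)[OF that s0] by (auto intro!: derivative_eq_intros)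
    show "((\<lambda>x'. vx x' s - ux x' s + M * r * sin (r * (x' - l / 2))) has_real_derivative vxx y s - uxx y s + M * r\<^sup>2 * \<psi> y) (at y within {0..l})"
      unfolding \<psi>_def using U(3)[OF y s0] V(3)[OF y s0]
      by (auto intro!: derivative_eq_intros simp: power2_eq_square)
    show "v x' s - u x' s - M * \<psi> x' \<le> v y s - u y s - M * \<psi> y" if "x' \<in> {0..l}" for x'
      using le[OF that s] ev by simp
  qed
  then have xx: "vxx y s - uxx y s \<le> - (r\<^sup>2 * (v y s - u y s))" using ev by (simp add: mult_ac)
  have cs: "continuous_on {0..s} (u y)" "continuous_on {0..s} (v y)"
  proof -
    have "continuous_on {0..s} (\<lambda>t. (y, t))" "(\<lambda>t. (y, t)) ` {0..s} \<subseteq> {0..l} \<times> {0..T}"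
      using y s by (auto intro!: continuous_intros)
    from continuous_on_compose2[OF c(1) this] continuous_on_compose2[OF c(2) this]
    show "continuous_on {0..s} (u y)" "continuous_on {0..s} (v y)" by simp_all
  qed
  \<comment> \<open>At fixed y the factor \<psi> is a constant, so v - u itself is maximal over
    [0, s] at time s.\<close>
  have "has_caputo_deriv \<rho> (\<lambda>t. 1 * v y t + (-1) * u y t) s (1 * Dv y s + (-1) * Du y s)"
    using s0 by (intro has_caputo_deriv_linear cs U V y) auto
  then have "0 \<le> 1 * Dv y s + (-1) * Du y s"
  proof (rule has_caputo_deriv_nonneg_at_max[OF \<rho>, rotated 3])
    show "1 * v y t' + (-1) * u y t' \<le> 1 * v y s + (-1) * u y s" if "t' \<in> {0..s}" for t'
      using le[OF y, of t'] that s ev by simp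
  qed (use s0 cs in \<open>auto intro!: continuous_intros\<close>)
  moreover have "Dv y s - Du y s = \<sigma> s * (vxx y s - uxx y s) - q s * (v y s - u y s)"
    using U(4)[OF y0 s0] V(4)[OF y0 s0] by (simp add: algebra_simps)
  moreover have "\<sigma> s * (vxx y s - uxx y s) \<le> \<sigma> s * (- (r\<^sup>2 * (v y s - u y s)))"
    using xx \<sigma>[OF s] m by (intro mult_left_mono) auto
  moreover have "m * r\<^sup>2 * (v y s - u y s) \<le> \<sigma> s * r\<^sup>2 * (v y s - u y s)"
    using \<sigma>[OF s] pos by (intro mult_right_mono) auto
  moreover have "n * (v y s - u y s) \<le> q s * (v y s - u y s)"
    using q[OF s] pos by (intro mult_right_mono) auto
  moreover have "0 < (m * r\<^sup>2 + n) * (v y s - u y s)" using r pos by simp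
  ultimately show False by (simp add: algebra_simps)
qed

section \<open>Existence\<close>

lemma summable_M_test:
  fixes g :: "nat \<Rightarrow> real"
  assumes "\<And>k. \<bar>g k\<bar> \<le> M k" "summable M"
  shows "summable g"
  using assms by (intro summable_comparison_test'[OF assms(2), of 0]) auto

lemma continuous_on_suminf:
  fixes g :: "nat \<Rightarrow> 'a::topological_space \<Rightarrow> real"
  assumes "\<And>k. continuous_on S (g k)" "\<And>k x. x \<in> S \<Longrightarrow> \<bar>g k x\<bar> \<le> M k" "summable M"
  shows "continuous_on S (\<lambda>x. \<Sum>k. g k x)"
proof (rule uniform_limit_theorem)
  show "uniform_limit S (\<lambda>n x. \<Sum>k<n. g k x) (\<lambda>x. \<Sum>k. g k x) sequentially"
    using assms by (intro Weierstrass_m_test) auto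
qed (auto intro!: always_eventually continuous_on_sum assms)

lemma has_real_derivative_suminf:
  fixes g g' :: "nat \<Rightarrow> real \<Rightarrow> real"
  assumes S: "convex S" and d: "\<And>k x. x \<in> S \<Longrightarrow> (g k has_real_derivative g' k x) (at x within S)"
    and g': "\<And>k x. x \<in> S \<Longrightarrow> \<bar>g' k x\<bar> \<le> M k" "summable M"
    and g: "\<And>x. x \<in> S \<Longrightarrow> summable (\<lambda>k. g k x)" and x: "x \<in> S"
  shows "((\<lambda>x. \<Sum>k. g k x) has_real_derivative (\<Sum>k. g' k x)) (at x within S)"
proof -
  have "uniform_limit S (\<lambda>n x. \<Sum>k<n. g' k x) (\<lambda>x. \<Sum>k. g' k x) sequentially"
    using g' by (intro Weierstrass_m_test) auto
  from has_field_derivative_series[OF S d this x g[OF x]] obtain G where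
    G: "\<forall>x\<in>S. (\<lambda>k. g k x) sums G x \<and> (G has_real_derivative (\<Sum>k. g' k x)) (at x within S)" by blast
  have eq: "G y = (\<Sum>k. g k y)" if "y \<in> S" for y using G that by (simp add: sums_iff)
  have "(G has_real_derivative (\<Sum>k. g' k x)) (at x within S)" using G x by blast
  then show ?thesis
    by (rule has_field_derivative_transform_within[OF _ zero_less_one x eq])
qed

text \<open>For fixed s < t the kernel is bounded on [0, s], so a summable majorant of the terms
  suffices. The singular limit s -> t is a separate matter.\<close>

lemma caputo_trunc_sums:
  assumes st: "0 < s" "s < t" and h: "\<And>k. continuous_on {0..s} (h k)"
    and b: "\<And>k x. x \<in> {0..s} \<Longrightarrow> \<bar>h k x\<bar> \<le> b k" "summable b"
  shows "(\<lambda>k. caputo_trunc \<rho> (h k) t s) sums caputo_trunc \<rho> (\<lambda>x. \<Sum>k. h k x) t s"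
proof -
  let ?K = "\<lambda>x. \<rho> * (t - x) powr (- \<rho> - 1)"
  have Kc: "continuous_on {0..s} ?K" using st by (intro continuous_intros) auto
  obtain C where C: "C > 0" "\<And>x. x \<in> {0..s} \<Longrightarrow> \<bar>?K x\<bar> \<le> C"
    using continuous_on_Icc_bounded[OF Kc] by blast
  have sm: "summable (\<lambda>k. h k x)" if "x \<in> {0..s}" for x
    using b(1)[OF that] b(2) by (rule summable_M_test)
  have "uniform_limit {0..s} (\<lambda>n x. \<Sum>k<n. ?K x * h k x) (\<lambda>x. \<Sum>k. ?K x * h k x) sequentially"
  proof (rule Weierstrass_m_test)
    show "summable (\<lambda>k. C * b k)" by (intro summable_mult b)
    show "norm (?K x * h k x) \<le> C * b k" if "x \<in> {0..s}" for k x
    proof -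
      have "\<bar>?K x\<bar> * \<bar>h k x\<bar> \<le> C * b k" using C b(1)[OF that] that by (intro mult_mono) auto
      then show ?thesis by (simp add: abs_mult)
    qed
  qed
  then obtain I J where IJ: "\<And>n. ((\<lambda>x. \<Sum>k<n. ?K x * h k x) has_integral I n) {0..s}"
    "((\<lambda>x. \<Sum>k. ?K x * h k x) has_integral J) {0..s}" "I \<longlonglongrightarrow> J"
    by (rule uniform_limit_integral) (auto intro!: continuous_on_sum continuous_on_mult[OF Kc h])
  have I: "I n = (\<Sum>k<n. integral {0..s} (\<lambda>x. ?K x * h k x))" for n
  proof (rule has_integral_unique[OF IJ(1)])
    show "((\<lambda>x. \<Sum>k<n. ?K x * h k x) has_integral (\<Sum>k<n. integral {0..s} (\<lambda>x. ?K x * h k x))) {0..s}"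
      by (intro has_integral_sum integrable_integral integrable_continuous_interval continuous_on_mult[OF Kc h]) auto
  qed
  have "((\<lambda>x. ?K x * (\<Sum>k. h k x)) has_integral J) {0..s}"
    using IJ(2) by (rule has_integral_eq[rotated]) (simp add: suminf_mult sm)
  then have J: "integral {0..s} (\<lambda>x. ?K x * (\<Sum>k. h k x)) = J" by (rule integral_unique)
  have "(\<lambda>k. integral {0..s} (\<lambda>x. ?K x * h k x)) sums integral {0..s} (\<lambda>x. ?K x * (\<Sum>k. h k x))"
    using IJ(3) unfolding sums_def J I .
  moreover have "(\<lambda>k. h k s) sums (\<Sum>k. h k s)" "(\<lambda>k. h k 0) sums (\<Sum>k. h k 0)"
    using sm st by (auto intro: summable_sums)
  ultimately show ?thesis
    unfolding caputo_trunc_def by (intro sums_diff sums_mult)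
qed

lemma freq_mono: "0 < l \<Longrightarrow> freq l 0 \<le> freq l k"
  by (simp add: freq_def divide_right_mono)

text \<open>Formulated for coefficient sequences with summable majorants, so that the Sobolev
  hypotheses enter only through summability and through the convergence of the sine series.\<close>

lemma series_classical_solution:
  fixes \<sigma> q \<phi> :: "real \<Rightarrow> real" and f :: "real \<Rightarrow> real \<Rightarrow> real"
  assumes \<rho>: "0 < \<rho>" "\<rho> < 1" and l: "l > 0" and T: "T > 0"
    and \<sigma>c: "continuous_on {0..T} \<sigma>" and m: "0 < m" "\<And>t. t \<in> {0..T} \<Longrightarrow> m \<le> \<sigma> t"
    and qc: "continuous_on {0..T} q" and n: "- (m * pi\<^sup>2 / l\<^sup>2) < n" "\<And>t. t \<in> {0..T} \<Longrightarrow> n \<le> q t"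
    and Fc: "\<And>k. continuous_on {0..T} (F k)" and K: "\<And>k t. t \<in> {0..T} \<Longrightarrow> \<bar>F k t\<bar> \<le> K k" "summable K"
    and f: "\<And>x t. x \<in> {0..l} \<Longrightarrow> t \<in> {0..T} \<Longrightarrow> (\<lambda>k. F k t * sin (freq l k * x)) sums f x t"
    and c: "summable (\<lambda>k. \<bar>c k\<bar>)"
    and \<phi>: "\<And>x. x \<in> {0..l} \<Longrightarrow> (\<lambda>k. c k * sin (freq l k * x)) sums \<phi> x"
  shows "\<exists>u. classical_solution \<rho> l T \<sigma> q f \<phi> u"
proof -
  have G: "Gamma (1 - \<rho>) > 0" using \<rho> by (auto intro!: Gamma_real_pos)
  define \<mu> where "\<mu> k = (freq l k)\<^sup>2" for k
  have \<mu>0: "0 < \<mu> 0" and \<mu>: "\<mu> 0 \<le> \<mu> k" "0 < \<mu> k" for k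
    using freq_pos[OF l, of k] freq_mono[OF l, of k] freq_pos[OF l, of 0]
    by (auto simp: \<mu>_def intro!: power_mono)
  define a where "a k t = \<sigma> t * \<mu> k + q t" for k t
  have ac: "continuous_on {0..T} (a k)" for k unfolding a_def by (intro continuous_intros \<sigma>c qc)
  \<comment> \<open>A negative bound for \<open>q\<close> is charged to the diffusion: since \<mu> k
    >= \<mu> 0, the number n is at least min n 0 / \<mu> 0 * \<mu> k. Positivity of the resulting
    factor is what the hypothesis on n provides.\<close>
  define \<alpha> where "\<alpha> = m + min n 0 / \<mu> 0"
  have \<alpha>: "\<alpha> > 0"
  proof -
    have "- (m * \<mu> 0) < min n 0" using n(1) m(1) \<mu>0 mult_pos_pos[OF m(1) \<mu>0] by (auto simp: \<mu>_def freq_def power_divide min_def)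
    then have "- m < min n 0 / \<mu> 0" using \<mu>0 by (subst pos_less_divide_eq) auto
    then show ?thesis by (simp add: \<alpha>_def)
  qed
  have a_lower: "\<alpha> * \<mu> k \<le> a k t" if t: "t \<in> {0..T}" for k t
  proof -
    have "min n 0 / \<mu> 0 * \<mu> k \<le> min n 0 / \<mu> 0 * \<mu> 0"
      using \<mu>(1) \<mu>0 by (intro mult_left_mono_neg) (auto simp: divide_nonpos_pos)
    also have "\<dots> \<le> n" using \<mu>0 by simp
    also have "\<dots> \<le> q t" by (rule n(2)[OF t])
    finally have "min n 0 / \<mu> 0 * \<mu> k \<le> q t" .
    moreover have "m * \<mu> k \<le> \<sigma> t * \<mu> k" using m(2)[OF t] \<mu>(2)[of k] by (intro mult_right_mono) auto
    ultimately show ?thesis by (simp add: \<alpha>_def a_def distrib_right)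
  qed
  obtain A where A: "A > 0" "\<And>k t. t \<in> {0..T} \<Longrightarrow> \<bar>a k t\<bar> \<le> A * \<mu> k"
  proof -
    obtain A1 where A1: "A1 > 0" "\<And>t. t \<in> {0..T} \<Longrightarrow> \<bar>\<sigma> t\<bar> \<le> A1" using continuous_on_Icc_bounded[OF \<sigma>c] by blast
    obtain A2 where A2: "A2 > 0" "\<And>t. t \<in> {0..T} \<Longrightarrow> \<bar>q t\<bar> \<le> A2" using continuous_on_Icc_bounded[OF qc] by blast
    show ?thesis
    proof (rule that[of "A1 + A2 / \<mu> 0"])
      fix k t assume t: "t \<in> {0..T}"
      have "\<bar>a k t\<bar> \<le> \<bar>\<sigma> t\<bar> * \<mu> k + \<bar>q t\<bar>" using abs_triangle_ineq[of "\<sigma> t * \<mu> k" "q t"] \<mu>(2)[of k] by (simp add: a_def abs_mult)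
      also have "\<dots> \<le> A1 * \<mu> k + A2 / \<mu> 0 * \<mu> 0"
        using A1 A2 t \<mu>(2)[of k] \<mu>0 by (intro add_mono mult_right_mono) auto
      also have "\<dots> \<le> A1 * \<mu> k + A2 / \<mu> 0 * \<mu> k"
        using \<mu>(1) \<mu>0 A2(1) by (intro add_left_mono mult_left_mono) auto
      finally show "\<bar>a k t\<bar> \<le> (A1 + A2 / \<mu> 0) * \<mu> k" by (simp add: distrib_right)
    qed (use A1 A2 \<mu>0 in \<open>auto intro!: add_pos_pos\<close>)
  qed
  have "\<exists>w. continuous_on {0..T} w \<and> (\<forall>t\<in>{0..T}. w t = F k t - a k t * (c k + abel \<rho> w t))" for k
    using abel_volterra_solution[OF \<rho> T ac Fc] by metis
  then obtain w where w: "\<And>k. continuous_on {0..T} (w k)"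
    "\<And>k t. t \<in> {0..T} \<Longrightarrow> w k t = F k t - a k t * (c k + abel \<rho> (w k) t)" by metis
  define h where "h k t = c k + abel \<rho> (w k) t" for k t
  have hc: "continuous_on {0..T} (h k)" for k
    unfolding h_def by (intro continuous_intros continuous_on_abel \<rho> w)
  have h0: "h k 0 = c k" for k by (simp add: h_def)
  have hw: "has_caputo_deriv \<rho> (h k) t (w k t)" if "t \<in> {0<..T}" for k t
    unfolding h_def using that
    by (intro has_caputo_deriv_const_plus_abel \<rho> continuous_on_subset[OF w(1)]) auto
  define \<epsilon> where "\<epsilon> = (1 - \<rho>) * Gamma (1 - \<rho>) / 2 powr \<rho>"
  have \<epsilon>: "\<epsilon> > 0" using \<rho> G by (simp add: \<epsilon>_def)
  have K0: "0 \<le> K k" for k using K(1)[of 0 k] T by (auto intro: order_trans[OF abs_ge_zero])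
  have decay: "\<bar>h k t\<bar> \<le> \<bar>c k\<bar> * (1 / (1 + \<alpha> * \<mu> k * \<epsilon> * t powr \<rho>)) + K k / (\<alpha> * \<mu> k)" if t: "t \<in> {0..T}" for k t
    unfolding \<epsilon>_def h0[of k, symmetric]
  proof (rule caputo_decay[OF \<rho> hc, of _ "F k" "a k"])
    show "has_caputo_deriv \<rho> (h k) t (F k t - a k t * h k t)" if "t \<in> {0<..T}" for t
      using hw[OF that, of k] w(2)[of t k] that by (simp add: h_def)
  qed (use \<alpha> \<mu>(2)[of k] a_lower K K0 t in auto)
  \<comment> \<open>Majorant on all of [0, T], obtained by bounding the barrier by 1; it makes
    \<open>u\<close> continuous down to t = 0.\<close>
  define b where "b k = \<bar>c k\<bar> + K k / (\<alpha> * \<mu> 0)" for k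
  have b: "summable b" unfolding b_def by (intro summable_add c summable_divide K)
  have hb: "\<bar>h k t\<bar> \<le> b k" if t: "t \<in> {0..T}" for k t
  proof -
    have "\<bar>c k\<bar> * (1 / (1 + \<alpha> * \<mu> k * \<epsilon> * t powr \<rho>)) \<le> \<bar>c k\<bar> * 1"
      using \<alpha> \<mu>(2)[of k] \<epsilon> by (intro mult_left_mono) (auto simp: divide_le_eq_1 add_pos_nonneg)
    moreover have "K k / (\<alpha> * \<mu> k) \<le> K k / (\<alpha> * \<mu> 0)"
      using K0 \<alpha> \<mu>(1)[of k] \<mu>0 by (intro divide_left_mono) auto
    ultimately show ?thesis using decay[OF t, of k] by (simp add: b_def)
  qed
  \<comment> \<open>Majorant after weighting with t^\<rho>: as 1 / (1 + y) <= 1 / y, the factor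
    \<mu> k * t^\<rho> cancels against the barrier, and two x-derivatives cost no summability of
    \<open>c\<close>.\<close>
  define d where "d k = \<bar>c k\<bar> / (\<alpha> * \<epsilon>) + T powr \<rho> * K k / \<alpha>" for k
  have d: "summable d" unfolding d_def by (intro summable_add summable_divide summable_mult c K)
  have hd: "t powr \<rho> * (\<mu> k * \<bar>h k t\<bar>) \<le> d k" if t: "t \<in> {0<..T}" for k t
  proof -
    define y where "y = \<alpha> * \<mu> k * \<epsilon> * t powr \<rho>"
    have y: "y > 0" using \<alpha> \<mu>(2)[of k] \<epsilon> t by (simp add: y_def)
    have "t powr \<rho> * (\<mu> k * \<bar>h k t\<bar>) \<le> t powr \<rho> * (\<mu> k * (\<bar>c k\<bar> * (1 / (1 + y)) + K k / (\<alpha> * \<mu> k)))"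
      using decay[of t k] t \<mu>(2)[of k] by (intro mult_left_mono) (auto simp: y_def)
    also have "\<dots> \<le> t powr \<rho> * (\<mu> k * (\<bar>c k\<bar> * (1 / y) + K k / (\<alpha> * \<mu> k)))"
      using y \<mu>(2)[of k] by (intro mult_left_mono add_right_mono divide_left_mono) auto
    also have "\<dots> = \<bar>c k\<bar> / (\<alpha> * \<epsilon>) + t powr \<rho> * K k / \<alpha>"
      using \<alpha> \<mu>(2)[of k] \<epsilon> t by (simp add: y_def field_simps)
    also have "\<dots> \<le> d k" unfolding d_def
      using t \<rho> K0 \<alpha> by (intro add_left_mono divide_right_mono mult_right_mono powr_mono2) auto
    finally show ?thesis .
  qed
  define e where "e k t x = h k t * sin (freq l k * x)" for k t x
  define u where "u x t = (\<Sum>k. e k t x)" for x t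
  have sinb: "\<bar>y * sin z\<bar> \<le> B" "\<bar>y * cos z\<bar> \<le> B" if "\<bar>y\<bar> \<le> B" for y z B :: real
  proof -
    have "\<bar>y\<bar> * \<bar>sin z\<bar> \<le> B * 1" "\<bar>y\<bar> * \<bar>cos z\<bar> \<le> B * 1" using that by (intro mult_mono; simp)+
    then show "\<bar>y * sin z\<bar> \<le> B" "\<bar>y * cos z\<bar> \<le> B" by (simp_all add: abs_mult)
  qed
  have eb: "\<bar>e k t x\<bar> \<le> b k" if "t \<in> {0..T}" for k t x
    unfolding e_def by (rule sinb(1)[OF hb[OF that]])
  have es: "summable (\<lambda>k. e k t x)" if "t \<in> {0..T}" for t x
    using eb[OF that] b by (rule summable_M_test)
  have uc: "continuous_on ({0..l} \<times> {0..T}) (\<lambda>(x, t). u x t)"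
    unfolding u_def case_prod_unfold
  proof (rule continuous_on_suminf[OF _ _ b])
    show "continuous_on ({0..l} \<times> {0..T}) (\<lambda>z. e k (snd z) (fst z))" for k
      unfolding e_def by (intro continuous_intros continuous_on_compose2[OF hc]) auto
  qed (use eb in auto)
  have d': "summable (\<lambda>k. d k / (t powr \<rho> * freq l 0))" "summable (\<lambda>k. d k / t powr \<rho>)" for t
    by (intro summable_divide d)+
  have h2: "\<bar>h k t * (freq l k)\<^sup>2\<bar> \<le> d k / t powr \<rho>" if t: "t \<in> {0<..T}" for k t
    using hd[OF t, of k] t by (simp add: abs_mult \<mu>_def pos_le_divide_eq mult_ac)
  \<comment> \<open>The lowest frequency converts the majorant for two x-derivatives into one for a
    single derivative.\<close>
  have h1: "\<bar>h k t * freq l k\<bar> \<le> d k / (t powr \<rho> * freq l 0)" if t: "t \<in> {0<..T}" for k t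
  proof -
    have "\<bar>h k t * freq l k\<bar> * freq l 0 \<le> \<bar>h k t * freq l k\<bar> * freq l k"
      using freq_mono[OF l] by (intro mult_left_mono) auto
    also have "\<dots> = \<bar>h k t * (freq l k)\<^sup>2\<bar>"
      using freq_pos[OF l, of k] by (simp add: abs_mult power2_eq_square)
    also have "\<dots> \<le> d k / t powr \<rho>" by (rule h2[OF t])
    finally show ?thesis
      unfolding divide_divide_eq_left[symmetric] by (subst pos_le_divide_eq[OF freq_pos[OF l]])
  qed
  define ux where "ux x t = (\<Sum>k. h k t * freq l k * cos (freq l k * x))" for x t
  define uxx where "uxx x t = (\<Sum>k. - (h k t * (freq l k)\<^sup>2 * sin (freq l k * x)))" for x t
  have dux: "((\<lambda>y. u y t) has_real_derivative ux x t) (at x within {0..l})" if x: "x \<in> {0..l}" and t: "t \<in> {0<..T}" for x t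
    unfolding u_def ux_def
  proof (rule has_real_derivative_suminf[OF _ _ _ d'(1)[of t] _ x])
    show "(e k t has_real_derivative h k t * freq l k * cos (freq l k * x)) (at x within {0..l})" for k x
      unfolding e_def[abs_def] by (auto intro!: derivative_eq_intros)
    show "\<bar>h k t * freq l k * cos (freq l k * x)\<bar> \<le> d k / (t powr \<rho> * freq l 0)" for k x
      by (rule sinb(2)[OF h1[OF t]])
  qed (use es t in auto)
  have duxx: "((\<lambda>y. ux y t) has_real_derivative uxx x t) (at x within {0..l})" if x: "x \<in> {0..l}" and t: "t \<in> {0<..T}" for x t
    unfolding ux_def uxx_def
  proof (rule has_real_derivative_suminf[OF _ _ _ d'(2)[of t] _ x])
    show "((\<lambda>x. h k t * freq l k * cos (freq l k * x)) has_real_derivative - (h k t * (freq l k)\<^sup>2 * sin (freq l k * x))) (at x within {0..l})" for k x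
      by (auto intro!: derivative_eq_intros simp: power2_eq_square)
    show "\<bar>- (h k t * (freq l k)\<^sup>2 * sin (freq l k * x))\<bar> \<le> d k / t powr \<rho>" for k x
      unfolding abs_minus_cancel by (rule sinb(1)[OF h2[OF t]])
    show "summable (\<lambda>k. h k t * freq l k * cos (freq l k * x))" for x
      by (rule summable_M_test[OF _ d'(1)[of t]]) (rule sinb(2)[OF h1[OF t]])
  qed auto
  have uxxs: "summable (\<lambda>k. - (h k t * (freq l k)\<^sup>2 * sin (freq l k * x)))" if t: "t \<in> {0<..T}" for x t
    by (intro summable_minus summable_M_test[OF _ d'(2)[of t]] sinb(1) h2 t)
  \<comment> \<open>Multiplied by t^\<rho> the series has a majorant independent of t. Continuity on
    the half-open time interval thus needs no exhaustion by smaller ones, and the weight is divided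
    out afterwards.\<close>
  have uxxc: "continuous_on ({0..l} \<times> {0<..T}) (\<lambda>(x, t). uxx x t)"
  proof -
    have "continuous_on ({0..l} \<times> {0<..T}) (\<lambda>z. \<Sum>k. snd z powr \<rho> * - (h k (snd z) * (freq l k)\<^sup>2 * sin (freq l k * fst z)))"
    proof (rule continuous_on_suminf[OF _ _ d])
      show "continuous_on ({0..l} \<times> {0<..T}) (\<lambda>z. snd z powr \<rho> * - (h k (snd z) * (freq l k)\<^sup>2 * sin (freq l k * fst z)))" for k
        by (intro continuous_intros continuous_on_compose2[OF hc]) auto
      fix k z assume z: "z \<in> {0..l} \<times> {0<..T}"
      then have t: "snd z \<in> {0<..T}" by auto
      have "snd z powr \<rho> * \<bar>h k (snd z) * (freq l k)\<^sup>2 * sin (freq l k * fst z)\<bar> \<le> snd z powr \<rho> * (d k / snd z powr \<rho>)"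
        by (intro mult_left_mono sinb(1)[OF h2[OF t]]) auto
      then show "\<bar>snd z powr \<rho> * - (h k (snd z) * (freq l k)\<^sup>2 * sin (freq l k * fst z))\<bar> \<le> d k"
        using t by (simp add: abs_mult)
    qed
    then have "continuous_on ({0..l} \<times> {0<..T}) (\<lambda>z. snd z powr (- \<rho>) * (\<Sum>k. snd z powr \<rho> * - (h k (snd z) * (freq l k)\<^sup>2 * sin (freq l k * fst z))))"
      by (intro continuous_on_mult) (auto intro!: continuous_intros)
    then show ?thesis
    proof (rule continuous_on_cong[THEN iffD1, rotated -1])
      fix z assume z: "z \<in> {0..l} \<times> {0<..T}"
      then have t: "snd z \<in> {0<..T}" by auto
      have "(\<Sum>k. snd z powr \<rho> * - (h k (snd z) * (freq l k)\<^sup>2 * sin (freq l k * fst z))) = snd z powr \<rho> * uxx (fst z) (snd z)"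
        unfolding uxx_def by (rule suminf_mult[OF uxxs[OF t]])
      then show "snd z powr (- \<rho>) * (\<Sum>k. snd z powr \<rho> * - (h k (snd z) * (freq l k)\<^sup>2 * sin (freq l k * fst z))) = (case z of (x, t) \<Rightarrow> uxx x t)"
        using t by (simp add: case_prod_unfold mult.assoc[symmetric] powr_add[symmetric])
    qed simp
  qed
  \<comment> \<open>Defined by the equation itself; that it is the fractional derivative of
    \<open>u\<close>, also at x = 0 and x = l, is shown in \<open>uD\<close>.\<close>
  define Du where "Du x t = \<sigma> t * uxx x t - q t * u x t + f x t" for x t
  \<comment> \<open>Joint continuity of \<open>f\<close> comes from its uniformly convergent sine
    series.\<close>
  have fc: "continuous_on ({0..l} \<times> {0..T}) (\<lambda>(x, t). f x t)"
  proof -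
    have "continuous_on ({0..l} \<times> {0..T}) (\<lambda>z. \<Sum>k. F k (snd z) * sin (freq l k * fst z))"
    proof (rule continuous_on_suminf[OF _ _ K(2)])
      show "continuous_on ({0..l} \<times> {0..T}) (\<lambda>z. F k (snd z) * sin (freq l k * fst z))" for k
        by (intro continuous_intros continuous_on_compose2[OF Fc]) auto
      show "\<bar>F k (snd z) * sin (freq l k * fst z)\<bar> \<le> K k" if "z \<in> {0..l} \<times> {0..T}" for k z
        using that by (intro sinb(1) K) auto
    qed
    then show ?thesis
      by (rule continuous_on_cong[THEN iffD1, rotated -1]) (use f in \<open>auto simp: sums_iff\<close>)
  qed
  have Duc: "continuous_on ({0..l} \<times> {0<..T}) (\<lambda>(x, t). Du x t)"
  proof -
    have sub: "{0..l} \<times> {0<..T} \<subseteq> {0..l} \<times> {0..T}" by auto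
    show ?thesis
      using uxxc continuous_on_subset[OF uc sub] continuous_on_subset[OF fc sub]
      unfolding Du_def case_prod_unfold
      by (intro continuous_intros continuous_on_compose2[OF \<sigma>c] continuous_on_compose2[OF qc]) auto
  qed
  have Dsum: "(\<Sum>k. w k t * sin (freq l k * x)) = Du x t" if x: "x \<in> {0..l}" and t: "t \<in> {0<..T}" for x t
  proof -
    have t': "t \<in> {0..T}" using t by auto
    have "(\<lambda>k. \<sigma> t * - (h k t * (freq l k)\<^sup>2 * sin (freq l k * x)) - q t * e k t x + F k t * sin (freq l k * x)) sums Du x t"
      unfolding Du_def
    proof (intro sums_add sums_diff sums_mult f x t')
      show "(\<lambda>k. - (h k t * (freq l k)\<^sup>2 * sin (freq l k * x))) sums uxx x t"
        unfolding uxx_def by (rule summable_sums[OF uxxs[OF t]])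
      show "(\<lambda>k. e k t x) sums u x t" unfolding u_def by (rule summable_sums[OF es[OF t']])
    qed
    also have "(\<lambda>k. \<sigma> t * - (h k t * (freq l k)\<^sup>2 * sin (freq l k * x)) - q t * e k t x + F k t * sin (freq l k * x)) =
      (\<lambda>k. w k t * sin (freq l k * x))"
    proof
      fix k
      have "w k t = F k t - (\<sigma> t * (freq l k)\<^sup>2 + q t) * h k t"
        using w(2)[OF t', of k] by (simp add: h_def a_def \<mu>_def)
      then show "\<sigma> t * - (h k t * (freq l k)\<^sup>2 * sin (freq l k * x)) - q t * e k t x + F k t * sin (freq l k * x) = w k t * sin (freq l k * x)"
        by (simp only: e_def) (simp add: algebra_simps)
    qed
    finally show ?thesis by (simp add: sums_iff)
  qed
  have uD: "has_caputo_deriv \<rho> (u x) t (Du x t)" if x: "x \<in> {0..l}" and t: "t \<in> {0<..T}" for x t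
  proof -
    have t0: "0 < t" "t \<le> T" using t by auto
    have sub: "continuous_on {0..s} g" if "continuous_on {0..T} g" "s \<le> t" for g :: "real \<Rightarrow> real" and s
      using that t0 by (auto intro: continuous_on_subset)
    have ec: "continuous_on {0..T} (\<lambda>t. e k t x)" for k unfolding e_def by (intro continuous_intros hc)
    have u1: "continuous_on {0..T} (u x)"
      unfolding u_def by (rule continuous_on_suminf[OF ec eb b])
    obtain M where M: "eventually (\<lambda>s. \<forall>w A C. continuous_on {0..t} w \<longrightarrow> 0 \<le> A \<longrightarrow> 0 \<le> C \<longrightarrow>
       (\<forall>x\<in>{0<..t}. \<bar>w x\<bar> \<le> A + C * x powr (- \<rho>)) \<longrightarrow>
       \<bar>caputo_trunc \<rho> (abel \<rho> w) t s\<bar> \<le> M * (A + C)) (at_left t)"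
      using caputo_trunc_abel_bounded[OF \<rho> t0(1)] by blast
    \<comment> \<open>The growth \<mu> k of \<open>a k\<close> cancels against the decay 1 / (\<mu>
      k * s^\<rho>) of \<open>h k\<close>. The coefficients become summable in k at the price of a
      singularity at s = 0.\<close>
    have wb: "\<bar>w k s\<bar> \<le> (K k + A * K k / \<alpha>) + A * (\<bar>c k\<bar> / (\<alpha> * \<epsilon>)) * s powr (- \<rho>)" if s: "s \<in> {0<..T}" for k s
    proof -
      have s': "s \<in> {0..T}" using s by auto
      have y: "1 / (1 + \<alpha> * \<mu> k * \<epsilon> * s powr \<rho>) \<le> 1 / (\<alpha> * \<mu> k * \<epsilon> * s powr \<rho>)"
        using \<alpha> \<mu>(2)[of k] \<epsilon> s by (intro divide_left_mono) (auto intro!: mult_pos_pos add_pos_pos)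
      have "\<bar>w k s\<bar> \<le> \<bar>F k s\<bar> + \<bar>a k s\<bar> * \<bar>h k s\<bar>"
        using abs_triangle_ineq4[of "F k s" "a k s * h k s"] w(2)[OF s', of k] by (simp add: h_def abs_mult)
      also have "\<dots> \<le> K k + A * \<mu> k * (\<bar>c k\<bar> * (1 / (\<alpha> * \<mu> k * \<epsilon> * s powr \<rho>)) + K k / (\<alpha> * \<mu> k))"
      proof (intro add_mono mult_mono K s' A)
        show "\<bar>h k s\<bar> \<le> \<bar>c k\<bar> * (1 / (\<alpha> * \<mu> k * \<epsilon> * s powr \<rho>)) + K k / (\<alpha> * \<mu> k)"
          using decay[OF s', of k] mult_left_mono[OF y abs_ge_zero, of "c k"] by linarith
      qed (use A \<mu>(2)[of k] in auto)
      also have "\<dots> = (K k + A * K k / \<alpha>) + A * (\<bar>c k\<bar> / (\<alpha> * \<epsilon>)) * s powr (- \<rho>)"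
        using \<alpha> \<mu>(2)[of k] \<epsilon> s by (simp add: powr_minus_divide field_simps)
      finally show ?thesis .
    qed
    define B where "B k = M * ((K k + A * K k / \<alpha>) + A * (\<bar>c k\<bar> / (\<alpha> * \<epsilon>)))" for k
    have B: "summable B" unfolding B_def by (intro summable_mult summable_add summable_divide K c)
    \<comment> \<open>The constant \<open>c k\<close> has zero truncated integral, so only the Abel
      part of the mode counts.\<close>
    have tr: "caputo_trunc \<rho> (\<lambda>t. e k t x) t s = sin (freq l k * x) * caputo_trunc \<rho> (abel \<rho> (w k)) t s"
      if s: "0 < s" "s < t" for k s
    proof -
      have wa: "continuous_on {0..s} (abel \<rho> (w k))" using s by (intro sub[OF continuous_on_abel[OF \<rho>(1) w(1)]]) auto
      have "(\<lambda>t. e k t x) = (\<lambda>t. sin (freq l k * x) * c k + sin (freq l k * x) * abel \<rho> (w k) t)"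
        by (simp add: e_def h_def fun_eq_iff algebra_simps)
      then show ?thesis
        using caputo_trunc_linear[OF s(2), of "\<lambda>_. c k" "abel \<rho> (w k)" \<rho> "sin (freq l k * x)" "sin (freq l k * x)"] wa
          caputo_trunc_const[OF s] by simp
    qed
    have "((\<lambda>s. \<Sum>k. sin (freq l k * x) * caputo_trunc \<rho> (abel \<rho> (w k)) t s) \<longlongrightarrow> (\<Sum>k. sin (freq l k * x) * (w k t * Gamma (1 - \<rho>)))) (at_left t)"
    \<comment> \<open>Tannery's theorem: each term converges, and \<open>M\<close>, which depends on
      t but not on the mode, turns \<open>wb\<close> into the summable majorant
      \<open>B\<close>.\<close>
    proof (rule tannerys_theorem[THEN conjunct2, THEN conjunct2])
      show "((\<lambda>s. sin (freq l k * x) * caputo_trunc \<rho> (abel \<rho> (w k)) t s) \<longlongrightarrow> sin (freq l k * x) * (w k t * Gamma (1 - \<rho>))) (at_left t)" for k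
        by (intro tendsto_mult_left caputo_trunc_abel_tendsto \<rho> t0 sub[OF w(1)]) auto
      have "eventually (\<lambda>s. \<forall>k. norm (sin (freq l k * x) * caputo_trunc \<rho> (abel \<rho> (w k)) t s) \<le> B k) (at_left t)"
        using M
      proof eventually_elim
        case (elim s)
        show ?case
        proof
          fix k
          have "\<bar>caputo_trunc \<rho> (abel \<rho> (w k)) t s\<bar> \<le> B k"
            unfolding B_def using wb t0 K0[of k] A(1) \<alpha> \<epsilon> sub[OF w(1)[of k]]
            by (intro elim[rule_format]) auto
          from sinb(1)[OF this, of "freq l k * x"]
          show "norm (sin (freq l k * x) * caputo_trunc \<rho> (abel \<rho> (w k)) t s) \<le> B k"
            by (subst mult.commute) simp
        qed
      qed
      from eventually_prodI[OF eventually_True this, of at_top]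
      show "eventually (\<lambda>(k, s). norm (sin (freq l k * x) * caputo_trunc \<rho> (abel \<rho> (w k)) t s) \<le> B k) (at_top \<times>\<^sub>F at_left t)"
        by eventually_elim auto
    qed (use B in \<open>auto simp: trivial_limit_at_left_real\<close>)
    moreover have "eventually (\<lambda>s. (\<Sum>k. sin (freq l k * x) * caputo_trunc \<rho> (abel \<rho> (w k)) t s) = caputo_trunc \<rho> (u x) t s) (at_left t)"
      unfolding eventually_at_left_field
    proof (intro exI[of _ 0] conjI allI impI t0)
      fix s assume s: "0 < s" "s < t"
      have "(\<lambda>k. caputo_trunc \<rho> (\<lambda>t. e k t x) t s) sums caputo_trunc \<rho> (\<lambda>t. \<Sum>k. e k t x) t s"
        by (rule caputo_trunc_sums[OF s sub[OF ec] _ b]) (use eb s t0 in auto)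
      then show "(\<Sum>k. sin (freq l k * x) * caputo_trunc \<rho> (abel \<rho> (w k)) t s) = caputo_trunc \<rho> (u x) t s"
        unfolding tr[OF s] by (simp add: sums_iff u_def[abs_def])
    qed
    ultimately have "((\<lambda>s. caputo_trunc \<rho> (u x) t s) \<longlongrightarrow> (\<Sum>k. sin (freq l k * x) * (w k t * Gamma (1 - \<rho>)))) (at_left t)"
      by (rule Lim_transform_eventually)
    moreover have "(\<Sum>k. sin (freq l k * x) * (w k t * Gamma (1 - \<rho>))) = Du x t * Gamma (1 - \<rho>)"
    proof -
      have "summable (\<lambda>k. w k t * sin (freq l k * x))"
      proof (rule summable_M_test)
        show "\<bar>w k t * sin (freq l k * x)\<bar> \<le> (K k + A * K k / \<alpha>) + A * (\<bar>c k\<bar> / (\<alpha> * \<epsilon>)) * t powr (- \<rho>)" for k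
          by (rule sinb(1)[OF wb[OF t]])
        show "summable (\<lambda>k. (K k + A * K k / \<alpha>) + A * (\<bar>c k\<bar> / (\<alpha> * \<epsilon>)) * t powr (- \<rho>))"
          by (intro summable_mult summable_mult2 summable_add summable_divide K c)
      qed
      from suminf_mult2[OF this, of "Gamma (1 - \<rho>)"] show ?thesis
        unfolding Dsum[OF x t] by (simp add: mult_ac)
    qed
    ultimately have "((\<lambda>s. caputo_trunc \<rho> (u x) t s / Gamma (1 - \<rho>)) \<longlongrightarrow> Du x t * Gamma (1 - \<rho>) / Gamma (1 - \<rho>)) (at_left t)"
      using G by (intro tendsto_divide tendsto_const) auto
    then show ?thesis
      using G t0 sub[OF u1] by (subst has_caputo_deriv_iff_trunc) auto
  qed
  have "classical_solution \<rho> l T \<sigma> q f \<phi> u"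
    unfolding classical_solution_def
  proof (rule conjI[OF uc], rule conjI[OF _ conjI], rule exI[of _ Du], rule exI[of _ ux], rule exI[of _ uxx], intro conjI)
    show "\<forall>x\<in>{0..l}. \<forall>t\<in>{0<..T}. has_caputo_deriv \<rho> (\<lambda>\<tau>. u x \<tau>) t (Du x t) \<and>
        ((\<lambda>y. u y t) has_real_derivative ux x t) (at x within {0..l}) \<and>
        ((\<lambda>y. ux y t) has_real_derivative uxx x t) (at x within {0..l})"
      using uD dux duxx by simp
    show "\<forall>x\<in>{0<..<l}. \<forall>t\<in>{0<..T}. Du x t - \<sigma> t * uxx x t + q t * u x t = f x t" by (simp add: Du_def)
    show "\<forall>x\<in>{0..l}. u x 0 = \<phi> x"
    proof
      fix x assume "x \<in> {0..l}"
      from \<phi>[OF this] show "u x 0 = \<phi> x" by (simp add: u_def e_def h0 sums_iff)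
    qed
    show "\<forall>t\<in>{0..T}. u 0 t = 0 \<and> u l t = 0" by (simp add: u_def e_def sin_freq_end[OF l])
  qed (rule uxxc Duc)+
  then show ?thesis by blast
qed

theorem theorem3p2:
  fixes \<rho> l T m\<sigma> M\<sigma> nq Nq :: real
    and \<sigma> q \<phi> :: "real \<Rightarrow> real" and f :: "real \<Rightarrow> real \<Rightarrow> real"
  assumes "0 < \<rho>" and "\<rho> < 1" and "l > 0" and "T > 0"
    and "continuous_on {0..T} \<sigma>"
    and "0 < m\<sigma>" and "\<And>t. t \<in> {0..T} \<Longrightarrow> m\<sigma> \<le> \<sigma> t \<and> \<sigma> t \<le> M\<sigma>"
    and "continuous_on {0..T} q"
    and "- (m\<sigma> * pi\<^sup>2 / l\<^sup>2) < nq" and "\<And>t. t \<in> {0..T} \<Longrightarrow> nq \<le> q t \<and> q t \<le> Nq"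
    and "Nq < (M\<sigma> - m\<sigma>) * pi\<^sup>2 / l\<^sup>2"
    and "continuous_into_sobolev T 3 l f"
    and "\<And>t. t \<in> {0..T} \<Longrightarrow> continuous_on {0..l} (\<lambda>x. f x t)"
    and "\<And>t. t \<in> {0..T} \<Longrightarrow> f 0 t = 0 \<and> f l t = 0"
    and "\<And>t. t \<in> {0..T} \<Longrightarrow> weak_deriv_vanishes_at_ends l 2 (\<lambda>x. f x t)"
    and "\<phi> \<in> sobolev_W2 1 l" and "continuous_on {0..l} \<phi>"
    and "\<phi> 0 = 0" and "\<phi> l = 0"
  shows "\<exists>u. classical_solution \<rho> l T \<sigma> q f \<phi> u \<and>
           (\<forall>v. classical_solution \<rho> l T \<sigma> q f \<phi> v \<longrightarrow>
              (\<forall>x\<in>{0..l}. \<forall>t\<in>{0..T}. v x t = u x t))"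
proof -
  note \<rho> = assms(1,2) and l = assms(3) and T = assms(4)
  have \<sigma>: "m\<sigma> \<le> \<sigma> t" and q: "nq \<le> q t" if "t \<in> {0..T}" for t
    using assms(7)[OF that] assms(10)[OF that] by auto
  obtain K where K: "\<And>k t. t \<in> {0..T} \<Longrightarrow> \<bar>sine_coeff l (\<lambda>x. f x t) k\<bar> \<le> K / (real (Suc k))\<^sup>2"
    and Fc: "\<And>k. continuous_on {0..T} (\<lambda>t. sine_coeff l (\<lambda>x. f x t) k)"
    using source_sine_coeffs[OF l less_imp_le[OF T] assms(12) _ assms(13,14)] by auto
  have Ks: "summable (\<lambda>k. K / (real (Suc k))\<^sup>2)"
    using summable_mult[OF summable_inverse_squares_Suc, of K] by simp
  \<comment> \<open>Continuity in x fixes the representative of \<open>f\<close>, so the series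
    converges to its value at every point and not just almost everywhere.\<close>
  have fs: "(\<lambda>k. sine_coeff l (\<lambda>x. f x t) k * sin (freq l k * x)) sums f x t"
    if x: "x \<in> {0..l}" and t: "t \<in> {0..T}" for x t
  proof (rule sine_series[OF l assms(13)[OF t] _ _ _ x])
    show "summable (\<lambda>k. \<bar>sine_coeff l (\<lambda>x. f x t) k\<bar>)"
      using K[OF t] by (intro summable_comparison_test'[OF Ks, of 0]) auto
  qed (use assms(14)[OF t] in auto)
  have cs: "summable (\<lambda>k. \<bar>sine_coeff l \<phi> k\<bar>)"
    by (rule summable_sine_coeff_W1[OF l assms(17,18,19,16)])
  have "\<exists>u. classical_solution \<rho> l T \<sigma> q f \<phi> u"
  proof (rule series_classical_solution[where F = "\<lambda>k t. sine_coeff l (\<lambda>x. f x t) k"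
        and c = "sine_coeff l \<phi>" and K = "\<lambda>k. K / (real (Suc k))\<^sup>2" and m = m\<sigma> and n = nq])
    show "(\<lambda>k. sine_coeff l \<phi> k * sin (freq l k * x)) sums \<phi> x" if "x \<in> {0..l}" for x
      by (rule sine_series[OF l assms(17,18,19) cs that])
    show "m\<sigma> \<le> \<sigma> t" "nq \<le> q t" if "t \<in> {0..T}" for t using \<sigma>[OF that] q[OF that] .
    show "continuous_on {0..T} (\<lambda>t. sine_coeff l (\<lambda>x. f x t) k)" for k by (rule Fc)
    show "\<bar>sine_coeff l (\<lambda>x. f x t) k\<bar> \<le> K / (real (Suc k))\<^sup>2" if "t \<in> {0..T}" for k t by (rule K[OF that])
    show "(\<lambda>k. sine_coeff l (\<lambda>x. f x t) k * sin (freq l k * x)) sums f x t"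
      if "x \<in> {0..l}" "t \<in> {0..T}" for x t by (rule fs[OF that])
  qed (rule \<rho> l T assms(5,6,8,9) Ks cs)+
  then obtain u where u: "classical_solution \<rho> l T \<sigma> q f \<phi> u" by blast
  have "v x t = u x t" if v: "classical_solution \<rho> l T \<sigma> q f \<phi> v" and "x \<in> {0..l}" "t \<in> {0..T}" for v x t
  proof (rule antisym)
    show "v x t \<le> u x t"
      by (rule classical_solution_le[OF \<rho> l T assms(6) _ assms(9) _ u v that(2,3)]) (use \<sigma> q in auto)
    show "u x t \<le> v x t"
      by (rule classical_solution_le[OF \<rho> l T assms(6) _ assms(9) _ v u that(2,3)]) (use \<sigma> q in auto)
  qed
  then show ?thesis using u by blast
qed

end
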